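(* Let $p$ be a probability distribution on $\mathbb{R}$ with mean $0$, variance $1$ and finite higher moments. Let $b_0,b_1,b_2,\dots$ be independent random variables, each with distribution $p$, and for each even $N$ let $A_N$ be the $N\times N$ real symmetric palindromic Toeplitz matrix built from $b_0,\dots,b_{N/2-1}$. Then, as $N\to\infty$ (through even integers), the normalized empirical spectral distribution $F^{A_N/\sqrt{N}}$ converges weakly, in probability and almost surely to $\Phi$, the cumulative distribution function of the standard Gaussian; in particular the limiting spectral distribution is $\Phi$, independently of $p$.
   Context: Throughout $N$ is even. The $N\times N$ real symmetric palindromic Toeplitz matrix $A_N$ built from $(b_0,\dots,b_{N/2-1})$ is the matrix with entries $a_{ij}=b_{\min(|i-j|,\,N-1-|i-j|)}$, $1\le i,j\le N$; so it is a real symmetric Toeplitz matrix whose first row is the palindrome $(b_0,b_1,\dots,b_{N/2-1},b_{N/2-1},\dots,b_1,b_0)$. The outcome space is the space of infinite sequences $A=(b_0,b_1,\dots)$ with the product probability measure $\mathbb{P}$ for which the $b_i$ are independent with $\mathrm{Prob}(b_i\in[\alpha_i,\beta_i])=\int_{\alpha_i}^{\beta_i}p(x)\,dx$; $A_N$ is obtained from $A$ by truncating to $(b_0,\dots,b_{N/2-1})$. "Finite higher moments" means all moments of $p$ are finite. For an $N\times N$ real symmetric matrix $A_N$ with eigenvalues $\lambda_N\ge\cdots\ge\lambda_1$, the normalized empirical spectral distribution is $F^{A_N/\sqrt{N}}(x)=\frac{1}{N}\#\{i\le N:\lambda_i/\sqrt{N}\le x\}$. If $F^{A_N/\sqrt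 N}$ converges in some sense (for example weakly or almost surely) to a distribution $F$, then $F$ is called the limiting spectral distribution of the ensemble. Also $\Phi(x)=\frac{1}{\sqrt{2\pi}}\int_{-\infty}^x e^{-t^2/2}\,dt$. Modes of convergence. Almost surely: with $\mathbb{P}$-probability $1$, $F^{A_N/\sqrt{N}}(x)\to\Phi(x)$ for every $x\in\mathbb{R}$. In probability, respectively weakly: for every $x\in\mathbb{R}$ the random variable $F^{A_N/\sqrt{N}}(x)$ converges to the constant $\Phi(x)$ in probability, respectively in distribution. (These are obtained via the corresponding convergence, for each integer $m\ge 0$, of the random moments $X_{m;N}(A)=\int_{-\infty}^\infty x^m\,dF^{A_N/\sqrt{N}}(x)$ to the $m$-th moment of the standard Gaussian.) *)

theory Defs
  imports "HOL-Probability.Probability" "Jordan_Normal_Form.Char_Poly"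
begin

text \<open>Indices run over \<open>0..<N\<close> instead of \<open>1..N\<close>; the entry depends only on \<open>\<bar>i - j\<bar>\<close>.
  For even \<open>N\<close> and \<open>d < N\<close> one has \<open>min d (N - 1 - d) < N div 2\<close>, so only
  \<open>b 0, \<dots>, b (N div 2 - 1)\<close> are used.\<close>

definition palindromic_toeplitz :: "nat \<Rightarrow> (nat \<Rightarrow> real) \<Rightarrow> real mat" where
  "palindromic_toeplitz N b =
     mat N N (\<lambda>(i, j). let d = nat \<bar>int i - int j\<bar> in b (min d (N - 1 - d)))"

text \<open>\<open>proots\<close> counts roots with multiplicity. A real symmetric \<open>N \<times> N\<close> matrix has \<open>N\<close> real
  eigenvalues, so for such a matrix no eigenvalue is lost by taking only real roots.\<close>

definition real_eigenvalues :: "real mat \<Rightarrow> real multiset" where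
  "real_eigenvalues A = proots (char_poly A)"

text \<open>The function \<open>x \<mapsto> F\<^bsup>A / \<surd>N\<^esup>(x)\<close>, where \<open>N\<close> is the dimension of \<open>A\<close>.\<close>

definition normalized_esd :: "real mat \<Rightarrow> real \<Rightarrow> real" where
  "normalized_esd A x =
     real (size {# l \<in># real_eigenvalues A. l / sqrt (real (dim_row A)) \<le> x #}) / real (dim_row A)"

definition std_normal_cdf :: "real \<Rightarrow> real" where
  "std_normal_cdf = cdf std_normal_distribution"

text \<open>Convergence of real random variables to a constant. Measurability is part of both notions:
  \<open>measure\<close> is \<open>0\<close> on non-measurable sets, and \<open>distr\<close> of a non-measurable function is not its law.\<close>

definition converges_in_probability ::
    "'a measure \<Rightarrow> (nat \<Rightarrow> 'a \<Rightarrow> real) \<Rightarrow> real \<Rightarrow> bool" where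
  "converges_in_probability M X c \<longleftrightarrow>
     (\<forall>n. X n \<in> borel_measurable M) \<and>
     (\<forall>\<epsilon>>0. (\<lambda>n. measure M {\<omega> \<in> space M. \<bar>X n \<omega> - c\<bar> > \<epsilon>}) \<longlonglongrightarrow> 0)"

definition converges_in_distribution ::
    "'a measure \<Rightarrow> (nat \<Rightarrow> 'a \<Rightarrow> real) \<Rightarrow> real \<Rightarrow> bool" where
  "converges_in_distribution M X c \<longleftrightarrow>
     (\<forall>n. X n \<in> borel_measurable M) \<and>
     weak_conv_m (\<lambda>n. distr M borel (X n)) (return borel c)"

end

theory Submission
  imports Defs "HOL-Real_Asymp.Real_Asymp"
begin

text \<open>For \<open>N = n + 1\<close> the top left \<open>n \<times> n\<close> block of \<open>A\<^sub>N\<close> is a symmetric circulant matrix, so its eigenvalues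
  \<open>\<lambda>\<^sub>k = b\<^sub>0 + 2 \<Sum>\<^sub>j b\<^sub>j cos (2\<pi>jk/n)\<close> are explicit, and by interlacing the spectral distribution of \<open>A\<^sub>N\<close>
  differs from theirs by \<open>O(1/N)\<close>. For \<open>k \<noteq> 0\<close>, \<open>\<lambda>\<^sub>k / \<surd>N\<close> is asymptotically standard Gaussian, uniformly in
  \<open>k\<close>, by a Lindeberg argument; this gives the limit of the expected averages of a test function over
  the spectrum. By Bessel's inequality for the cosine system, such an average has a gradient of
  squared length \<open>O(1/N)\<close> as a function of the \<open>b\<^sub>j\<close>. The Efron--Stein inequality, applied to the square
  of the centred average, turns this into a fourth central moment of order \<open>N\<^sup>-\<^sup>3\<^sup>/\<^sup>2\<close>, which is summable.\<close>

subsection \<open>Interlacing for bordered diagonal matrices\<close>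

text \<open>A squared gradient of order 1/N yields at best a variance of order 1/N, which is not
  summable over N; almost sure convergence therefore calls for a fourth moment. The exponent 3/2
  instead of 2 is the price of unbounded \<open>b j\<close>: Bessel bounds the gradient only in l^2,
  so one coordinate may carry most of it, and the fourth power of \<open>b j\<close> is traded for
  sqrt N plus its eighth power divided by sqrt N. This is where eighth moments enter. Increments are
  taken against the value 0 of a coordinate, so each is \<open>b j\<close> times a partial
  derivative up to a quadratic remainder. Test functions must accordingly have a bounded derivative
  and a quadratic Taylor remainder. The index k = 0 is exceptional because its coefficients do not
  oscillate: its limiting variance is 2, not 1. It is one of n eigenvalues, so it costs only O(1/N)
  in an average. The eigenvalues enter as a multiset of roots. Measurability of their counting
  function, a part of the two weaker modes of convergence, is extracted from the sign of the
  characteristic polynomial.\<close>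

text \<open>The characteristic polynomial of a diagonal matrix with entries \<open>v k\<close>,
  bordered by a row and column whose entries have squares \<open>c k\<close>, with corner
  \<open>a\<close>. It is the secular equation cleared of denominators, so it makes sense at the
  poles and for repeated \<open>v k\<close>. Working with the weights \<open>c k\<close> instead of
  the border entries lets weights of equal poles be added.\<close>

definition arrow_poly :: "'k set \<Rightarrow> real \<Rightarrow> ('k \<Rightarrow> real) \<Rightarrow> ('k \<Rightarrow> real) \<Rightarrow> real poly" where
  "arrow_poly K a v c = [:-a, 1:] * (\<Prod>k\<in>K. [:-v k, 1:]) -
     (\<Sum>k\<in>K. Polynomial.smult (c k) (\<Prod>l\<in>K-{k}. [:-v l, 1:]))"

lemma arrow_poly_reindex:
  assumes "bij_betw f I K"
  shows "arrow_poly K a v c = arrow_poly I a (v \<circ> f) (c \<circ> f)"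
proof -
  have inj: "inj_on f I" and im: "K = f ` I"
    using assms by (auto simp: bij_betw_def)
  have "(\<Prod>l\<in>K-{f i}. [:-v l, 1:]) = (\<Prod>l\<in>I-{i}. [:-v (f l), 1:])" if "i \<in> I" for i
  proof -
    have "K - {f i} = f ` (I - {i})"
      using inj that by (auto simp: im inj_on_def)
    then show ?thesis
      using inj by (simp add: prod.reindex inj_on_diff)
  qed
  then show ?thesis
    using inj by (simp add: arrow_poly_def im prod.reindex sum.reindex cong: sum.cong)
qed

lemma prod_linear_monic:
  fixes v :: "'k \<Rightarrow> real"
  assumes "finite K"
  shows "degree (\<Prod>k\<in>K. [:-v k, 1:]) = card K" "lead_coeff (\<Prod>k\<in>K. [:-v k, 1:]) = 1"
proof -
  show "degree (\<Prod>k\<in>K. [:-v k, 1:]) = card K"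
    using assms by (simp add: degree_prod_sum_eq)
  show "lead_coeff (\<Prod>k\<in>K. [:-v k, 1:]) = 1"
    unfolding lead_coeff_prod by simp
qed

lemma arrow_poly_monic:
  assumes "finite K"
  shows "degree (arrow_poly K a v c) = Suc (card K)" "lead_coeff (arrow_poly K a v c) = 1"
proof -
  let ?P = "[:-a, 1:] * (\<Prod>k\<in>K. [:-v k, 1:])"
  let ?S = "\<Sum>k\<in>K. Polynomial.smult (c k) (\<Prod>l\<in>K-{k}. [:-v l, 1:])"
  have P0: "(\<Prod>k\<in>K. [:-v k, 1:]) \<noteq> 0"
    using assms by (simp add: prod_zero_iff)
  have degP: "degree ?P = Suc (card K)"
    using P0 by (subst degree_mult_eq) (simp_all add: prod_linear_monic[OF assms])
  have lcP: "lead_coeff ?P = 1"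
    unfolding lead_coeff_mult prod_linear_monic(2)[OF assms] by simp
  have degS: "degree ?S \<le> card K"
  proof (rule degree_sum_le)
    fix k assume "k \<in> K"
    have "degree (Polynomial.smult (c k) (\<Prod>l\<in>K-{k}. [:-v l, 1:])) \<le> degree (\<Prod>l\<in>K-{k}. [:-v l, 1:])"
      by (rule degree_smult_le)
    also have "\<dots> = card (K - {k})"
      by (rule prod_linear_monic) (use assms in auto)
    also have "\<dots> \<le> card K"
      using assms by (intro card_mono) auto
    finally show "degree (Polynomial.smult (c k) (\<Prod>l\<in>K-{k}. [:-v l, 1:])) \<le> card K" .
  qed (use assms in auto)
  have less: "degree (- ?S) < degree ?P"
    using degS degP by simp
  have eq: "arrow_poly K a v c = - ?S + ?P"
    by (simp only: arrow_poly_def uminus_add_conv_diff)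
  have deg: "degree (arrow_poly K a v c) = degree ?P"
    unfolding eq by (rule degree_add_eq_right[OF less])
  have "lead_coeff (arrow_poly K a v c) = lead_coeff ?P"
    unfolding eq by (rule lead_coeff_add_le[OF less])
  with deg show "degree (arrow_poly K a v c) = Suc (card K)" "lead_coeff (arrow_poly K a v c) = 1"
    using degP lcP by simp_all
qed

text \<open>The intermediate value theorem produces all roots at once when the sign alternates along
  sufficiently many points.\<close>

lemma monic_poly_alternating:
  fixes Q :: "real poly" and e :: "nat \<Rightarrow> real"
  assumes deg: "degree Q = Suc n" and lc: "lead_coeff Q = 1"
    and e: "\<And>i. i \<le> n \<Longrightarrow> e i < e (Suc i)"
    and sgn: "\<And>i. i \<le> Suc n \<Longrightarrow> (-1) ^ (Suc n - i) * poly Q (e i) > 0"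
  obtains r where "\<And>i. i \<le> n \<Longrightarrow> e i < r i \<and> r i < e (Suc i)" "Q = (\<Prod>i\<le>n. [:-r i, 1:])"
proof -
  have "\<exists>x. e i < x \<and> x < e (Suc i) \<and> poly Q x = 0" if i: "i \<le> n" for i
  proof -
    define s :: real where "s = (-1) ^ (n - i)"
    have s: "s = 1 \<or> s = -1"
      by (simp add: s_def minus_one_power_iff)
    have "- s * poly Q (e i) > 0"
      using sgn[of i] i by (simp add: s_def Suc_diff_le)
    moreover have "s * poly Q (e (Suc i)) > 0"
      using sgn[of "Suc i"] i by (simp add: s_def)
    ultimately show ?thesis
      using s poly_IVT_pos[OF e[OF i], of Q] poly_IVT_neg[OF e[OF i], of Q] by auto
  qed
  then obtain r where r: "\<And>i. i \<le> n \<Longrightarrow> e i < r i \<and> r i < e (Suc i) \<and> poly Q (r i) = 0"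
    by metis
  have e_mono: "e i \<le> e j" if "i \<le> j" "j \<le> Suc n" for i j
    using that
  proof (induction rule: dec_induct)
    case (step k)
    then show ?case using e[of k] by simp
  qed simp
  have r_less: "r i < r j" if "i < j" "j \<le> n" for i j
    using r[of i] r[of j] e_mono[of "Suc i" j] that by simp
  have inj: "inj_on r {..n}"
    by (rule linorder_inj_onI) (use r_less in \<open>auto simp: less_le\<close>)
  let ?P = "\<Prod>i\<le>n. [:-r i, 1:]"
  have P: "degree ?P = Suc n" "lead_coeff ?P = 1"
    using prod_linear_monic[of "{..n}" r] by simp_all
  \<comment> \<open>Both polynomials are monic of degree \<open>Suc n\<close>, so the difference has
    degree at most \<open>n\<close>, yet it vanishes at the \<open>n + 1\<close> distinct points
    \<open>r i\<close>.\<close>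
  have "Q - ?P = 0"
  proof (rule ccontr)
    assume nz: "Q - ?P \<noteq> 0"
    have "coeff (Q - ?P) (Suc n) = 0"
      using deg lc P by simp
    moreover have "degree (Q - ?P) \<le> Suc n"
      by (rule degree_diff_le) (simp_all add: deg P)
    ultimately have "degree (Q - ?P) \<le> n"
      using nz by (metis le_SucE leading_coeff_0_iff)
    moreover have "card {x. poly (Q - ?P) x = 0} \<le> degree (Q - ?P)"
      using nz by (rule poly_roots_degree)
    moreover have "card (r ` {..n}) \<le> card {x. poly (Q - ?P) x = 0}"
    proof (intro card_mono poly_roots_finite nz)
      show "r ` {..n} \<subseteq> {x. poly (Q - ?P) x = 0}"
        using r by (auto simp: poly_prod)
    qed
    ultimately show False
      by (simp add: card_image[OF inj])
  qed
  then show ?thesis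
    using r by (intro that[of r]) auto
qed

text \<open>Replacing x by -x and correcting the sign gives a polynomial with leading coefficient 1,
  which is eventually at least 1.\<close>

lemma monic_poly_sign_at_minus_infinity:
  fixes Q :: "real poly"
  assumes lc: "lead_coeff Q = 1"
  obtains x where "x < B" "(-1) ^ degree Q * poly Q x > 0"
proof -
  let ?R = "Polynomial.smult ((-1) ^ degree Q) (Q \<circ>\<^sub>p [:0, -1:])"
  have "lead_coeff (Q \<circ>\<^sub>p [:0, -1:]) = (-1) ^ degree Q"
    by (subst lead_coeff_comp) (simp_all add: lc)
  then have "lead_coeff ?R = 1"
    by (subst lead_coeff_smult) (simp add: power_mult_distrib[symmetric])
  then obtain m where m: "\<And>x. x \<ge> m \<Longrightarrow> poly ?R x \<ge> 1"
    using poly_pinfty_gt_lc[of ?R] by auto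
  define x where "x = max m (\<bar>B\<bar> + 1)"
  have "poly ?R x \<ge> 1"
    by (rule m) (simp add: x_def)
  then show ?thesis
    by (intro that[of "-x"]) (auto simp: poly_pcompose x_def)
qed

definition count_le :: "real multiset \<Rightarrow> real \<Rightarrow> nat" where
  "count_le R y = size {#r \<in># R. r \<le> y#}"

text \<open>At a pole \<open>v i\<close> only the \<open>i\<close>-th summand survives, and its sign
  is determined by the number of poles above \<open>v i\<close>. Together with a point far to the
  left and one far to the right this gives \<open>n + 2\<close> points of alternating sign, hence
  one root in each of the \<open>n + 1\<close> gaps.\<close>

lemma arrow_poly_roots_sorted:
  fixes v :: "nat \<Rightarrow> real"
  assumes v: "\<And>i j. i < j \<Longrightarrow> j < n \<Longrightarrow> v i < v j" and c: "\<And>i. i < n \<Longrightarrow> c i > 0"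
  shows "\<exists>R. size R = Suc n \<and> arrow_poly {..<n} a v c = (\<Prod>r\<in>#R. [:-r, 1:]) \<and>
           (\<forall>y. card {k. k < n \<and> v k \<le> y} \<le> count_le R y \<and> count_le R y \<le> Suc (card {k. k < n \<and> v k \<le> y}))"
proof -
  define Q where "Q = arrow_poly {..<n} a v c"
  have degQ: "degree Q = Suc n" and lcQ: "lead_coeff Q = 1"
    using arrow_poly_monic[of "{..<n}" a v c] by (simp_all add: Q_def)
  have Qv: "(-1) ^ (n - i) * poly Q (v i) > 0" if i: "i < n" for i
  proof -
    have 1: "(\<Prod>k<n. v i - v k) = 0"
      using i by (intro prod_zero) auto
    have 2: "(\<Prod>l\<in>{..<n}-{k}. v i - v l) = 0" if "k < n" "k \<noteq> i" for k
      using i that by (intro prod_zero) auto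
    have "poly Q (v i) = - (\<Sum>k<n. c k * (\<Prod>l\<in>{..<n}-{k}. v i - v l))"
      using 1 by (simp add: Q_def arrow_poly_def poly_prod poly_sum)
    also have "(\<Sum>k<n. c k * (\<Prod>l\<in>{..<n}-{k}. v i - v l)) = c i * (\<Prod>l\<in>{..<n}-{i}. v i - v l)"
      using i by (subst sum.remove[of _ i]) (auto simp: 2)
    also have "{..<n} - {i} = {..<i} \<union> {i<..<n}"
      using i by auto
    also have "(\<Prod>l\<in>{..<i} \<union> {i<..<n}. v i - v l) = (\<Prod>l<i. v i - v l) * (\<Prod>l\<in>{i<..<n}. - (v l - v i))"
      by (subst prod.union_disjoint) auto
    also have "(\<Prod>l\<in>{i<..<n}. - (v l - v i)) = (-1) ^ (n - Suc i) * (\<Prod>l\<in>{i<..<n}. v l - v i)"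
      using prod.distrib[of "\<lambda>_. -1" "\<lambda>l. v l - v i" "{i<..<n}"] by simp
    finally have eq: "poly Q (v i) = - (c i * ((\<Prod>l<i. v i - v l) * ((-1) ^ (n - Suc i) * (\<Prod>l\<in>{i<..<n}. v l - v i))))" .
    have "(-1::real) ^ (n - i) = - ((-1) ^ (n - Suc i))"
      using i by (simp add: Suc_diff_Suc[symmetric] del: Suc_diff_Suc)
    moreover have "(-1::real) ^ (n - Suc i) * (-1) ^ (n - Suc i) = 1"
      by (simp add: power_mult_distrib[symmetric])
    ultimately have "(-1) ^ (n - i) * poly Q (v i) = c i * ((\<Prod>l<i. v i - v l) * (\<Prod>l\<in>{i<..<n}. v l - v i))"
      unfolding eq by (simp add: algebra_simps)
    also have "\<dots> > 0"
      using i v c by (intro mult_pos_pos prod_pos) auto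
    finally show ?thesis .
  qed
  obtain lo where lo: "lo < (if n = 0 then 0 else v 0)" "(-1) ^ Suc n * poly Q lo > 0"
    using monic_poly_sign_at_minus_infinity[OF lcQ] degQ by metis
  obtain m where m: "\<And>x. x \<ge> m \<Longrightarrow> poly Q x \<ge> 1"
    using poly_pinfty_gt_lc[of Q] lcQ by auto
  define hi where "hi = max m (\<bar>if n = 0 then 0 else v (n - 1)\<bar> + 1)"
  \<comment> \<open>The poles are shifted by one place to make room for \<open>lo\<close>, so the
    root \<open>r i\<close> lies between \<open>v (i - 1)\<close> and \<open>v i\<close>.\<close>
  define e where "e i = (if i = 0 then lo else if i = Suc n then hi else v (i - 1))" for i
  have e_mono: "e i < e (Suc i)" if "i \<le> n" for i
    using that lo(1) v[of "i - 1" i] by (cases "i = n"; cases "i = 0") (auto simp: e_def hi_def)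
  have e_sgn: "(-1) ^ (Suc n - i) * poly Q (e i) > 0" if i: "i \<le> Suc n" for i
  proof -
    consider "i = 0" | "i = Suc n" | "0 < i" "i \<le> n" using i by linarith
    then show ?thesis
    proof cases
      case 2
      then show ?thesis using m[of hi] by (simp add: e_def hi_def)
    next
      case 3
      then show ?thesis using Qv[of "i - 1"] by (cases i) (simp_all add: e_def)
    qed (use lo in \<open>simp_all add: e_def\<close>)
  qed
  obtain r where r: "\<And>i. i \<le> n \<Longrightarrow> e i < r i \<and> r i < e (Suc i)" "Q = (\<Prod>i\<le>n. [:-r i, 1:])"
    using monic_poly_alternating[OF degQ lcQ e_mono e_sgn] by blast
  define R where "R = image_mset r (mset_set {..n})"
  have cR: "count_le R y = card {i. i \<le> n \<and> r i \<le> y}" for y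
    by (simp add: count_le_def R_def filter_mset_image_mset)
  have "card {k. k < n \<and> v k \<le> y} \<le> count_le R y" for y
    unfolding cR
  proof (rule card_mono)
    show "{k. k < n \<and> v k \<le> y} \<subseteq> {i. i \<le> n \<and> r i \<le> y}"
    proof
      fix k assume k: "k \<in> {k. k < n \<and> v k \<le> y}"
      then have "r k < v k"
        using r(1)[of k] by (simp add: e_def)
      then show "k \<in> {i. i \<le> n \<and> r i \<le> y}"
        using k by simp
    qed
  qed simp
  moreover have "count_le R y \<le> Suc (card {k. k < n \<and> v k \<le> y})" for y
  proof -
    \<comment> \<open>The root \<open>r (Suc k)\<close> lies to the right of \<open>v k\<close>;
      only \<open>r 0\<close> has no pole to its left.\<close>
    have "{i. i \<le> n \<and> r i \<le> y} \<subseteq> insert 0 (Suc ` {k. k < n \<and> v k \<le> y})"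
    proof
      fix i assume i: "i \<in> {i. i \<le> n \<and> r i \<le> y}"
      show "i \<in> insert 0 (Suc ` {k. k < n \<and> v k \<le> y})"
        using i r(1)[of i] by (cases i) (auto simp: e_def)
    qed
    then have "count_le R y \<le> card (insert 0 (Suc ` {k. k < n \<and> v k \<le> y}))"
      unfolding cR by (rule card_mono[rotated]) simp
    also have "\<dots> \<le> Suc (card {k. k < n \<and> v k \<le> y})"
      by (simp add: card_insert_if card_image)
    finally show ?thesis .
  qed
  moreover have "Q = (\<Prod>r\<in>#R. [:-r, 1:])"
    unfolding r(2) R_def by (simp add: image_mset.compositionality comp_def prod_unfold_prod_mset)
  ultimately show ?thesis
    unfolding Q_def[symmetric] by (intro exI[of _ R]) (auto simp: R_def)
qed

text \<open>A pole of weight 0 splits off at once. A repeated pole splits off after its weight has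
  been moved to another index \<open>m\<close> with the same value. The conditional in
  \<open>c'\<close> covers both cases, since for \<open>c k = 0\<close> it adds 0 whatever
  \<open>m\<close> is.\<close>

lemma arrow_poly_factor:
  assumes K: "finite K" "k \<in> K"
    and c': "\<And>j. j \<in> K - {k} \<Longrightarrow> c' j = c j + (if v j = v k \<and> j = m then c k else 0)"
    and ck: "c k = 0 \<or> m \<in> K - {k} \<and> v m = v k"
  shows "arrow_poly K a v c = [:-v k, 1:] * arrow_poly (K - {k}) a v c'"
proof -
  let ?f = "\<lambda>l. [:-v l, 1:]"
  let ?K = "K - {k}"
  have fin: "finite ?K" using K by simp
  have P: "(\<Prod>l\<in>K. ?f l) = ?f k * (\<Prod>l\<in>?K. ?f l)"
    using K by (rule prod.remove)
  have Pj: "(\<Prod>l\<in>K-{j}. ?f l) = ?f k * (\<Prod>l\<in>?K-{j}. ?f l)" if "j \<in> ?K" for j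
  proof -
    have "(\<Prod>l\<in>K-{j}. ?f l) = ?f k * (\<Prod>l\<in>K-{j}-{k}. ?f l)"
      by (rule prod.remove) (use K that in auto)
    also have "K - {j} - {k} = ?K - {j}" by auto
    finally show ?thesis .
  qed
  have "(\<Sum>j\<in>?K. Polynomial.smult (c' j) (\<Prod>l\<in>?K-{j}. ?f l)) =
        (\<Sum>j\<in>?K. Polynomial.smult (c j) (\<Prod>l\<in>?K-{j}. ?f l)) +
        (\<Sum>j\<in>?K. if j = m then (if v j = v k then Polynomial.smult (c k) (\<Prod>l\<in>?K-{j}. ?f l) else 0) else 0)"
    by (subst sum.distrib[symmetric], rule sum.cong) (auto simp: c' smult_add_left)
  also have "(\<Sum>j\<in>?K. if j = m then (if v j = v k then Polynomial.smult (c k) (\<Prod>l\<in>?K-{j}. ?f l) else 0) else 0) =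
        (if m \<in> ?K \<and> v m = v k then Polynomial.smult (c k) (\<Prod>l\<in>?K-{m}. ?f l) else 0)"
    using fin by (simp add: sum.delta)
  finally have S: "?f k * (\<Sum>j\<in>?K. Polynomial.smult (c' j) (\<Prod>l\<in>?K-{j}. ?f l)) =
        ?f k * (\<Sum>j\<in>?K. Polynomial.smult (c j) (\<Prod>l\<in>?K-{j}. ?f l)) +
        ?f k * (if m \<in> ?K \<and> v m = v k then Polynomial.smult (c k) (\<Prod>l\<in>?K-{m}. ?f l) else 0)"
    by (simp only: distrib_left)
  have "?f k * (if m \<in> ?K \<and> v m = v k then Polynomial.smult (c k) (\<Prod>l\<in>?K-{m}. ?f l) else 0) = Polynomial.smult (c k) (\<Prod>l\<in>?K. ?f l)"
  proof (cases "m \<in> ?K \<and> v m = v k")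
    case True
    then have "(\<Prod>l\<in>?K. ?f l) = ?f k * (\<Prod>l\<in>?K-{m}. ?f l)"
      using prod.remove[OF fin, of m ?f] by simp
    then show ?thesis using True by simp
  qed (use ck in auto)
  moreover have "?f k * (\<Sum>j\<in>?K. Polynomial.smult (c j) (\<Prod>l\<in>?K-{j}. ?f l)) = (\<Sum>j\<in>?K. Polynomial.smult (c j) (\<Prod>l\<in>K-{j}. ?f l))"
    unfolding sum_distrib_left by (rule sum.cong) (simp_all only: Pj mult_smult_right)
  ultimately have "?f k * (\<Sum>j\<in>?K. Polynomial.smult (c' j) (\<Prod>l\<in>?K-{j}. ?f l)) = (\<Sum>j\<in>K. Polynomial.smult (c j) (\<Prod>l\<in>K-{j}. ?f l))"
    unfolding S using K by (simp add: sum.remove[of K k])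
  then show ?thesis
    unfolding arrow_poly_def P right_diff_distrib by (simp only: mult.left_commute[of "[:-a, 1:]"])
qed

lemma card_le_remove:
  fixes v :: "'k \<Rightarrow> real"
  assumes "finite K" "k \<in> K"
  shows "card {l \<in> K. v l \<le> y} = (if v k \<le> y then 1 else 0) + card {l \<in> K - {k}. v l \<le> y}"
proof -
  have "{l \<in> K. v l \<le> y} = (if v k \<le> y then {k} else {}) \<union> {l \<in> K - {k}. v l \<le> y}"
    using assms by auto
  also have "card \<dots> = (if v k \<le> y then 1 else 0) + card {l \<in> K - {k}. v l \<le> y}"
    using assms by (subst card_Un_disjoint) auto
  finally show ?thesis .
qed

text \<open>Cauchy interlacing for a diagonal matrix bordered by one row and column: vanishing weights and
  repeated poles split off a linear factor, and otherwise the sign alternates along the poles.\<close>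

lemma arrow_poly_interlacing:
  assumes "finite K" "\<And>k. k \<in> K \<Longrightarrow> c k \<ge> 0"
  shows "\<exists>R. size R = Suc (card K) \<and> arrow_poly K a v c = (\<Prod>r\<in>#R. [:-r, 1:]) \<and>
           (\<forall>y. card {k \<in> K. v k \<le> y} \<le> count_le R y \<and> count_le R y \<le> Suc (card {k \<in> K. v k \<le> y}))"
  using assms
proof (induction "card K" arbitrary: K c)
  case 0
  then have "K = {}" by simp
  then show ?case
    using arrow_poly_roots_sorted[of 0 "\<lambda>_. 0" "\<lambda>_. 0" a] by (simp add: arrow_poly_def)
next
  case (Suc n)
  show ?case
  proof (cases "\<exists>k\<in>K. c k = 0 \<or> (\<exists>m\<in>K-{k}. v m = v k)")
    case True
    then obtain k m where k: "k \<in> K" and ck: "c k = 0 \<or> m \<in> K - {k} \<and> v m = v k" by blast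
    define c' where "c' j = c j + (if v j = v k \<and> j = m then c k else 0)" for j
    have card: "n = card (K - {k})" "Suc (card (K - {k})) = card K"
      using Suc.hyps(2) Suc.prems(1) k by (simp_all add: card_Diff_singleton)
    obtain R where R: "size R = Suc (card (K - {k}))" "arrow_poly (K - {k}) a v c' = (\<Prod>r\<in>#R. [:-r, 1:])"
      and Ry: "\<And>y. card {l \<in> K - {k}. v l \<le> y} \<le> count_le R y \<and> count_le R y \<le> Suc (card {l \<in> K - {k}. v l \<le> y})"
      using Suc.hyps(1)[OF card(1), of c'] Suc.prems k by (force simp: c'_def)
    have "arrow_poly K a v c = [:-v k, 1:] * arrow_poly (K - {k}) a v c'"
      by (rule arrow_poly_factor[where m = m]) (use Suc.prems k ck in \<open>auto simp: c'_def\<close>)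
    \<comment> \<open>The root \<open>v k\<close> that was split off adds one to the root count and
      to the pole count for the same \<open>y\<close>, so the interlacing bounds persist.\<close>
    then show ?thesis
      using R Ry card(2) card_le_remove[OF Suc.prems(1) k, of v]
      by (intro exI[of _ "add_mset (v k) R"]) (auto simp: count_le_def)
  next
    case False
    then have inj: "inj_on v K" and pos: "\<And>k. k \<in> K \<Longrightarrow> c k > 0"
      using Suc.prems by (auto simp: inj_on_def less_le)
    \<comment> \<open>Now all weights are positive and the poles are distinct, so listing them in
      increasing order reduces to the sorted case.\<close>
    define xs where "xs = sorted_list_of_set (v ` K)"
    have xs: "sorted xs" "distinct xs" "set xs = v ` K" "length xs = card K"
      using Suc.prems inj by (simp_all add: xs_def card_image)
    define f where "f i = the_inv_into K v (xs ! i)" for i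
    have xsK: "xs ! i \<in> v ` K" if "i < card K" for i
      using that xs nth_mem by metis
    have vf: "v (f i) = xs ! i" if "i < card K" for i
      using xsK[OF that] inj by (simp add: f_def f_the_inv_into_f)
    have fK: "f i \<in> K" if "i < card K" for i
      using xsK[OF that] inj by (simp add: f_def the_inv_into_into)
    have mono: "(v \<circ> f) i < (v \<circ> f) j" if "i < j" "j < card K" for i j
      using that xs by (simp add: vf sorted_wrt_nth_less strict_sorted_iff)
    have injf: "inj_on f {..<card K}"
    proof (rule inj_onI)
      fix i j assume "i \<in> {..<card K}" "j \<in> {..<card K}" "f i = f j"
      then show "i = j"
        using mono[of i j] mono[of j i] by (cases i j rule: linorder_cases) auto
    qed
    have imf: "f ` {..<card K} = K"
      by (rule card_subset_eq) (use Suc.prems fK injf in \<open>auto simp: card_image\<close>)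
    with injf have bij: "bij_betw f {..<card K} K"
      by (simp add: bij_betw_def)
    have eq: "card {k \<in> K. v k \<le> y} = card {k. k < card K \<and> (v \<circ> f) k \<le> y}" for y
    proof -
      have "{k \<in> f ` {..<card K}. v k \<le> y} = f ` {k. k < card K \<and> (v \<circ> f) k \<le> y}"
        by auto
      moreover have "inj_on f {k. k < card K \<and> (v \<circ> f) k \<le> y}"
        by (rule inj_on_subset[OF injf]) auto
      ultimately show ?thesis
        by (simp add: imf card_image)
    qed
    show ?thesis
      unfolding arrow_poly_reindex[OF bij] eq
      by (rule arrow_poly_roots_sorted[OF mono]) (use fK pos in auto)
  qed
qed

subsection \<open>Symmetric circulant matrices\<close>

lemma sum_cis_roots_of_unity:
  fixes m :: int
  assumes n: "n > 0"
  shows "(\<Sum>j<n. cis (2 * pi * (real j * m) / n)) = (if int n dvd m then of_nat n else 0)"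
proof -
  define w where "w = cis (2 * pi * m / n)"
  have pow: "cis (2 * pi * (real j * m) / n) = w ^ j" for j
    unfolding w_def Complex.DeMoivre by (rule arg_cong[where f = cis]) (simp add: field_simps)
  have "w ^ n = cis (2 * pi * m)"
    unfolding w_def Complex.DeMoivre using n by (intro arg_cong[where f = cis]) (simp add: field_simps)
  then have wn: "w ^ n = 1"
    by (simp add: cis_multiple_2pi)
  have w1: "w = 1 \<longleftrightarrow> int n dvd m"
  proof
    assume "w = 1"
    then have "cos (2 * pi * m / n) = 1"
      by (simp add: w_def complex_eq_iff)
    then obtain k :: int where "2 * pi * m / n = of_int k * 2 * pi"
      by (auto simp: cos_one_2pi_int)
    then have "real_of_int m = of_int (int n * k)"
      using n by (simp add: field_simps)
    then show "int n dvd m"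
      by (simp only: of_int_eq_iff dvd_triv_left)
  next
    assume "int n dvd m"
    then obtain k where "m = int n * k" ..
    then have "w = cis (2 * pi * k)"
      unfolding w_def using n by (simp add: field_simps)
    then show "w = 1"
      by (simp add: cis_multiple_2pi)
  qed
  show ?thesis
    unfolding pow using wn w1 geometric_sum[of w n] by (cases "w = 1") auto
qed

lemma sum_cos_roots_of_unity:
  fixes m :: int
  assumes "n > 0"
  shows "(\<Sum>j<n. cos (2 * pi * (real j * m) / n)) = (if int n dvd m then n else 0)"
  using arg_cong[OF sum_cis_roots_of_unity[OF assms, of m], of Re] by (simp add: if_distrib cong: if_cong)

lemma sum_sin_roots_of_unity:
  fixes m :: int
  assumes "n > 0"
  shows "(\<Sum>j<n. sin (2 * pi * (real j * m) / n)) = 0"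
  using arg_cong[OF sum_cis_roots_of_unity[OF assms, of m], of Im] by (simp add: if_distrib cong: if_cong)

lemma int_dvd_diff_iff:
  fixes k l n :: nat
  assumes "k < n" "l < n"
  shows "int n dvd (int k - int l) \<longleftrightarrow> k = l"
proof
  assume "int n dvd (int k - int l)"
  then have "int k mod int n = int l mod int n"
    by (simp add: mod_eq_dvd_iff)
  then show "k = l" using assms by simp
qed simp

text \<open>The kernel of the discrete Hartley transform. Using cos + sin in place of complex
  exponentials gives a real symmetric matrix that is its own inverse, so the diagonalisation stays
  over the reals.\<close>

definition hartley :: "nat \<Rightarrow> nat \<Rightarrow> nat \<Rightarrow> real" where
  "hartley n i k = (let x = 2 * pi * (real i * real k) / n in (cos x + sin x) / sqrt n)"

lemma hartley_sym: "hartley n i k = hartley n k i"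
  by (simp add: hartley_def mult.commute)

text \<open>The product of the two kernels is cos of the difference plus sin of the sum of the
  angles. Summed over \<open>j\<close>, the sines always cancel, and the cosines detect divisibility
  of \<open>k - l\<close> by \<open>n\<close>.\<close>

lemma hartley_orthogonal:
  assumes n: "n > 0" and "k < n" "l < n"
  shows "(\<Sum>j<n. hartley n k j * hartley n j l) = (if k = l then 1 else 0)"
proof -
  let ?x = "\<lambda>j m. 2 * pi * (real j * of_int m) / n"
  have "hartley n k j * hartley n j l = (cos (?x j (int k - int l)) + sin (?x j (int k + int l))) / n" for j
  proof -
    have 1: "?x j (int k - int l) = ?x j (int k) - ?x j (int l)" "?x j (int k + int l) = ?x j (int k) + ?x j (int l)"
      by (simp_all add: algebra_simps diff_divide_distrib add_divide_distrib)
    have "hartley n k j = (cos (?x j (int k)) + sin (?x j (int k))) / sqrt n" for k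
      by (simp add: hartley_def mult.commute Let_def)
    then have "hartley n k j * hartley n j l =
        (cos (?x j (int k)) + sin (?x j (int k))) * (cos (?x j (int l)) + sin (?x j (int l))) / (sqrt n * sqrt n)"
      unfolding hartley_sym[of n j l] by simp
    also have "sqrt n * sqrt n = n" by simp
    finally show ?thesis
      unfolding 1 cos_diff sin_add by (simp add: algebra_simps)
  qed
  then have "(\<Sum>j<n. hartley n k j * hartley n j l) =
      ((\<Sum>j<n. cos (?x j (int k - int l))) + (\<Sum>j<n. sin (?x j (int k + int l)))) / n"
    by (simp add: sum_divide_distrib[symmetric] sum.distrib)
  also have "\<dots> = (if int n dvd (int k - int l) then 1 else 0)"
    unfolding sum_cos_roots_of_unity[OF n] sum_sin_roots_of_unity[OF n] using n by simp
  also have "int n dvd (int k - int l) \<longleftrightarrow> k = l"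
    using assms by (intro int_dvd_diff_iff)
  finally show ?thesis .
qed

text \<open>The argument of \<open>b\<close> is the distance of 0 and \<open>d\<close> on a cycle of
  length \<open>n\<close>. At \<open>d = n\<close> the value is \<open>b 0\<close> again, as the
  corner of the palindrome requires.\<close>

definition circ_entry :: "nat \<Rightarrow> (nat \<Rightarrow> real) \<Rightarrow> nat \<Rightarrow> real" where
  "circ_entry n b d = b (min d (n - d))"

definition circ_eig :: "nat \<Rightarrow> (nat \<Rightarrow> real) \<Rightarrow> nat \<Rightarrow> real" where
  "circ_eig n b k = (\<Sum>d<n. circ_entry n b d * cos (2 * pi * (real d * real k) / n))"

lemma cyclic_diff:
  fixes n i j :: nat
  assumes "i < n" "j < n"
  shows "(i + n - j) mod n = (if j \<le> i then i - j else i + n - j)"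
  using assms by (auto simp: mod_if)

lemma bij_betw_cyclic_diff:
  fixes i n :: nat
  assumes i: "i < n"
  shows "bij_betw (\<lambda>j. (i + n - j) mod n) {..<n} {..<n}"
  by (rule bij_betwI[where g = "\<lambda>j. (i + n - j) mod n"]) (use i in \<open>auto simp: cyclic_diff\<close>)

text \<open>Substituting the cyclic difference turns the kernel at \<open>j\<close> into cos + sin
  of a difference of angles. The addition formulas leave a cosine sum, which is the eigenvalue, and
  a sine sum, which vanishes because the circulant row is even under \<open>d\<close> to
  \<open>n - d\<close> while the sine is odd.\<close>

lemma circ_eigenvector:
  assumes n: "n > 0" and i: "i < n"
  shows "(\<Sum>j<n. circ_entry n b (nat \<bar>int i - int j\<bar>) * hartley n j k) = circ_eig n b k * hartley n i k"
proof -
  define x where "x d = 2 * pi * (real d * real k) / n" for d :: nat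
  define c where "c d = circ_entry n b d" for d
  have csym: "c ((i' + n - d) mod n) = c (nat \<bar>int i' - int d\<bar>)" if "i' < n" "d < n" for i' d
    using that by (auto simp: cyclic_diff c_def circ_entry_def min_def nat_abs_int_diff intro!: arg_cong[where f = b])
  have trig: "cos (x ((i' + n - d) mod n)) = cos (x i' - x d) \<and> sin (x ((i' + n - d) mod n)) = sin (x i' - x d)"
    if "i' < n" "d < n" for i' d
  proof (cases "d \<le> i'")
    case True
    then have "x ((i' + n - d) mod n) = x i' - x d"
      using that by (simp add: cyclic_diff x_def of_nat_diff algebra_simps diff_divide_distrib)
    then show ?thesis by simp
  next
    case False
    \<comment> \<open>Wrapping around adds \<open>n\<close> to the index, that is, \<open>k\<close>
      full turns to the angle.\<close>
    have eq: "x ((i' + n - d) mod n) = (x i' - x d) + 2 * real k * pi"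
      using that False n by (simp add: cyclic_diff x_def of_nat_diff field_simps)
    show ?thesis
      unfolding eq cos_add[of "x i' - x d"] sin_add[of "x i' - x d"] cos_2npi sin_2npi by simp
  qed
  have anti: "(\<Sum>d<n. c d * sin (x d)) = 0"
  proof -
    have "(\<Sum>d<n. c d * sin (x d)) = (\<Sum>d<n. c ((0 + n - d) mod n) * sin (x ((0 + n - d) mod n)))"
      using sum.reindex_bij_betw[OF bij_betw_cyclic_diff[OF n], of "\<lambda>d. c d * sin (x d)"] by simp
    also have "\<dots> = (\<Sum>d<n. - (c d * sin (x d)))"
    proof (rule sum.cong[OF refl])
      fix d assume "d \<in> {..<n}"
      then have d: "d < n" by simp
      have "sin (x ((0 + n - d) mod n)) = - sin (x d)"
        using trig[OF n d] by (simp add: x_def)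
      then show "c ((0 + n - d) mod n) * sin (x ((0 + n - d) mod n)) = - (c d * sin (x d))"
        using csym[OF n d] by simp
    qed
    finally show ?thesis by (simp add: sum_negf)
  qed
  have "(\<Sum>j<n. c (nat \<bar>int i - int j\<bar>) * (cos (x j) + sin (x j))) =
      (\<Sum>j<n. c (nat \<bar>int i - int ((i + n - j) mod n)\<bar>) * (cos (x ((i + n - j) mod n)) + sin (x ((i + n - j) mod n))))"
    using sum.reindex_bij_betw[OF bij_betw_cyclic_diff[OF i], of "\<lambda>j. c (nat \<bar>int i - int j\<bar>) * (cos (x j) + sin (x j))"] by simp
  also have "\<dots> = (\<Sum>d<n. c d * (cos (x i - x d) + sin (x i - x d)))"
  proof (rule sum.cong[OF refl])
    fix d assume "d \<in> {..<n}"
    then have d: "d < n" by simp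
    have inv: "(i + n - (i + n - d) mod n) mod n = d"
      using i d by (auto simp: cyclic_diff)
    have "c (nat \<bar>int i - int ((i + n - d) mod n)\<bar>) = c d"
      using csym[OF i, of "(i + n - d) mod n"] n unfolding inv by simp
    then show "c (nat \<bar>int i - int ((i + n - d) mod n)\<bar>) * (cos (x ((i + n - d) mod n)) + sin (x ((i + n - d) mod n))) =
        c d * (cos (x i - x d) + sin (x i - x d))"
      using trig[OF i d] by simp
  qed
  also have "\<dots> = (cos (x i) + sin (x i)) * (\<Sum>d<n. c d * cos (x d)) + (sin (x i) - cos (x i)) * (\<Sum>d<n. c d * sin (x d))"
    by (simp add: cos_diff sin_diff sum_distrib_left sum.distrib[symmetric] algebra_simps)
  finally have "(\<Sum>j<n. c (nat \<bar>int i - int j\<bar>) * (cos (x j) + sin (x j))) = (cos (x i) + sin (x i)) * circ_eig n b k"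
    unfolding anti by (simp add: circ_eig_def c_def x_def)
  then have "(\<Sum>j<n. c (nat \<bar>int i - int j\<bar>) * (cos (x j) + sin (x j))) / sqrt n = circ_eig n b k * ((cos (x i) + sin (x i)) / sqrt n)"
    by simp
  then show ?thesis
    by (simp add: hartley_def c_def x_def Let_def sum_divide_distrib)
qed

section \<open>Characteristic polynomial of an arrow matrix\<close>

lemma det_diagonal:
  "det (mat n n (\<lambda>(i, j). if i = j then f i else 0)) = (\<Prod>i<n. f i)" for f :: "nat \<Rightarrow> real"
proof -
  let ?D = "mat n n (\<lambda>(i, j). if i = j then f i else 0)"
  have "det ?D = prod_list (diag_mat ?D)"
    by (rule det_upper_triangular[of _ n]) auto
  also have "diag_mat ?D = map f [0..<n]"
    by (auto simp: diag_mat_def)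
  also have "prod_list \<dots> = (\<Prod>i<n. f i)"
    by (simp add: prod.distinct_set_conv_list[symmetric] atLeast0LessThan)
  finally show ?thesis .
qed

definition arrow_mat :: "nat \<Rightarrow> real \<Rightarrow> (nat \<Rightarrow> real) \<Rightarrow> (nat \<Rightarrow> real) \<Rightarrow> real mat" where
  "arrow_mat n a v w = four_block_mat (mat n n (\<lambda>(i, j). if i = j then v i else 0)) (mat n 1 (\<lambda>(i, j). w i))
     (mat 1 n (\<lambda>(i, j). w j)) (mat 1 1 (\<lambda>_. a))"

lemma arrow_mat_carrier: "arrow_mat n a v w \<in> carrier_mat (n + 1) (n + 1)"
  unfolding arrow_mat_def by (rule four_block_carrier_mat) auto

text \<open>Away from the poles the diagonal block is invertible and a block LU factorisation
  computes the determinant. Two polynomials that agree off a finite set are equal.\<close>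

lemma char_poly_arrow_mat:
  "char_poly (arrow_mat n a v w) = arrow_poly {..<n} a v (\<lambda>k. (w k)\<^sup>2)"
proof -
  let ?A = "arrow_mat n a v w"
  let ?p = "char_poly ?A" and ?q = "arrow_poly {..<n} a v (\<lambda>k. (w k)\<^sup>2)"
  have eq: "poly ?p y = poly ?q y" if y: "y \<notin> v ` {..<n}" for y
  proof -
    have nz: "y - v k \<noteq> 0" if "k < n" for k
      using y that by auto
    define D where "D = mat n n (\<lambda>(i, j). if i = j then y - v i else 0)"
    define V where "V = mat n 1 (\<lambda>(i, j). - w i)"
    define W where "W = mat 1 n (\<lambda>(i::nat, j). - w j)"
    \<comment> \<open>\<open>R\<close> is \<open>W\<close> times the inverse of \<open>D\<close>,
      the off-diagonal block of the lower factor; \<open>Z\<close> below is the Schur complement of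
      \<open>D\<close>.\<close>
    define R where "R = mat 1 n (\<lambda>(i::nat, j). - w j / (y - v j))"
    define s where "s = (\<Sum>k<n. (w k)\<^sup>2 / (y - v k))"
    define Y where "Y = mat 1 1 (\<lambda>_::nat \<times> nat. y - a)"
    define Z where "Z = mat 1 1 (\<lambda>_::nat \<times> nat. y - a - s)"
    have carr: "D \<in> carrier_mat n n" "V \<in> carrier_mat n 1" "W \<in> carrier_mat 1 n" "R \<in> carrier_mat 1 n"
      "Y \<in> carrier_mat 1 1" "Z \<in> carrier_mat 1 1"
      by (simp_all add: D_def V_def W_def R_def Y_def Z_def)
    have "- (char_matrix ?A y) = four_block_mat D V W Y"
      by (rule eq_matI) (auto simp: char_matrix_def arrow_mat_def D_def V_def W_def Y_def)
    also have "\<dots> = four_block_mat (1\<^sub>m n) (0\<^sub>m n 1) R (1\<^sub>m 1) * four_block_mat D V (0\<^sub>m 1 n) Z"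
    proof -
      have RD: "R * D = W"
      proof (rule eq_matI)
        fix i j assume ij: "i < dim_row W" "j < dim_col W"
        then have "(R * D) $$ (i, j) = (\<Sum>k<n. - w k / (y - v k) * (if k = j then y - v k else 0))"
          by (simp add: R_def D_def W_def scalar_prod_def atLeast0LessThan)
        also have "\<dots> = (\<Sum>k<n. if k = j then - w j else 0)"
          using nz by (intro sum.cong) auto
        finally show "(R * D) $$ (i, j) = W $$ (i, j)"
          using ij by (simp add: W_def)
      qed (simp_all add: R_def D_def W_def)
      have RV: "R * V + Z = Y"
      proof (rule eq_matI)
        fix i j assume ij: "i < dim_row Y" "j < dim_col Y"
        then have "(R * V) $$ (i, j) = s"
          by (auto simp: R_def V_def Y_def s_def scalar_prod_def atLeast0LessThan power2_eq_square intro!: sum.cong)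
        then show "(R * V + Z) $$ (i, j) = Y $$ (i, j)"
          using ij by (simp add: Y_def Z_def R_def V_def)
      qed (simp_all add: Y_def Z_def R_def V_def)
      have "four_block_mat (1\<^sub>m n) (0\<^sub>m n 1) R (1\<^sub>m 1) * four_block_mat D V (0\<^sub>m 1 n) Z =
          four_block_mat (1\<^sub>m n * D + 0\<^sub>m n 1 * 0\<^sub>m 1 n) (1\<^sub>m n * V + 0\<^sub>m n 1 * Z)
            (R * D + 1\<^sub>m 1 * 0\<^sub>m 1 n) (R * V + 1\<^sub>m 1 * Z)"
        by (rule mult_four_block_mat) (use carr in auto)
      also have "\<dots> = four_block_mat D V W Y"
        using carr RD RV by (intro cong_four_block_mat) auto
      finally show ?thesis by simp
    qed
    also have "det \<dots> = det (four_block_mat (1\<^sub>m n) (0\<^sub>m n 1) R (1\<^sub>m 1)) * det (four_block_mat D V (0\<^sub>m 1 n) Z)"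
      by (rule det_mult[of _ "n + 1"]) (use carr in auto)
    also have "det (four_block_mat (1\<^sub>m n) (0\<^sub>m n 1) R (1\<^sub>m 1)) = det (1\<^sub>m n) * det (1\<^sub>m 1)"
      by (rule det_four_block_mat_upper_right_zero) (use carr in auto)
    also have "det (four_block_mat D V (0\<^sub>m 1 n) Z) = det D * det Z"
      by (rule det_four_block_mat_lower_left_zero) (use carr in auto)
    also have "det Z = y - a - s"
      by (subst det_single[OF carr(6)]) (simp add: Z_def)
    also have "det D = (\<Prod>k<n. y - v k)"
      unfolding D_def by (rule det_diagonal)
    also have "det (1\<^sub>m n) * det (1\<^sub>m 1) * ((\<Prod>k<n. y - v k) * (y - a - s)) =
        (y - a) * (\<Prod>k<n. y - v k) - (\<Sum>k<n. (\<Prod>l<n. y - v l) * ((w k)\<^sup>2 / (y - v k)))"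
      by (simp add: s_def algebra_simps sum_distrib_left)
    also have "(\<Sum>k<n. (\<Prod>l<n. y - v l) * ((w k)\<^sup>2 / (y - v k))) = (\<Sum>k<n. (w k)\<^sup>2 * (\<Prod>l\<in>{..<n}-{k}. y - v l))"
    proof (rule sum.cong[OF refl])
      fix k assume k: "k \<in> {..<n}"
      then have "(\<Prod>l<n. y - v l) = (y - v k) * (\<Prod>l\<in>{..<n}-{k}. y - v l)"
        by (intro prod.remove) auto
      then show "(\<Prod>l<n. y - v l) * ((w k)\<^sup>2 / (y - v k)) = (w k)\<^sup>2 * (\<Prod>l\<in>{..<n}-{k}. y - v l)"
        using nz[of k] k by simp
    qed
    also have "(y - a) * (\<Prod>k<n. y - v k) - (\<Sum>k<n. (w k)\<^sup>2 * (\<Prod>l\<in>{..<n}-{k}. y - v l)) = poly ?q y"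
      by (simp add: arrow_poly_def poly_prod poly_sum left_diff_distrib)
    finally show ?thesis
      by (simp add: char_poly_matrix[OF arrow_mat_carrier])
  qed
  have "?p - ?q = 0"
  proof (rule ccontr)
    assume "?p - ?q \<noteq> 0"
    then have "finite {x. poly (?p - ?q) x = 0}"
      by (rule poly_roots_finite)
    moreover have "- (v ` {..<n}) \<subseteq> {x. poly (?p - ?q) x = 0}"
      using eq by auto
    ultimately have "finite (- (v ` {..<n}))"
      by (rule finite_subset[rotated])
    then have "finite (UNIV :: real set)"
      by (metis Compl_partition2 finite_Un finite_imageI finite_lessThan)
    then show False
      by (simp add: infinite_UNIV_char_0)
  qed
  then show ?thesis by simp
qed

section \<open>The palindromic Toeplitz matrix as a bordered circulant\<close>

text \<open>For \<open>N = n + 1\<close> the Toeplitz rule is literally \<open>circ_entry n\<close>,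
  and this takes equal values at \<open>i\<close> and \<open>n - i\<close>. So the border, whose
  distances are \<open>n - i\<close>, can be written with \<open>i\<close>.\<close>

lemma palindromic_toeplitz_four_block:
  "palindromic_toeplitz (n + 1) b = four_block_mat (mat n n (\<lambda>(i, j). circ_entry n b (nat \<bar>int i - int j\<bar>)))
     (mat n 1 (\<lambda>(i, j). circ_entry n b i)) (mat 1 n (\<lambda>(i, j). circ_entry n b j)) (mat 1 1 (\<lambda>_. b 0))"
  by (rule eq_matI)
    (auto simp: palindromic_toeplitz_def circ_entry_def nat_abs_int_diff less_Suc_eq min.commute Let_def)

text \<open>The top left \<open>n \<times> n\<close> block of \<open>A\<^sub>N\<close>, \<open>N = n + 1\<close>, is a symmetric circulant matrix, and the last
  row and column repeat the first ones. The Hartley matrix is an orthogonal involution that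
  diagonalises the circulant block, so that \<open>A\<^sub>N\<close> is similar to an arrow matrix.\<close>

lemma char_poly_palindromic_toeplitz:
  assumes n: "n > 0"
  shows "char_poly (palindromic_toeplitz (n + 1) b) =
    arrow_poly {..<n} (b 0) (circ_eig n b) (\<lambda>k. (circ_eig n b k)\<^sup>2 / n)"
proof -
  let ?e = "circ_eig n b" and ?c = "circ_entry n b"
  \<comment> \<open>The border in the eigenbasis. It equals row 0 of the circulant block, and row 0
    of the Hartley matrix is constantly 1 / sqrt n, so the eigenvector equation at row 0 gives these
    coordinates and hence the weights \<open>(w k)\<^sup>2\<close>.\<close>
  define w where "w k = ?e k / sqrt n" for k
  define H where "H = mat n n (\<lambda>(i, j). hartley n i j)"
  define C where "C = mat n n (\<lambda>(i, j). ?c (nat \<bar>int i - int j\<bar>))"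
  define D where "D = mat n n (\<lambda>(i, j). if i = j then ?e i else 0)"
  define V where "V = mat n 1 (\<lambda>(i, j::nat). ?c i)"
  define W where "W = mat 1 n (\<lambda>(i::nat, j). ?c j)"
  define V' where "V' = mat n 1 (\<lambda>(i, j::nat). w i)"
  define W' where "W' = mat 1 n (\<lambda>(i::nat, j). w j)"
  define Y where "Y = mat 1 1 (\<lambda>_::nat \<times> nat. b 0)"
  define S where "S = four_block_mat H (0\<^sub>m n 1) (0\<^sub>m 1 n) (1\<^sub>m 1)"
  have carr: "H \<in> carrier_mat n n" "C \<in> carrier_mat n n" "D \<in> carrier_mat n n" "V \<in> carrier_mat n 1"
    "W \<in> carrier_mat 1 n" "V' \<in> carrier_mat n 1" "W' \<in> carrier_mat 1 n" "Y \<in> carrier_mat 1 1"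
    by (simp_all add: H_def C_def D_def V_def W_def V'_def W'_def Y_def)
  have SC: "S \<in> carrier_mat (n + 1) (n + 1)"
    unfolding S_def using carr by (intro four_block_carrier_mat) auto
  have HH: "H * H = 1\<^sub>m n"
    by (rule eq_matI) (simp_all add: H_def scalar_prod_def atLeast0LessThan hartley_orthogonal[OF n])
  have e0: "hartley n 0 k = 1 / sqrt n" for k
    by (simp add: hartley_def)
  have CH: "C * H = H * D"
  proof (rule eq_matI)
    fix i k assume "i < dim_row (H * D)" "k < dim_col (H * D)"
    then have ik: "i < n" "k < n" by (simp_all add: H_def D_def)
    have "(C * H) $$ (i, k) = ?e k * hartley n i k"
      using ik circ_eigenvector[OF n ik(1), of b k] by (simp add: C_def H_def scalar_prod_def atLeast0LessThan)
    also have "\<dots> = hartley n i k * ?e k"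
      by (rule mult.commute)
    also have "\<dots> = (H * D) $$ (i, k)"
      using ik by (simp add: H_def D_def scalar_prod_def atLeast0LessThan mult_delta_right)
    finally show "(C * H) $$ (i, k) = (H * D) $$ (i, k)" .
  qed (simp_all add: C_def H_def D_def)
  have ev0: "(\<Sum>j<n. ?c j * hartley n j k) = w k" for k
    using circ_eigenvector[OF n n, of b k] by (simp add: e0 w_def)
  have HV: "H * V' = V"
  proof -
    have "H * V = V'"
    proof (rule eq_matI)
      fix i j assume "i < dim_row V'" "j < dim_col V'"
      then show "(H * V) $$ (i, j) = V' $$ (i, j)"
        using ev0[of i] by (simp add: H_def V_def V'_def scalar_prod_def atLeast0LessThan mult.commute hartley_sym[of n i])
    qed (simp_all add: H_def V_def V'_def)
    then have "H * V' = H * (H * V)"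
      by (simp only:)
    also have "\<dots> = H * H * V"
      by (rule assoc_mult_mat[OF carr(1,1,4), symmetric])
    finally have "H * V' = H * H * V" .
    then show ?thesis using carr HH by simp
  qed
  have WH: "W' * H = W"
  proof -
    have "W * H = W'"
    proof (rule eq_matI)
      fix i j assume "i < dim_row W'" "j < dim_col W'"
      then show "(W * H) $$ (i, j) = W' $$ (i, j)"
        using ev0[of j] by (simp add: H_def W_def W'_def scalar_prod_def atLeast0LessThan)
    qed (simp_all add: H_def W_def W'_def)
    then have "W' * H = W * H * H"
      by (simp only:)
    also have "\<dots> = W * (H * H)"
      by (rule assoc_mult_mat[OF carr(5,1,1)])
    finally have "W' * H = W * (H * H)" .
    then show ?thesis using carr HH by simp
  qed
  have HDH: "H * D * H = C"
  proof -
    have "H * D * H = C * H * H"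
      by (simp only: CH)
    also have "\<dots> = C * (H * H)"
      by (rule assoc_mult_mat[OF carr(2,1,1)])
    finally have "H * D * H = C * (H * H)" .
    then show ?thesis using carr HH by simp
  qed
  have "S * S = four_block_mat (H * H + 0\<^sub>m n 1 * 0\<^sub>m 1 n) (H * 0\<^sub>m n 1 + 0\<^sub>m n 1 * 1\<^sub>m 1)
      (0\<^sub>m 1 n * H + 1\<^sub>m 1 * 0\<^sub>m 1 n) (0\<^sub>m 1 n * 0\<^sub>m n 1 + 1\<^sub>m 1 * 1\<^sub>m 1)"
    unfolding S_def by (rule mult_four_block_mat) (use carr in auto)
  also have "\<dots> = four_block_mat (1\<^sub>m n) (0\<^sub>m n 1) (0\<^sub>m 1 n) (1\<^sub>m 1)"
    using carr HH by (intro cong_four_block_mat) auto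
  finally have SS: "S * S = 1\<^sub>m (n + 1)"
    by simp
  have B: "arrow_mat n (b 0) ?e w = four_block_mat D V' W' Y"
    by (simp add: arrow_mat_def D_def V'_def W'_def Y_def)
  have "S * four_block_mat D V' W' Y = four_block_mat (H * D + 0\<^sub>m n 1 * W') (H * V' + 0\<^sub>m n 1 * Y)
      (0\<^sub>m 1 n * D + 1\<^sub>m 1 * W') (0\<^sub>m 1 n * V' + 1\<^sub>m 1 * Y)"
    unfolding S_def by (rule mult_four_block_mat) (use carr in auto)
  also have "\<dots> = four_block_mat (H * D) V W' Y"
    using carr HV by (intro cong_four_block_mat) auto
  also have "\<dots> * S = four_block_mat (H * D * H + V * 0\<^sub>m 1 n) (H * D * 0\<^sub>m n 1 + V * 1\<^sub>m 1)
      (W' * H + Y * 0\<^sub>m 1 n) (W' * 0\<^sub>m n 1 + Y * 1\<^sub>m 1)"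
    unfolding S_def by (rule mult_four_block_mat) (use carr in auto)
  also have "\<dots> = four_block_mat C V W Y"
    using carr HDH WH by (intro cong_four_block_mat) auto
  finally have "S * arrow_mat n (b 0) ?e w * S = four_block_mat C V W Y"
    by (simp only: B)
  moreover have "palindromic_toeplitz (n + 1) b = four_block_mat C V W Y"
    by (simp only: palindromic_toeplitz_four_block C_def V_def W_def Y_def)
  ultimately have "palindromic_toeplitz (n + 1) b = S * arrow_mat n (b 0) ?e w * S"
    by (simp only:)
  then have "similar_mat (palindromic_toeplitz (n + 1) b) (arrow_mat n (b 0) ?e w)"
    using SS SC arrow_mat_carrier by (intro similar_matI[of _ _ S S "n + 1"]) (auto simp: palindromic_toeplitz_def)
  then have "char_poly (palindromic_toeplitz (n + 1) b) = char_poly (arrow_mat n (b 0) ?e w)"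
    by (rule char_poly_similar)
  then show ?thesis
    by (simp add: char_poly_arrow_mat w_def power_divide)
qed

subsection \<open>The Efron--Stein inequality\<close>

lemma (in prob_space) integrable_bounded:
  fixes g :: "'a \<Rightarrow> real"
  assumes "g \<in> borel_measurable M" "\<And>x. \<bar>g x\<bar> \<le> C"
  shows "integrable M g"
  using assms by (intro integrable_const_bound[where B = C]) auto

lemma bounded_power2: "\<bar>x\<bar> \<le> C \<Longrightarrow> \<bar>x\<^sup>2\<bar> \<le> C\<^sup>2" for x :: real
  by (metis abs_ge_zero abs_power2 power2_abs power_mono)

lemma bounded_diff_power2: "\<bar>x\<bar> \<le> C \<Longrightarrow> \<bar>y\<bar> \<le> C \<Longrightarrow> \<bar>(x - y)\<^sup>2\<bar> \<le> (2 * C)\<^sup>2" for x y :: real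
  by (rule bounded_power2) linarith

lemma (in prob_space) expectation_power2_le:
  fixes g :: "'a \<Rightarrow> real"
  assumes [measurable]: "g \<in> borel_measurable M" and B: "\<And>x. \<bar>g x\<bar> \<le> B"
  shows "expectation (\<lambda>x. (g x)\<^sup>2) \<le> (expectation g)\<^sup>2 + expectation (\<lambda>x. (g x - c)\<^sup>2)"
proof -
  have i1: "integrable M g"
    using B by (intro integrable_bounded) auto
  have i2: "integrable M (\<lambda>x. (g x)\<^sup>2)"
    using bounded_power2[OF B] by (intro integrable_bounded) auto
  have "expectation (\<lambda>x. (g x - c)\<^sup>2) = expectation (\<lambda>x. (g x)\<^sup>2 - 2 * c * g x + c\<^sup>2)"
    by (intro Bochner_Integration.integral_cong) (auto simp: power2_eq_square algebra_simps)
  also have "\<dots> = expectation (\<lambda>x. (g x)\<^sup>2) - 2 * c * expectation g + c\<^sup>2"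
    using i1 i2 by (simp add: prob_space)
  finally show ?thesis
    using zero_le_power2[of "expectation g - c"] by (simp add: power2_eq_square algebra_simps)
qed

lemma (in prob_space) power2_expectation_le:
  fixes g :: "'a \<Rightarrow> real"
  assumes [measurable]: "g \<in> borel_measurable M" and B: "\<And>x. \<bar>g x\<bar> \<le> B"
  shows "(expectation g)\<^sup>2 \<le> expectation (\<lambda>x. (g x)\<^sup>2)"
proof -
  have i1: "integrable M g"
    using B by (intro integrable_bounded) auto
  have i2: "integrable M (\<lambda>x. (g x)\<^sup>2)"
    using bounded_power2[OF B] by (intro integrable_bounded) auto
  have "0 \<le> expectation (\<lambda>x. (g x - expectation g)\<^sup>2)"
    by simp
  also have "\<dots> = expectation (\<lambda>x. (g x)\<^sup>2) - (expectation g)\<^sup>2"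
    using i1 i2 by (rule variance_eq)
  finally show ?thesis by simp
qed

lemma (in prob_space) expectation_bounded:
  fixes g :: "'a \<Rightarrow> real"
  assumes "\<And>x. \<bar>g x\<bar> \<le> B"
  shows "\<bar>expectation g\<bar> \<le> B"
proof (cases "integrable M g")
  case True
  have "\<bar>expectation g\<bar> \<le> expectation (\<lambda>x. \<bar>g x\<bar>)"
    by (rule integral_abs_bound)
  also have "\<dots> \<le> expectation (\<lambda>_. B)"
    using True assms by (intro integral_mono) auto
  finally show ?thesis by (simp add: prob_space)
next
  \<comment> \<open>A non-integrable function has integral 0 by convention, and \<open>B\<close> is
    nonnegative because it bounds an absolute value.\<close>
  case False
  then show ?thesis
    using order_trans[OF abs_ge_zero assms] by (simp add: not_integrable_integral_eq)
qed

lemma measurable_fun_upd_const: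
  assumes "j \<in> I" "z \<in> space (M j)"
  shows "(\<lambda>x. x(j := z)) \<in> measurable (Pi\<^sub>M I M) (Pi\<^sub>M I M)"
proof (rule measurable_PiM_single')
  fix i assume "i \<in> I"
  then show "(\<lambda>x. (x(j := z)) i) \<in> measurable (Pi\<^sub>M I M) (M i)"
    using assms by (cases "i = j") simp_all
qed (use assms in \<open>auto simp: space_PiM PiE_iff extensional_def\<close>)

text \<open>Efron--Stein: in place of resampling the \<open>i\<close>-th coordinate it is fixed to a value \<open>z i\<close>, since the
  mean minimises the quadratic deviation from a constant.\<close>

lemma (in product_prob_space) efron_stein:
  fixes f :: "('i \<Rightarrow> 'a) \<Rightarrow> real"
  assumes "finite J" and "f \<in> borel_measurable (Pi\<^sub>M J M)" and "\<And>x. \<bar>f x\<bar> \<le> B"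
    and z: "\<And>i. z i \<in> space (M i)"
  shows "(\<integral>x. (f x)\<^sup>2 \<partial>Pi\<^sub>M J M) - (\<integral>x. f x \<partial>Pi\<^sub>M J M)\<^sup>2
           \<le> (\<Sum>i\<in>J. \<integral>x. (f x - f (x(i := z i)))\<^sup>2 \<partial>Pi\<^sub>M J M)"
  using assms(1-3)
proof (induction J arbitrary: f rule: finite_induct)
  case empty
  then show ?case
    by (simp add: PiM_empty lebesgue_integral_count_space_finite)
next
  case (insert i J)
  note [measurable] = insert.prems(1) and B = insert.prems(2)
  interpret PJ: prob_space "Pi\<^sub>M J M"
    by (rule prob_space_PiM) (rule prob_space)
  interpret PQ: prob_space "Pi\<^sub>M (insert i J) M"
    by (rule prob_space_PiM) (rule prob_space)
  \<comment> \<open>The conditional mean over coordinate \<open>i\<close>. The second moment of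
    \<open>f\<close> splits into that of \<open>e\<close> plus a mean conditional variance, bounded
    by the \<open>i\<close>-th increment (fact 1). The induction hypothesis handles
    \<open>e\<close>, whose increments are dominated by those of \<open>f\<close> by Jensen (fact
    2).\<close>
  define e where "e x = (\<integral>y. f (x(i := y)) \<partial>M i)" for x
  have fi: "(\<lambda>y. g (x(i := y))) \<in> borel_measurable (M i)"
    if "g \<in> borel_measurable (Pi\<^sub>M (insert i J) M)" and "x \<in> space (Pi\<^sub>M J M)"
    for x and g :: "('i \<Rightarrow> 'a) \<Rightarrow> real"
    using measurable_compose[OF measurable_component_update[OF that(2) insert.hyps(2)] that(1)] .
  have intm: "(\<lambda>x. \<integral>y. g (x(i := y)) \<partial>M i) \<in> borel_measurable (Pi\<^sub>M J M)"
    if "g \<in> borel_measurable (Pi\<^sub>M (insert i J) M)" for g :: "('i \<Rightarrow> 'a) \<Rightarrow> real"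
  proof (rule M.borel_measurable_lebesgue_integral)
    show "(\<lambda>(x, y). g (x(i := y))) \<in> borel_measurable (Pi\<^sub>M J M \<Otimes>\<^sub>M M i)"
      using measurable_compose[OF measurable_add_dim that] by (simp add: case_prod_unfold)
  qed
  have fub: "(\<integral>x. g x \<partial>Pi\<^sub>M (insert i J) M) = (\<integral>x. \<integral>y. g (x(i := y)) \<partial>M i \<partial>Pi\<^sub>M J M)"
    if "g \<in> borel_measurable (Pi\<^sub>M (insert i J) M)" "\<And>x. \<bar>g x\<bar> \<le> C" for g :: "('i \<Rightarrow> 'a) \<Rightarrow> real" and C
    by (rule product_integral_insert[OF insert.hyps PQ.integrable_bounded[OF that]])
  have em [measurable]: "e \<in> borel_measurable (Pi\<^sub>M J M)"
    unfolding e_def by (rule intm) fact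
  have eB: "\<bar>e x\<bar> \<le> B" for x
    unfolding e_def by (rule M.expectation_bounded) (rule B)
  have updm: "(\<lambda>x. f (x(j := z j))) \<in> borel_measurable (Pi\<^sub>M (insert i J) M)" if "j \<in> insert i J" for j
    using measurable_compose[OF measurable_fun_upd_const[OF that z] insert.prems(1)] .
  have dm: "(\<lambda>x. (f x - f (x(j := z j)))\<^sup>2) \<in> borel_measurable (Pi\<^sub>M (insert i J) M)" if "j \<in> insert i J" for j
    by (intro borel_measurable_power borel_measurable_diff insert.prems(1) updm[OF that])
  have dB: "\<bar>(f x - f (x(j := z j)))\<^sup>2\<bar> \<le> (2 * B)\<^sup>2" for x j
    by (rule bounded_diff_power2[OF B B])
  have 1: "(\<integral>x. (f x)\<^sup>2 \<partial>Pi\<^sub>M (insert i J) M) \<le>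
      (\<integral>x. (e x)\<^sup>2 \<partial>Pi\<^sub>M J M) + (\<integral>x. (f x - f (x(i := z i)))\<^sup>2 \<partial>Pi\<^sub>M (insert i J) M)"
  proof -
    have m1: "(\<lambda>x. \<integral>y. (f (x(i := y)))\<^sup>2 \<partial>M i) \<in> borel_measurable (Pi\<^sub>M J M)"
      by (rule intm) measurable
    have m2: "(\<lambda>x. \<integral>y. (f (x(i := y)) - f (x(i := y, i := z i)))\<^sup>2 \<partial>M i) \<in> borel_measurable (Pi\<^sub>M J M)"
      using intm[OF dm[of i]] by simp
    have "(\<integral>x. (f x)\<^sup>2 \<partial>Pi\<^sub>M (insert i J) M) = (\<integral>x. \<integral>y. (f (x(i := y)))\<^sup>2 \<partial>M i \<partial>Pi\<^sub>M J M)"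
      by (rule fub) (measurable, rule bounded_power2[OF B])
    also have "\<dots> \<le> (\<integral>x. (e x)\<^sup>2 + (\<integral>y. (f (x(i := y)) - f (x(i := y, i := z i)))\<^sup>2 \<partial>M i) \<partial>Pi\<^sub>M J M)"
    proof (rule integral_mono)
      show "integrable (Pi\<^sub>M J M) (\<lambda>x. \<integral>y. (f (x(i := y)))\<^sup>2 \<partial>M i)"
        by (rule PJ.integrable_bounded[OF m1 M.expectation_bounded[OF bounded_power2[OF B]]])
      have "integrable (Pi\<^sub>M J M) (\<lambda>x. (e x)\<^sup>2)"
        by (rule PJ.integrable_bounded[OF _ bounded_power2[OF eB]]) measurable
      moreover have "integrable (Pi\<^sub>M J M) (\<lambda>x. \<integral>y. (f (x(i := y)) - f (x(i := y, i := z i)))\<^sup>2 \<partial>M i)"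
        by (rule PJ.integrable_bounded[OF m2 M.expectation_bounded[OF dB]])
      ultimately show "integrable (Pi\<^sub>M J M) (\<lambda>x. (e x)\<^sup>2 + (\<integral>y. (f (x(i := y)) - f (x(i := y, i := z i)))\<^sup>2 \<partial>M i))"
        by (rule Bochner_Integration.integrable_add)
      fix x assume x: "x \<in> space (Pi\<^sub>M J M)"
      show "(\<integral>y. (f (x(i := y)))\<^sup>2 \<partial>M i) \<le> (e x)\<^sup>2 + (\<integral>y. (f (x(i := y)) - f (x(i := y, i := z i)))\<^sup>2 \<partial>M i)"
        unfolding e_def fun_upd_upd by (rule M.expectation_power2_le[OF fi[OF insert.prems(1) x] B])
    qed
    also have "\<dots> = (\<integral>x. (e x)\<^sup>2 \<partial>Pi\<^sub>M J M) + (\<integral>x. \<integral>y. (f (x(i := y)) - f (x(i := y, i := z i)))\<^sup>2 \<partial>M i \<partial>Pi\<^sub>M J M)"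
    proof (rule Bochner_Integration.integral_add)
      show "integrable (Pi\<^sub>M J M) (\<lambda>x. (e x)\<^sup>2)"
        by (rule PJ.integrable_bounded[OF _ bounded_power2[OF eB]]) measurable
      show "integrable (Pi\<^sub>M J M) (\<lambda>x. \<integral>y. (f (x(i := y)) - f (x(i := y, i := z i)))\<^sup>2 \<partial>M i)"
        by (rule PJ.integrable_bounded[OF m2 M.expectation_bounded[OF dB]])
    qed
    also have "(\<integral>x. \<integral>y. (f (x(i := y)) - f (x(i := y, i := z i)))\<^sup>2 \<partial>M i \<partial>Pi\<^sub>M J M) =
        (\<integral>x. (f x - f (x(i := z i)))\<^sup>2 \<partial>Pi\<^sub>M (insert i J) M)"
      by (rule fub[OF dm dB, symmetric]) simp
    finally show ?thesis .
  qed
  have 2: "(\<integral>x. (e x - e (x(j := z j)))\<^sup>2 \<partial>Pi\<^sub>M J M) \<le> (\<integral>x. (f x - f (x(j := z j)))\<^sup>2 \<partial>Pi\<^sub>M (insert i J) M)"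
    if j: "j \<in> J" for j
  proof -
    have ji: "j \<noteq> i" using j insert.hyps by auto
    have m1: "(\<lambda>x. e (x(j := z j))) \<in> borel_measurable (Pi\<^sub>M J M)"
      using measurable_compose[OF measurable_fun_upd_const[OF j z] em] .
    have m2: "(\<lambda>x. \<integral>y. (f (x(i := y)) - f (x(i := y, j := z j)))\<^sup>2 \<partial>M i) \<in> borel_measurable (Pi\<^sub>M J M)"
      using intm[OF dm[of j]] j by simp
    have "(\<integral>x. (e x - e (x(j := z j)))\<^sup>2 \<partial>Pi\<^sub>M J M) \<le>
        (\<integral>x. \<integral>y. (f (x(i := y)) - f (x(i := y, j := z j)))\<^sup>2 \<partial>M i \<partial>Pi\<^sub>M J M)"
    proof (rule integral_mono)
      show "integrable (Pi\<^sub>M J M) (\<lambda>x. (e x - e (x(j := z j)))\<^sup>2)"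
        by (rule PJ.integrable_bounded[OF _ bounded_diff_power2[OF eB eB]])
          (intro borel_measurable_power borel_measurable_diff em m1)
      show "integrable (Pi\<^sub>M J M) (\<lambda>x. \<integral>y. (f (x(i := y)) - f (x(i := y, j := z j)))\<^sup>2 \<partial>M i)"
        by (rule PJ.integrable_bounded[OF m2 M.expectation_bounded[OF dB]])
      fix x assume x: "x \<in> space (Pi\<^sub>M J M)"
      have xj: "x(j := z j) \<in> space (Pi\<^sub>M J M)"
        using measurable_space[OF measurable_fun_upd_const[OF j z] x] .
      have m: "(\<lambda>y. f (x(i := y))) \<in> borel_measurable (M i)" "(\<lambda>y. f (x(j := z j, i := y))) \<in> borel_measurable (M i)"
        by (intro fi[OF insert.prems(1)] x xj)+
      have "e x - e (x(j := z j)) = (\<integral>y. f (x(i := y)) - f (x(j := z j, i := y)) \<partial>M i)"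
        unfolding e_def using M.integrable_bounded[OF m(1) B] M.integrable_bounded[OF m(2) B]
        by (rule Bochner_Integration.integral_diff[symmetric])
      also have "\<dots>\<^sup>2 \<le> (\<integral>y. (f (x(i := y)) - f (x(j := z j, i := y)))\<^sup>2 \<partial>M i)"
      proof (rule M.power2_expectation_le)
        show "\<bar>f (x(i := y)) - f (x(j := z j, i := y))\<bar> \<le> B + B" for y
          using B[of "x(i := y)"] B[of "x(j := z j, i := y)"] by linarith
      qed (intro borel_measurable_diff m)
      finally show "(e x - e (x(j := z j)))\<^sup>2 \<le> (\<integral>y. (f (x(i := y)) - f (x(i := y, j := z j)))\<^sup>2 \<partial>M i)"
        by (simp only: fun_upd_twist[OF ji])
    qed
    also have "\<dots> = (\<integral>x. (f x - f (x(j := z j)))\<^sup>2 \<partial>Pi\<^sub>M (insert i J) M)"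
      by (rule fub[OF dm dB, symmetric]) (use j in simp)
    finally show ?thesis .
  qed
  have mean: "(\<integral>x. f x \<partial>Pi\<^sub>M (insert i J) M) = (\<integral>x. e x \<partial>Pi\<^sub>M J M)"
    unfolding e_def by (rule fub[OF insert.prems(1) B])
  have "(\<integral>x. (e x)\<^sup>2 \<partial>Pi\<^sub>M J M) - (\<integral>x. e x \<partial>Pi\<^sub>M J M)\<^sup>2 \<le>
      (\<Sum>j\<in>J. \<integral>x. (e x - e (x(j := z j)))\<^sup>2 \<partial>Pi\<^sub>M J M)"
    by (rule insert.IH[OF em eB])
  also have "\<dots> \<le> (\<Sum>j\<in>J. \<integral>x. (f x - f (x(j := z j)))\<^sup>2 \<partial>Pi\<^sub>M (insert i J) M)"
    by (rule sum_mono) (rule 2)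
  finally show ?case
    unfolding mean sum.insert[OF insert.hyps] using 1 by linarith
qed

text \<open>Controls the change of the square of a centred function when the function itself changes
  by \<open>d\<close>: the difference of squares factors as d (2 Z - d).\<close>

lemma power2_diff_power2_le:
  fixes Z d :: real
  shows "(Z\<^sup>2 - (Z - d)\<^sup>2)\<^sup>2 \<le> 8 * (Z\<^sup>2 * d\<^sup>2) + 2 * (d\<^sup>2 * d\<^sup>2)"
proof -
  have "(Z\<^sup>2 - (Z - d)\<^sup>2)\<^sup>2 = d\<^sup>2 * (2 * Z - d)\<^sup>2"
    by (simp add: power2_eq_square algebra_simps)
  also have "\<dots> \<le> d\<^sup>2 * (8 * Z\<^sup>2 + 2 * d\<^sup>2)"
    using zero_le_power2[of "2 * Z + d"] by (intro mult_left_mono) (simp_all add: power2_eq_square algebra_simps)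
  finally show ?thesis by (simp add: algebra_simps)
qed

text \<open>Efron--Stein applied to the square of the centred function.\<close>

lemma (in product_prob_space) central_fourth_moment_le:
  fixes f :: "('i \<Rightarrow> 'a) \<Rightarrow> real"
  assumes J: "finite J" and f [measurable]: "f \<in> borel_measurable (Pi\<^sub>M J M)" and B: "\<And>x. \<bar>f x\<bar> \<le> B"
    and z: "\<And>i. z i \<in> space (M i)"
  shows "(\<integral>x. (f x - (\<integral>x. f x \<partial>Pi\<^sub>M J M)) ^ 4 \<partial>Pi\<^sub>M J M)
           \<le> 70 * (\<integral>x. (\<Sum>i\<in>J. (f x - f (x(i := z i)))\<^sup>2)\<^sup>2 \<partial>Pi\<^sub>M J M)"
proof -
  interpret PJ: prob_space "Pi\<^sub>M J M"
    by (rule prob_space_PiM) (rule prob_space)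
  define m where "m = (\<integral>x. f x \<partial>Pi\<^sub>M J M)"
  define Z where "Z x = f x - m" for x
  define d where "d i x = f x - f (x(i := z i))" for i x
  define S where "S x = (\<Sum>i\<in>J. (d i x)\<^sup>2)" for x
  have [measurable]: "Z \<in> borel_measurable (Pi\<^sub>M J M)"
    unfolding Z_def by measurable
  have dm: "d i \<in> borel_measurable (Pi\<^sub>M J M)" if "i \<in> J" for i
  proof -
    have "(\<lambda>x. f (x(i := z i))) \<in> borel_measurable (Pi\<^sub>M J M)"
      using measurable_compose[OF measurable_fun_upd_const[OF that z] f] .
    then show ?thesis unfolding d_def by (intro borel_measurable_diff f)
  qed
  have [measurable]: "S \<in> borel_measurable (Pi\<^sub>M J M)"
    unfolding S_def by (intro borel_measurable_sum borel_measurable_power dm)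
  have mB: "\<bar>m\<bar> \<le> B"
    unfolding m_def by (rule PJ.expectation_bounded) (rule B)
  have ZB: "\<bar>Z x\<bar> \<le> 2 * B" for x
    using B[of x] mB unfolding Z_def by linarith
  have dB: "\<bar>d i x\<bar> \<le> 2 * B" for i x
    using B[of x] B[of "x(i := z i)"] unfolding d_def by linarith
  have S0: "0 \<le> S x" for x
    unfolding S_def by (intro sum_nonneg) simp
  have SB: "\<bar>S x\<bar> \<le> card J * (2 * B)\<^sup>2" for x
  proof -
    have "S x \<le> of_nat (card J) * (2 * B)\<^sup>2"
      unfolding S_def by (rule sum_bounded_above) (use bounded_power2[OF dB] in simp)
    then show ?thesis using S0[of x] by simp
  qed
  have iZ2: "integrable (Pi\<^sub>M J M) (\<lambda>x. (Z x)\<^sup>2)"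
    by (rule PJ.integrable_bounded[OF _ bounded_power2[OF ZB]]) measurable
  have iZ4: "integrable (Pi\<^sub>M J M) (\<lambda>x. ((Z x)\<^sup>2)\<^sup>2)"
    by (rule PJ.integrable_bounded[OF _ bounded_power2[OF bounded_power2[OF ZB]]]) measurable
  have iS: "integrable (Pi\<^sub>M J M) S"
    by (rule PJ.integrable_bounded[OF _ SB]) measurable
  have iS2: "integrable (Pi\<^sub>M J M) (\<lambda>x. (S x)\<^sup>2)"
    by (rule PJ.integrable_bounded[OF _ bounded_power2[OF SB]]) measurable
  have id2: "integrable (Pi\<^sub>M J M) (\<lambda>x. (d i x)\<^sup>2)" if "i \<in> J" for i
    by (rule PJ.integrable_bounded[OF _ bounded_power2[OF dB]]) (intro borel_measurable_power dm[OF that])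
  \<comment> \<open>Efron--Stein for \<open>f\<close> itself, followed by Jensen, takes care of the
    squared mean that Efron--Stein for the square of \<open>Z\<close> will subtract.\<close>
  have "(\<integral>x. (Z x)\<^sup>2 \<partial>Pi\<^sub>M J M) = (\<integral>x. (f x)\<^sup>2 \<partial>Pi\<^sub>M J M) - m\<^sup>2"
    unfolding Z_def m_def
    by (rule PJ.variance_eq[OF PJ.integrable_bounded[OF f B] PJ.integrable_bounded[OF _ bounded_power2[OF B]]]) measurable
  also have "\<dots> \<le> (\<Sum>i\<in>J. \<integral>x. (d i x)\<^sup>2 \<partial>Pi\<^sub>M J M)"
    unfolding m_def d_def by (rule efron_stein[OF J f B z])
  also have "\<dots> = (\<integral>x. S x \<partial>Pi\<^sub>M J M)"
    unfolding S_def by (rule Bochner_Integration.integral_sum[symmetric]) (rule id2)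
  finally have "(\<integral>x. (Z x)\<^sup>2 \<partial>Pi\<^sub>M J M)\<^sup>2 \<le> (\<integral>x. S x \<partial>Pi\<^sub>M J M)\<^sup>2"
    by (rule power_mono) simp
  also have "\<dots> \<le> (\<integral>x. (S x)\<^sup>2 \<partial>Pi\<^sub>M J M)"
    by (rule PJ.power2_expectation_le[OF _ SB]) measurable
  finally have var: "(\<integral>x. (Z x)\<^sup>2 \<partial>Pi\<^sub>M J M)\<^sup>2 \<le> (\<integral>x. (S x)\<^sup>2 \<partial>Pi\<^sub>M J M)" .
  have iD: "integrable (Pi\<^sub>M J M) (\<lambda>x. ((Z x)\<^sup>2 - (Z x - d i x)\<^sup>2)\<^sup>2)" if "i \<in> J" for i
  proof (rule PJ.integrable_bounded)
    show "(\<lambda>x. ((Z x)\<^sup>2 - (Z x - d i x)\<^sup>2)\<^sup>2) \<in> borel_measurable (Pi\<^sub>M J M)"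
      by (intro borel_measurable_power borel_measurable_diff dm[OF that]) measurable
    have "\<bar>Z x - d i x\<bar> \<le> 2 * B" for x
      using B[of "x(i := z i)"] mB unfolding Z_def d_def by linarith
    then show "\<bar>((Z x)\<^sup>2 - (Z x - d i x)\<^sup>2)\<^sup>2\<bar> \<le> (2 * (2 * B)\<^sup>2)\<^sup>2" for x
      by (intro bounded_diff_power2 bounded_power2 ZB)
  qed
  have "(\<integral>x. ((Z x)\<^sup>2)\<^sup>2 \<partial>Pi\<^sub>M J M) - (\<integral>x. (Z x)\<^sup>2 \<partial>Pi\<^sub>M J M)\<^sup>2 \<le>
      (\<Sum>i\<in>J. \<integral>x. ((Z x)\<^sup>2 - (Z (x(i := z i)))\<^sup>2)\<^sup>2 \<partial>Pi\<^sub>M J M)"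
    by (rule efron_stein[OF J _ bounded_power2[OF ZB] z]) measurable
  also have "\<dots> = (\<Sum>i\<in>J. \<integral>x. ((Z x)\<^sup>2 - (Z x - d i x)\<^sup>2)\<^sup>2 \<partial>Pi\<^sub>M J M)"
    by (simp add: Z_def d_def algebra_simps)
  also have "\<dots> = (\<integral>x. (\<Sum>i\<in>J. ((Z x)\<^sup>2 - (Z x - d i x)\<^sup>2)\<^sup>2) \<partial>Pi\<^sub>M J M)"
    by (rule Bochner_Integration.integral_sum[symmetric]) (rule iD)
  \<comment> \<open>The mixed term is split as 8 Z^2 S <= Z^4 / 2 + 32 S^2, the weight being chosen
    so that half of the fourth moment can be absorbed later. The fourth powers of the increments sum
    to at most S^2, which adds the remaining 2.\<close>
  also have "\<dots> \<le> (\<integral>x. ((Z x)\<^sup>2)\<^sup>2 / 2 + 34 * (S x)\<^sup>2 \<partial>Pi\<^sub>M J M)"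
  proof (rule integral_mono)
    fix x
    have "(\<Sum>i\<in>J. ((Z x)\<^sup>2 - (Z x - d i x)\<^sup>2)\<^sup>2) \<le> (\<Sum>i\<in>J. 8 * ((Z x)\<^sup>2 * (d i x)\<^sup>2) + 2 * ((d i x)\<^sup>2 * (d i x)\<^sup>2))"
      by (intro sum_mono power2_diff_power2_le)
    also have "\<dots> = 8 * ((Z x)\<^sup>2 * S x) + 2 * (\<Sum>i\<in>J. (d i x)\<^sup>2 * (d i x)\<^sup>2)"
      by (simp add: S_def sum.distrib sum_distrib_left mult.assoc)
    also have "(\<Sum>i\<in>J. (d i x)\<^sup>2 * (d i x)\<^sup>2) \<le> (\<Sum>i\<in>J. (d i x)\<^sup>2 * S x)"
      unfolding S_def using J by (intro sum_mono mult_left_mono member_le_sum) auto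
    also have "\<dots> = (S x)\<^sup>2"
      by (simp add: S_def sum_distrib_right power2_eq_square)
    also have "8 * ((Z x)\<^sup>2 * S x) + 2 * (S x)\<^sup>2 \<le> ((Z x)\<^sup>2)\<^sup>2 / 2 + 34 * (S x)\<^sup>2"
    proof -
      have "0 \<le> ((Z x)\<^sup>2 - 8 * S x)\<^sup>2"
        by simp
      then show ?thesis
        unfolding power2_diff by (simp add: power_mult_distrib)
    qed
    finally show "(\<Sum>i\<in>J. ((Z x)\<^sup>2 - (Z x - d i x)\<^sup>2)\<^sup>2) \<le> ((Z x)\<^sup>2)\<^sup>2 / 2 + 34 * (S x)\<^sup>2"
      by simp
  next
    show "integrable (Pi\<^sub>M J M) (\<lambda>x. \<Sum>i\<in>J. ((Z x)\<^sup>2 - (Z x - d i x)\<^sup>2)\<^sup>2)"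
      by (rule Bochner_Integration.integrable_sum) (rule iD)
    show "integrable (Pi\<^sub>M J M) (\<lambda>x. ((Z x)\<^sup>2)\<^sup>2 / 2 + 34 * (S x)\<^sup>2)"
      using iZ4 iS2 by simp
  qed
  also have "\<dots> = (\<integral>x. ((Z x)\<^sup>2)\<^sup>2 \<partial>Pi\<^sub>M J M) / 2 + 34 * (\<integral>x. (S x)\<^sup>2 \<partial>Pi\<^sub>M J M)"
    using iZ4 iS2 by simp
  \<comment> \<open>With the bound \<open>var\<close> for the squared second moment this reads E Z^4
    <= E Z^4 / 2 + (1 + 34) E S^2, whence 70.\<close>
  finally have "(\<integral>x. ((Z x)\<^sup>2)\<^sup>2 \<partial>Pi\<^sub>M J M) \<le> 70 * (\<integral>x. (S x)\<^sup>2 \<partial>Pi\<^sub>M J M)"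
    using var by linarith
  moreover have "(Z x) ^ 4 = ((Z x)\<^sup>2)\<^sup>2" for x
    by (simp flip: power_mult)
  ultimately show ?thesis
    by (simp add: Z_def m_def S_def d_def)
qed

subsection \<open>Concentration of spectral averages\<close>

text \<open>For odd \<open>n\<close> the summands \<open>j\<close> and \<open>n - j\<close> of \<^const>\<open>circ_eig\<close> agree for \<open>0 < j < n\<close>, while \<open>j = 0\<close> occurs once.\<close>

definition half_weight :: "nat \<Rightarrow> real" where
  "half_weight j = (if j = 0 then 1 else 2)"

lemma sum_symmetric_half:
  fixes g :: "nat \<Rightarrow> real"
  assumes "\<And>d. 1 \<le> d \<Longrightarrow> d \<le> m \<Longrightarrow> g (2 * m + 1 - d) = g d"
  shows "(\<Sum>d<2*m+1. g d) = (\<Sum>j\<le>m. half_weight j * g j)"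
proof -
  have "{..<2*m+1} = {0} \<union> {1..m} \<union> {m+1..2*m}"
    by auto
  then have "(\<Sum>d<2*m+1. g d) = g 0 + (\<Sum>d\<in>{1..m}. g d) + (\<Sum>d\<in>{m+1..2*m}. g d)"
    by (simp add: sum.union_disjoint)
  also have "(\<Sum>d\<in>{m+1..2*m}. g d) = (\<Sum>d\<in>{1..m}. g (2 * m + 1 - d))"
    by (rule sum.reindex_bij_witness[of _ "\<lambda>d. 2 * m + 1 - d" "\<lambda>d. 2 * m + 1 - d"]) auto
  also have "\<dots> = (\<Sum>d\<in>{1..m}. g d)"
    by (rule sum.cong) (use assms in auto)
  also have "g 0 + (\<Sum>d\<in>{1..m}. g d) + (\<Sum>d\<in>{1..m}. g d) = half_weight 0 * g 0 + (\<Sum>j\<in>{1..m}. half_weight j * g j)"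
  proof -
    have "(\<Sum>j\<in>{1..m}. half_weight j * g j) = (\<Sum>j\<in>{1..m}. 2 * g j)"
      by (rule sum.cong) (auto simp: half_weight_def)
    then show ?thesis
      by (simp add: half_weight_def sum_distrib_left)
  qed
  also have "\<dots> = (\<Sum>j\<le>m. half_weight j * g j)"
    by (simp add: atMost_atLeast0 sum.atLeast_Suc_atMost)
  finally show ?thesis .
qed

lemma cos_reflect:
  assumes "n > 0" "d \<le> n"
  shows "cos (2 * pi * (real (n - d) * real k) / n) = cos (2 * pi * (real d * real k) / n)"
proof -
  have "2 * pi * (real (n - d) * real k) / n = 2 * real k * pi - 2 * pi * (real d * real k) / n"
    using assms by (simp add: of_nat_diff field_simps)
  then show ?thesis
    by (simp only: cos_diff cos_2npi sin_2npi)
qed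

definition eig_coeff :: "nat \<Rightarrow> nat \<Rightarrow> nat \<Rightarrow> real" where
  "eig_coeff m j k = half_weight j * cos (2 * pi * (real j * real k) / (2 * m + 1))"

lemma circ_eig_half:
  "circ_eig (2 * m + 1) x k = (\<Sum>j\<le>m. eig_coeff m j k * x j)"
proof -
  have "circ_eig (2 * m + 1) x k =
      (\<Sum>j\<le>m. half_weight j * (circ_entry (2 * m + 1) x j * cos (2 * pi * (real j * real k) / real (2 * m + 1))))"
    unfolding circ_eig_def
  proof (rule sum_symmetric_half)
    fix d assume d: "1 \<le> d" "d \<le> m"
    then have "circ_entry (2 * m + 1) x (2 * m + 1 - d) = circ_entry (2 * m + 1) x d"
      by (simp add: circ_entry_def min.commute)
    then show "circ_entry (2 * m + 1) x (2 * m + 1 - d) * cos (2 * pi * (real (2 * m + 1 - d) * real k) / real (2 * m + 1)) =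
        circ_entry (2 * m + 1) x d * cos (2 * pi * (real d * real k) / real (2 * m + 1))"
      using cos_reflect[of "2 * m + 1" d k] d by (simp del: of_nat_add of_nat_mult of_nat_Suc)
  qed
  also have "\<dots> = (\<Sum>j\<le>m. eig_coeff m j k * x j)"
    by (rule sum.cong) (auto simp: eig_coeff_def circ_entry_def min_def add_ac)
  finally show ?thesis .
qed

lemma abs_eig_coeff_le: "\<bar>eig_coeff m j k\<bar> \<le> 2"
proof -
  have "\<bar>half_weight j\<bar> * \<bar>cos y\<bar> \<le> 2 * 1" for y
    by (intro mult_mono) (auto simp: half_weight_def)
  then show ?thesis by (simp add: eig_coeff_def abs_mult)
qed

text \<open>The sum over \<open>j\<close> is enlarged to a full period and the matching sine terms
  are added, so that cos cos + sin sin becomes the cosine of a difference and exact orthogonality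
  applies. The factor 4 is the largest square of \<open>half_weight\<close>.\<close>

lemma bessel_eig_coeff:
  fixes w :: "nat \<Rightarrow> real" and m :: nat
  defines "n \<equiv> 2 * m + 1"
  shows "(\<Sum>j\<le>m. (\<Sum>k<n. eig_coeff m j k * w k)\<^sup>2) \<le> 4 * real n * (\<Sum>k<n. (w k)\<^sup>2)"
proof -
  have n: "n > 0" by (simp add: n_def)
  define x where "x j k = 2 * pi * (real j * real k) / n" for j k :: nat
  have sq: "(\<Sum>k<n. u k * w k)\<^sup>2 = (\<Sum>k<n. \<Sum>l<n. u k * u l * (w k * w l))" for u
    by (simp add: power2_eq_square sum_product algebra_simps)
  have ec: "eig_coeff m j k = half_weight j * cos (x j k)" for j k
    by (simp add: eig_coeff_def x_def n_def add_ac)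
  have "(\<Sum>j\<le>m. (\<Sum>k<n. eig_coeff m j k * w k)\<^sup>2) \<le> (\<Sum>j\<le>m. 4 * ((\<Sum>k<n. cos (x j k) * w k)\<^sup>2 + (\<Sum>k<n. sin (x j k) * w k)\<^sup>2))"
  proof (rule sum_mono)
    fix j
    have "(\<Sum>k<n. eig_coeff m j k * w k)\<^sup>2 = (half_weight j)\<^sup>2 * (\<Sum>k<n. cos (x j k) * w k)\<^sup>2"
      by (simp add: ec mult.assoc sum_distrib_left[symmetric] power_mult_distrib)
    also have "\<dots> \<le> 4 * (\<Sum>k<n. cos (x j k) * w k)\<^sup>2"
      by (intro mult_right_mono) (auto simp: half_weight_def)
    finally show "(\<Sum>k<n. eig_coeff m j k * w k)\<^sup>2 \<le> 4 * ((\<Sum>k<n. cos (x j k) * w k)\<^sup>2 + (\<Sum>k<n. sin (x j k) * w k)\<^sup>2)"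
      by (rule order_trans) simp
  qed
  also have "\<dots> \<le> (\<Sum>j<n. 4 * ((\<Sum>k<n. cos (x j k) * w k)\<^sup>2 + (\<Sum>k<n. sin (x j k) * w k)\<^sup>2))"
    by (rule sum_mono2) (auto simp: n_def)
  also have "\<dots> = 4 * (\<Sum>j<n. \<Sum>k<n. \<Sum>l<n. cos (2 * pi * (real j * of_int (int k - int l)) / n) * (w k * w l))"
  proof -
    have "(\<Sum>k<n. cos (x j k) * w k)\<^sup>2 + (\<Sum>k<n. sin (x j k) * w k)\<^sup>2 =
        (\<Sum>k<n. \<Sum>l<n. cos (2 * pi * (real j * of_int (int k - int l)) / n) * (w k * w l))" for j
    proof -
      have "cos (2 * pi * (real j * of_int (int k - int l)) / n) = cos (x j k) * cos (x j l) + sin (x j k) * sin (x j l)" for k l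
      proof -
        have "2 * pi * (real j * of_int (int k - int l)) / n = x j k - x j l"
          by (simp add: x_def algebra_simps diff_divide_distrib)
        then show ?thesis by (simp only: cos_diff)
      qed
      then show ?thesis
        unfolding sq by (simp add: sum.distrib[symmetric] distrib_right)
    qed
    then show ?thesis by (simp add: sum_distrib_left)
  qed
  also have "(\<Sum>j<n. \<Sum>k<n. \<Sum>l<n. cos (2 * pi * (real j * of_int (int k - int l)) / n) * (w k * w l)) =
      (\<Sum>k<n. \<Sum>j<n. \<Sum>l<n. cos (2 * pi * (real j * of_int (int k - int l)) / n) * (w k * w l))"
    by (rule sum.swap)
  also have "\<dots> = (\<Sum>k<n. \<Sum>l<n. \<Sum>j<n. cos (2 * pi * (real j * of_int (int k - int l)) / n) * (w k * w l))"
    by (intro sum.cong refl sum.swap)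
  also have "\<dots> = (\<Sum>k<n. \<Sum>l<n. (\<Sum>j<n. cos (2 * pi * (real j * of_int (int k - int l)) / n)) * (w k * w l))"
    by (simp only: sum_distrib_right)
  also have "\<dots> = (\<Sum>k<n. \<Sum>l<n. if k = l then real n * (w k)\<^sup>2 else 0)"
  proof (intro sum.cong refl)
    fix k l assume "k \<in> {..<n}" "l \<in> {..<n}"
    then have "int n dvd (int k - int l) \<longleftrightarrow> k = l"
      by (intro int_dvd_diff_iff) auto
    then show "(\<Sum>j<n. cos (2 * pi * (real j * of_int (int k - int l)) / n)) * (w k * w l) = (if k = l then real n * (w k)\<^sup>2 else 0)"
      unfolding sum_cos_roots_of_unity[OF n] by (simp add: power2_eq_square)
  qed
  also have "4 * \<dots> = 4 * real n * (\<Sum>k<n. (w k)\<^sup>2)"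
    by (simp add: sum_distrib_left mult.assoc)
  finally show ?thesis .
qed

text \<open>The circulant matrix has dimension \<open>2m + 1\<close>, but its eigenvalues are scaled by the square root of
  the dimension \<open>N = 2m + 2\<close> of \<open>A\<^sub>N\<close>.\<close>

definition eig_mean :: "nat \<Rightarrow> (real \<Rightarrow> real) \<Rightarrow> (nat \<Rightarrow> real) \<Rightarrow> real" where
  "eig_mean m \<phi> x = (\<Sum>k<2*m+1. \<phi> (circ_eig (2 * m + 1) x k / sqrt (2 * m + 2))) / (2 * m + 1)"

lemma circ_eig_upd:
  assumes "j \<le> m"
  shows "circ_eig (2 * m + 1) (x(j := 0)) k = circ_eig (2 * m + 1) x k - eig_coeff m j k * x j"
proof -
  have "(\<Sum>i\<in>{..m}-{j}. eig_coeff m i k * (x(j := 0)) i) = (\<Sum>i\<in>{..m}-{j}. eig_coeff m i k * x i)"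
    by (rule sum.cong) auto
  then show ?thesis
    unfolding circ_eig_half using assms by (simp add: sum.remove[of "{..m}" j])
qed

text \<open>To first order the \<open>j\<close>-th increment is \<open>x j\<close> times a partial
  derivative \<open>G j\<close>. The squares of \<open>G j\<close> sum to O(1/N) by Bessel, and
  Cauchy--Schwarz separates them from the powers of \<open>x j\<close>. The quadratic remainders are
  of size \<open>(x j)\<^sup>2 / N\<close> each and are summed crudely.\<close>

lemma eig_mean_increments:
  fixes x :: "nat \<Rightarrow> real" and m :: nat
  assumes \<phi>': "\<And>y. \<bar>\<phi>' y\<bar> \<le> L" and \<phi>: "\<And>y d. \<bar>\<phi> (y + d) - \<phi> y - d * \<phi>' y\<bar> \<le> K * d\<^sup>2"
  defines "N \<equiv> real (2 * m + 2)"
  shows "(\<Sum>j\<le>m. (eig_mean m \<phi> x - eig_mean m \<phi> (x(j := 0)))\<^sup>2)\<^sup>2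
           \<le> (128 * L ^ 4 + 2048 * K ^ 4) * (sqrt N + (\<Sum>j\<le>m. x j ^ 8) / sqrt N) / N\<^sup>2"
proof -
  define n where "n = 2 * m + 1"
  have n: "real n > 0" and N: "N > 0" "N \<ge> 1" "N \<ge> n" "N \<ge> m + 1"
    by (simp_all add: n_def N_def)
  have L: "L \<ge> 0"
    using \<phi>'[of 0] by linarith
  have K: "K \<ge> 0"
    using \<phi>[of 0 1] by simp
  define y where "y k = circ_eig n x k / sqrt N" for k
  \<comment> \<open>The partial derivative of \<open>eig_mean m \<phi>\<close> with respect to
    coordinate \<open>j\<close>, at \<open>x\<close>.\<close>
  define G where "G j = (\<Sum>k<n. eig_coeff m j k * \<phi>' (y k)) / (n * sqrt N)" for j
  define D where "D j = eig_mean m \<phi> x - eig_mean m \<phi> (x(j := 0))" for j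
  define T where "T = (\<Sum>j\<le>m. x j ^ 8)"
  have T: "T \<ge> 0"
    unfolding T_def by (intro sum_nonneg) simp
  have DG: "\<bar>D j - x j * G j\<bar> \<le> 4 * K * (x j)\<^sup>2 / N" if "j \<le> m" for j
  proof -
    define d where "d k = - (eig_coeff m j k * x j / sqrt N)" for k
    have "D j = (\<Sum>k<n. \<phi> (y k) - \<phi> (y k + d k)) / n"
      unfolding D_def eig_mean_def circ_eig_upd[OF that]
      by (simp add: y_def d_def n_def N_def diff_divide_distrib sum_subtractf add_ac)
    moreover have "x j * G j = (\<Sum>k<n. - (d k * \<phi>' (y k))) / n"
      unfolding G_def d_def by (simp add: sum_distrib_left sum_divide_distrib algebra_simps)
    ultimately have "D j - x j * G j = (\<Sum>k<n. - (\<phi> (y k + d k) - \<phi> (y k) - d k * \<phi>' (y k))) / n"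
      by (simp add: diff_divide_distrib[symmetric] sum_subtractf[symmetric] algebra_simps)
    then have "\<bar>D j - x j * G j\<bar> = \<bar>\<Sum>k<n. - (\<phi> (y k + d k) - \<phi> (y k) - d k * \<phi>' (y k))\<bar> / n"
      by simp
    also have "\<dots> \<le> (\<Sum>k<n. \<bar>- (\<phi> (y k + d k) - \<phi> (y k) - d k * \<phi>' (y k))\<bar>) / n"
      by (intro divide_right_mono sum_abs) simp
    also have "\<dots> \<le> (\<Sum>k<n. 4 * K * (x j)\<^sup>2 / N) / n"
    proof (intro divide_right_mono sum_mono)
      fix k
      have "(d k)\<^sup>2 = (eig_coeff m j k)\<^sup>2 * (x j)\<^sup>2 / N"
        using N by (simp add: d_def power_mult_distrib power_divide)
      also have "\<dots> \<le> 4 * (x j)\<^sup>2 / N"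
        using N bounded_power2[OF abs_eig_coeff_le[of m j k]]
        by (intro divide_right_mono mult_right_mono) auto
      finally have "K * (d k)\<^sup>2 \<le> K * (4 * (x j)\<^sup>2 / N)"
        using K by (rule mult_left_mono)
      then show "\<bar>- (\<phi> (y k + d k) - \<phi> (y k) - d k * \<phi>' (y k))\<bar> \<le> 4 * K * (x j)\<^sup>2 / N"
        unfolding abs_minus_cancel using \<phi>[of "y k" "d k"] by (simp add: mult_ac)
    qed simp
    also have "\<dots> = 4 * K * (x j)\<^sup>2 / N"
      using n by simp
    finally show ?thesis .
  qed
  have sumG: "(\<Sum>j\<le>m. (G j)\<^sup>2) \<le> 4 * L\<^sup>2 / N"
  proof -
    have "(G j)\<^sup>2 = (\<Sum>k<n. eig_coeff m j k * \<phi>' (y k))\<^sup>2 / (n\<^sup>2 * N)" for j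
      using N by (simp add: G_def power_divide power_mult_distrib)
    then have "(\<Sum>j\<le>m. (G j)\<^sup>2) = (\<Sum>j\<le>m. (\<Sum>k<n. eig_coeff m j k * \<phi>' (y k))\<^sup>2) / (n\<^sup>2 * N)"
      by (simp add: sum_divide_distrib)
    also have "\<dots> \<le> (4 * real n * (\<Sum>k<n. (\<phi>' (y k))\<^sup>2)) / (n\<^sup>2 * N)"
      using N unfolding n_def by (intro divide_right_mono bessel_eig_coeff) auto
    also have "\<dots> \<le> (4 * real n * (\<Sum>k<n. L\<^sup>2)) / (n\<^sup>2 * N)"
      using N bounded_power2[OF \<phi>'] by (intro divide_right_mono mult_left_mono sum_mono) auto
    also have "\<dots> = 4 * L\<^sup>2 / N"
      using n N by (simp add: power2_eq_square field_simps)
    finally show ?thesis .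
  qed
  define A where "A = (\<Sum>j\<le>m. (x j)\<^sup>2 * (G j)\<^sup>2)"
  define Q where "Q = (\<Sum>j\<le>m. (x j)^4)"
  have A2: "A\<^sup>2 \<le> 16 * L ^ 4 * (sqrt N + T / sqrt N) / N\<^sup>2"
  proof -
    have "A\<^sup>2 = (\<Sum>j\<le>m. ((x j)\<^sup>2 * G j) * G j)\<^sup>2"
      by (simp add: A_def power2_eq_square mult.assoc)
    also have "\<dots> \<le> (\<Sum>j\<le>m. ((x j)\<^sup>2 * G j)\<^sup>2) * (\<Sum>j\<le>m. (G j)\<^sup>2)"
      by (rule Cauchy_Schwarz_ineq_sum)
    also have "\<dots> \<le> ((4 * L\<^sup>2 / N) * (sqrt N + T / sqrt N)) * (4 * L\<^sup>2 / N)"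
    proof (intro mult_mono sumG)
      have "(\<Sum>j\<le>m. ((x j)\<^sup>2 * G j)\<^sup>2) \<le> (\<Sum>j\<le>m. sqrt N * (G j)\<^sup>2 + (4 * L\<^sup>2 / N) / sqrt N * x j ^ 8)"
      proof (rule sum_mono)
        fix j assume j: "j \<in> {..m}"
        have Gj: "(G j)\<^sup>2 \<le> 4 * L\<^sup>2 / N"
          using sumG member_le_sum[OF j, of "\<lambda>j. (G j)\<^sup>2"] by simp
        \<comment> \<open>The threshold sqrt N balances two costs: moderate \<open>x j\<close> are
          paid for by the l^2 bound on all of \<open>G\<close>, large ones by the eighth power and
          the bound on the single \<open>G j\<close>. If the eighth powers sum to O(N), both
          contributions are of order sqrt N.\<close>
        have "x j ^ 4 \<le> sqrt N + x j ^ 8 / sqrt N"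
        proof -
          have "0 \<le> (x j ^ 4 - sqrt N)\<^sup>2 + x j ^ 4 * sqrt N"
            using N by simp
          then have "x j ^ 4 * sqrt N \<le> sqrt N * sqrt N + x j ^ 8"
            by (simp add: power2_eq_square algebra_simps power_add[symmetric])
          then show ?thesis
            using N by (simp add: field_simps)
        qed
        then have "x j ^ 4 * (G j)\<^sup>2 \<le> (sqrt N + x j ^ 8 / sqrt N) * (G j)\<^sup>2"
          by (intro mult_right_mono) auto
        also have "\<dots> = sqrt N * (G j)\<^sup>2 + (x j ^ 8 / sqrt N) * (G j)\<^sup>2"
          by (simp add: distrib_right)
        also have "(x j ^ 8 / sqrt N) * (G j)\<^sup>2 \<le> (x j ^ 8 / sqrt N) * (4 * L\<^sup>2 / N)"
          using N Gj by (intro mult_left_mono) auto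
        finally show "((x j)\<^sup>2 * G j)\<^sup>2 \<le> sqrt N * (G j)\<^sup>2 + (4 * L\<^sup>2 / N) / sqrt N * x j ^ 8"
          by (simp add: power_mult_distrib mult_ac flip: power_mult)
      qed
      also have "\<dots> = sqrt N * (\<Sum>j\<le>m. (G j)\<^sup>2) + (4 * L\<^sup>2 / N) / sqrt N * T"
        by (simp add: sum.distrib sum_distrib_left T_def)
      also have "\<dots> \<le> sqrt N * (4 * L\<^sup>2 / N) + (4 * L\<^sup>2 / N) / sqrt N * T"
        using N sumG by (intro add_mono mult_left_mono) auto
      also have "\<dots> = (4 * L\<^sup>2 / N) * (sqrt N + T / sqrt N)"
        by (simp add: algebra_simps add_divide_distrib)
      finally show "(\<Sum>j\<le>m. ((x j)\<^sup>2 * G j)\<^sup>2) \<le> (4 * L\<^sup>2 / N) * (sqrt N + T / sqrt N)" .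
    qed (use N T in \<open>auto intro!: sum_nonneg\<close>)
    also have "(4 * L\<^sup>2 / N) * U * (4 * L\<^sup>2 / N) = 16 * L ^ 4 * U / N\<^sup>2" for U
      by (simp add: power2_eq_square power4_eq_xxxx)
    finally show ?thesis .
  qed
  \<comment> \<open>The remainder enters with a prefactor N^(-4), so this lossy use of
    Cauchy--Schwarz still fits the target bound.\<close>
  have Q2: "Q\<^sup>2 \<le> N * T"
  proof -
    have "Q\<^sup>2 = (\<Sum>j\<le>m. 1 * x j ^ 4)\<^sup>2"
      by (simp add: Q_def)
    also have "\<dots> \<le> (\<Sum>j\<le>m. 1\<^sup>2) * (\<Sum>j\<le>m. (x j ^ 4)\<^sup>2)"
      by (rule Cauchy_Schwarz_ineq_sum)
    also have "\<dots> = (m + 1) * T"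
      by (simp add: T_def flip: power_mult)
    also have "\<dots> \<le> N * T"
      using N T by (intro mult_right_mono) auto
    finally show ?thesis .
  qed
  have "(\<Sum>j\<le>m. (D j)\<^sup>2) \<le> (\<Sum>j\<le>m. 2 * ((x j)\<^sup>2 * (G j)\<^sup>2) + 32 * K\<^sup>2 / N\<^sup>2 * x j ^ 4)"
  proof (rule sum_mono)
    fix j assume "j \<in> {..m}"
    then have "\<bar>D j - x j * G j\<bar> \<le> 4 * K * (x j)\<^sup>2 / N"
      using DG by simp
    then have E: "(D j - x j * G j)\<^sup>2 \<le> (4 * K * (x j)\<^sup>2 / N)\<^sup>2"
      by (metis abs_ge_zero power2_abs power_mono)
    have "(D j)\<^sup>2 \<le> 2 * (x j * G j)\<^sup>2 + 2 * (D j - x j * G j)\<^sup>2"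
      using zero_le_power2[of "D j - 2 * (x j * G j)"] by (simp add: power2_eq_square algebra_simps)
    also have "\<dots> \<le> 2 * (x j * G j)\<^sup>2 + 2 * (4 * K * (x j)\<^sup>2 / N)\<^sup>2"
      using E by simp
    also have "\<dots> = 2 * ((x j)\<^sup>2 * (G j)\<^sup>2) + 32 * K\<^sup>2 / N\<^sup>2 * x j ^ 4"
      by (simp add: power_mult_distrib power_divide flip: power_mult)
    finally show "(D j)\<^sup>2 \<le> 2 * ((x j)\<^sup>2 * (G j)\<^sup>2) + 32 * K\<^sup>2 / N\<^sup>2 * x j ^ 4" .
  qed
  also have "\<dots> = 2 * A + 32 * K\<^sup>2 / N\<^sup>2 * Q"
    by (simp add: A_def Q_def sum.distrib sum_distrib_left)
  finally have "(\<Sum>j\<le>m. (D j)\<^sup>2)\<^sup>2 \<le> (2 * A + 32 * K\<^sup>2 / N\<^sup>2 * Q)\<^sup>2"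
    by (intro power_mono) (auto intro!: sum_nonneg)
  also have "\<dots> \<le> 8 * A\<^sup>2 + 2 * (32 * K\<^sup>2 / N\<^sup>2 * Q)\<^sup>2"
  proof -
    have "(2 * A + u)\<^sup>2 \<le> 8 * A\<^sup>2 + 2 * u\<^sup>2" for u
      using zero_le_power2[of "2 * A - u"] by (simp add: power2_eq_square algebra_simps)
    then show ?thesis .
  qed
  also have "(32 * K\<^sup>2 / N\<^sup>2 * Q)\<^sup>2 = 1024 * K ^ 4 / N ^ 4 * Q\<^sup>2"
    by (simp add: power_mult_distrib power_divide flip: power_mult)
  also have "8 * A\<^sup>2 + 2 * (1024 * K ^ 4 / N ^ 4 * Q\<^sup>2) \<le>
      8 * (16 * L ^ 4 * (sqrt N + T / sqrt N) / N\<^sup>2) + 2 * (1024 * K ^ 4 * ((sqrt N + T / sqrt N) / N\<^sup>2))"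
  proof -
    have "1024 * K ^ 4 / N ^ 4 * Q\<^sup>2 \<le> 1024 * K ^ 4 / N ^ 4 * (N * T)"
      by (intro mult_left_mono Q2) simp
    also have "\<dots> = 1024 * K ^ 4 * (T / N / N\<^sup>2)"
      using N by (simp add: power2_eq_square power4_eq_xxxx)
    also have "\<dots> \<le> 1024 * K ^ 4 * ((sqrt N + T / sqrt N) / N\<^sup>2)"
    proof (intro mult_left_mono divide_right_mono)
      have "sqrt N \<le> N"
        using N real_sqrt_le_mono[of N "N\<^sup>2"] by (simp add: self_le_power)
      then have "T / N \<le> T / sqrt N"
        using N T by (intro divide_left_mono) auto
      then show "T / N \<le> sqrt N + T / sqrt N"
        using N by (simp add: add_increasing)
    qed (use N in auto)
    finally show ?thesis
      using A2 by linarith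
  qed
  also have "\<dots> = (128 * L ^ 4 + 2048 * K ^ 4) * (sqrt N + T / sqrt N) / N\<^sup>2"
    by (simp add: algebra_simps add_divide_distrib)
  finally show ?thesis
    by (simp add: D_def T_def)
qed

section \<open>From fourth moments to almost sure concentration\<close>

text \<open>By independence the joint law of the \<open>X i\<close> is a product measure, so the
  product space inequality transfers. Restricting to \<open>J\<close> yields functions with an
  unspecified value outside \<open>J\<close>; the hypothesis \<open>local\<close> makes
  \<open>f\<close> blind to it.\<close>

lemma (in prob_space) indep_central_fourth_moment_le:
  fixes X :: "'i \<Rightarrow> 'a \<Rightarrow> real" and f :: "('i \<Rightarrow> real) \<Rightarrow> real"
  assumes X: "indep_vars (\<lambda>_. borel) X J" and J: "finite J" "J \<noteq> {}"
    and f [measurable]: "f \<in> borel_measurable (Pi\<^sub>M J (\<lambda>_. borel))"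
    and B: "\<And>x. \<bar>f x\<bar> \<le> B" and local: "\<And>x. f (restrict x J) = f x"
  shows "expectation (\<lambda>\<omega>. (f (\<lambda>i. X i \<omega>) - expectation (\<lambda>\<omega>. f (\<lambda>i. X i \<omega>))) ^ 4)
           \<le> 70 * expectation (\<lambda>\<omega>. (\<Sum>i\<in>J. (f (\<lambda>i. X i \<omega>) - f ((\<lambda>i. X i \<omega>)(i := 0)))\<^sup>2)\<^sup>2)"
proof -
  \<comment> \<open>The locale of product spaces asks for a probability measure at every index, so a
    point mass at 0 is put outside \<open>J\<close>.\<close>
  define P where "P i = (if i \<in> J then distr M borel (X i) else return borel 0)" for i
  have rv: "random_variable borel (X i)" if "i \<in> J" for i
    using X that by (simp add: indep_vars_def)
  have P: "prob_space (P i)" for i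
    using rv[of i] by (auto simp: P_def intro: prob_space_distr prob_space_return)
  have setsP: "sets (P i) = sets borel" for i
    by (simp add: P_def)
  have spaceP: "space (P i) = UNIV" for i
    using sets_eq_imp_space_eq[OF setsP[of i]] by simp
  interpret prod: product_prob_space P J
    by (simp add: product_prob_space_def product_prob_space_axioms_def product_sigma_finite_def P prob_space_imp_sigma_finite)
  have PiM_P: "Pi\<^sub>M J P = distr M (Pi\<^sub>M J (\<lambda>_. borel)) (\<lambda>\<omega>. \<lambda>i\<in>J. X i \<omega>)"
  proof -
    have "distr M (Pi\<^sub>M J (\<lambda>_. borel)) (\<lambda>\<omega>. \<lambda>i\<in>J. X i \<omega>) = Pi\<^sub>M J (\<lambda>i. distr M borel (X i))"
      using X indep_vars_iff_distr_eq_PiM'[where X = X and M' = "\<lambda>_. borel" and I = J, OF J(2) rv] by simp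
    also have "\<dots> = Pi\<^sub>M J P"
      by (rule PiM_cong) (simp_all add: P_def)
    finally show ?thesis ..
  qed
  have sets: "sets (Pi\<^sub>M J P) = sets (Pi\<^sub>M J (\<lambda>_. borel))"
    by (rule sets_PiM_cong) (simp_all add: setsP)
  have fP: "f \<in> borel_measurable (Pi\<^sub>M J P)"
    using f by (simp add: measurable_cong_sets[OF sets refl])
  have transfer: "(\<integral>x. g x \<partial>Pi\<^sub>M J P) = expectation (\<lambda>\<omega>. g (\<lambda>i\<in>J. X i \<omega>))"
    if "g \<in> borel_measurable (Pi\<^sub>M J (\<lambda>_. borel))" for g :: "('i \<Rightarrow> real) \<Rightarrow> real"
    unfolding PiM_P by (rule integral_distr[OF measurable_restrict[OF rv] that])
  have upd: "(\<lambda>x. f (x(i := 0))) \<in> borel_measurable (Pi\<^sub>M J (\<lambda>_. borel))" if "i \<in> J" for i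
    by (rule measurable_compose[OF measurable_fun_upd_const[OF that] f]) simp
  have local': "f ((\<lambda>i\<in>J. x i)(i := 0)) = f (x(i := 0))" if "i \<in> J" for x i
  proof -
    have "(\<lambda>i\<in>J. x i)(i := 0) = restrict (x(i := 0)) J"
      using that by auto
    then show ?thesis by (simp add: local)
  qed
  have mean: "(\<integral>x. f x \<partial>Pi\<^sub>M J P) = expectation (\<lambda>\<omega>. f (\<lambda>i. X i \<omega>))"
    by (subst transfer[OF f]) (simp add: local)
  have "(\<integral>x. (f x - (\<integral>x. f x \<partial>Pi\<^sub>M J P)) ^ 4 \<partial>Pi\<^sub>M J P)
           \<le> 70 * (\<integral>x. (\<Sum>i\<in>J. (f x - f (x(i := 0)))\<^sup>2)\<^sup>2 \<partial>Pi\<^sub>M J P)"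
    by (rule prod.central_fourth_moment_le[OF J(1) fP B]) (simp add: spaceP)
  also have "(\<integral>x. (f x - (\<integral>x. f x \<partial>Pi\<^sub>M J P)) ^ 4 \<partial>Pi\<^sub>M J P) =
      expectation (\<lambda>\<omega>. (f (\<lambda>i. X i \<omega>) - expectation (\<lambda>\<omega>. f (\<lambda>i. X i \<omega>))) ^ 4)"
    unfolding mean by (subst transfer) (simp_all add: local)
  also have "(\<integral>x. (\<Sum>i\<in>J. (f x - f (x(i := 0)))\<^sup>2)\<^sup>2 \<partial>Pi\<^sub>M J P) =
      expectation (\<lambda>\<omega>. (\<Sum>i\<in>J. (f (\<lambda>i\<in>J. X i \<omega>) - f ((\<lambda>i\<in>J. X i \<omega>)(i := 0)))\<^sup>2)\<^sup>2)"
    by (rule transfer) (intro borel_measurable_power borel_measurable_sum borel_measurable_diff f upd)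
  also have "\<dots> = expectation (\<lambda>\<omega>. (\<Sum>i\<in>J. (f (\<lambda>i. X i \<omega>) - f ((\<lambda>i. X i \<omega>)(i := 0)))\<^sup>2)\<^sup>2)"
    by (simp add: local local' cong: sum.cong)
  finally show ?thesis .
qed

text \<open>The series of fourth powers has finite expectation, so it converges almost surely and
  its terms tend to 0. This takes the place of Markov's inequality and Borel--Cantelli.\<close>

lemma (in prob_space) AE_tendsto_0_if_summable_fourth_moment:
  fixes Z :: "nat \<Rightarrow> 'a \<Rightarrow> real"
  assumes [measurable]: "\<And>n. random_variable borel (Z n)" and B: "\<And>n \<omega>. \<bar>Z n \<omega>\<bar> \<le> B"
    and sum: "summable (\<lambda>n. expectation (\<lambda>\<omega>. (Z n \<omega>) ^ 4))"
  shows "AE \<omega> in M. (\<lambda>n. Z n \<omega>) \<longlonglongrightarrow> 0"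
proof -
  have int: "integrable M (\<lambda>\<omega>. (Z n \<omega>) ^ 4)" for n
  proof (rule integrable_bounded)
    show "\<bar>(Z n \<omega>) ^ 4\<bar> \<le> B ^ 4" for \<omega>
      unfolding power_abs by (intro power_mono B) simp
  qed measurable
  have "(\<integral>\<^sup>+\<omega>. (\<Sum>n. ennreal ((Z n \<omega>) ^ 4)) \<partial>M) = (\<Sum>n. \<integral>\<^sup>+\<omega>. ennreal ((Z n \<omega>) ^ 4) \<partial>M)"
    by (rule nn_integral_suminf) measurable
  also have "\<dots> = (\<Sum>n. ennreal (expectation (\<lambda>\<omega>. (Z n \<omega>) ^ 4)))"
    by (intro suminf_cong nn_integral_eq_integral int) auto
  also have "\<dots> = ennreal (\<Sum>n. expectation (\<lambda>\<omega>. (Z n \<omega>) ^ 4))"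
    by (rule suminf_ennreal2[OF _ sum]) auto
  finally have "(\<integral>\<^sup>+\<omega>. (\<Sum>n. ennreal ((Z n \<omega>) ^ 4)) \<partial>M) \<noteq> \<infinity>"
    by simp
  then have "AE \<omega> in M. (\<Sum>n. ennreal ((Z n \<omega>) ^ 4)) \<noteq> \<infinity>"
    by (intro nn_integral_noteq_infinite) measurable
  then show ?thesis
  proof (eventually_elim)
    fix \<omega> assume "(\<Sum>n. ennreal ((Z n \<omega>) ^ 4)) \<noteq> \<infinity>"
    then have "summable (\<lambda>n. (Z n \<omega>) ^ 4)"
      by (intro summable_suminf_not_top) auto
    then have "(\<lambda>n. (Z n \<omega>) ^ 4) \<longlonglongrightarrow> 0"
      by (rule summable_LIMSEQ_zero)
    then show "(\<lambda>n. Z n \<omega>) \<longlonglongrightarrow> 0"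
      by (simp add: power_tendsto_0_iff)
  qed
qed

lemma eig_mean_measurable:
  assumes [measurable]: "\<phi> \<in> borel_measurable borel"
  shows "eig_mean m \<phi> \<in> borel_measurable (Pi\<^sub>M {..m} (\<lambda>_. borel))"
  unfolding eig_mean_def circ_eig_half
proof (intro borel_measurable_divide borel_measurable_sum borel_measurable_const)
  fix k
  have "(\<lambda>x. (\<Sum>j\<le>m. eig_coeff m j k * x j) / sqrt (2 * m + 2)) \<in> borel_measurable (Pi\<^sub>M {..m} (\<lambda>_. borel))"
    by (intro borel_measurable_divide borel_measurable_sum borel_measurable_times borel_measurable_const
        measurable_component_singleton)
  then show "(\<lambda>x. \<phi> ((\<Sum>j\<le>m. eig_coeff m j k * x j) / sqrt (2 * m + 2))) \<in> borel_measurable (Pi\<^sub>M {..m} (\<lambda>_. borel))"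
    by (rule measurable_compose) measurable
qed

lemma eig_mean_bounded:
  assumes "\<And>y. \<bar>\<phi> y\<bar> \<le> B"
  shows "\<bar>eig_mean m \<phi> x\<bar> \<le> B"
proof -
  have "\<bar>\<Sum>k<2*m+1. \<phi> (circ_eig (2 * m + 1) x k / sqrt (2 * m + 2))\<bar> \<le> (\<Sum>k<2*m+1. B)"
    by (rule order_trans[OF sum_abs sum_mono]) (rule assms)
  then show ?thesis
    by (simp add: eig_mean_def field_simps)
qed

lemma summable_power_neg_3_2: "summable (\<lambda>m. 1 / (real (2 * m + 2) * sqrt (2 * m + 2)))"
proof (rule summable_comparison_test')
  show "summable (\<lambda>m. 1 / real (Suc m) powr (3/2))"
  proof -
    have "summable (\<lambda>m. real m powr - (3/2))"
      by (simp add: summable_real_powr_iff)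
    then have "summable (\<lambda>m. real (Suc m) powr - (3/2))"
      by (rule iffD2[OF summable_Suc_iff])
    then show ?thesis
      by (simp only: powr_minus_divide)
  qed
  fix m :: nat
  have "real (Suc m) powr (3/2) = real (Suc m) powr 1 * real (Suc m) powr (1/2)"
    unfolding powr_add[symmetric] by simp
  also have "\<dots> = real (Suc m) * sqrt (real (Suc m))"
    by (simp add: powr_half_sqrt)
  also have "\<dots> \<le> real (2 * m + 2) * sqrt (2 * m + 2)"
    by (intro mult_mono) auto
  finally have "real (Suc m) powr (3/2) \<le> real (2 * m + 2) * sqrt (2 * m + 2)" .
  then show "norm (1 / (real (2 * m + 2) * sqrt (2 * m + 2))) \<le> 1 / real (Suc m) powr (3/2)"
    by (simp add: frac_le)
qed

lemma (in prob_space) eig_mean_concentration: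
  fixes b :: "nat \<Rightarrow> 'a \<Rightarrow> real"
  assumes b: "indep_vars (\<lambda>_. borel) b UNIV"
    and int: "\<And>i. integrable M (\<lambda>\<omega>. b i \<omega> ^ 8)" and c: "\<And>i. expectation (\<lambda>\<omega>. b i \<omega> ^ 8) \<le> c"
    and m\<phi> [measurable]: "\<phi> \<in> borel_measurable borel" and B: "\<And>y. \<bar>\<phi> y\<bar> \<le> B"
    and \<phi>': "\<And>y. \<bar>\<phi>' y\<bar> \<le> L" and \<phi>: "\<And>y d. \<bar>\<phi> (y + d) - \<phi> y - d * \<phi>' y\<bar> \<le> K * d\<^sup>2"
  shows "AE \<omega> in M. (\<lambda>m. eig_mean m \<phi> (\<lambda>i. b i \<omega>) - expectation (\<lambda>\<omega>. eig_mean m \<phi> (\<lambda>i. b i \<omega>))) \<longlonglongrightarrow> 0"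
proof (rule AE_tendsto_0_if_summable_fourth_moment)
  have rv [measurable]: "random_variable borel (b i)" for i
    using b by (simp add: indep_vars_def)
  have local: "eig_mean m \<phi> (restrict x {..m}) = eig_mean m \<phi> x" for m x
  proof -
    have "circ_eig (2 * m + 1) (restrict x {..m}) k = circ_eig (2 * m + 1) x k" for k
      unfolding circ_eig_half by (rule sum.cong) auto
    then show ?thesis
      by (simp only: eig_mean_def)
  qed
  have em: "random_variable borel (\<lambda>\<omega>. eig_mean m \<phi> (\<lambda>i. b i \<omega>))" for m
  proof -
    have "random_variable borel (\<lambda>\<omega>. eig_mean m \<phi> (\<lambda>i\<in>{..m}. b i \<omega>))"
      by (rule measurable_compose[OF measurable_restrict[OF rv] eig_mean_measurable[OF m\<phi>]])
    then show ?thesis by (simp add: local)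
  qed
  let ?E = "\<lambda>m. expectation (\<lambda>\<omega>. eig_mean m \<phi> (\<lambda>i. b i \<omega>))"
  show "random_variable borel (\<lambda>\<omega>. eig_mean m \<phi> (\<lambda>i. b i \<omega>) - ?E m)" for m
    using em[of m] by measurable
  show "\<bar>eig_mean m \<phi> (\<lambda>i. b i \<omega>) - ?E m\<bar> \<le> B + B" for m \<omega>
  proof -
    have "\<bar>?E m\<bar> \<le> B"
      by (rule expectation_bounded) (rule eig_mean_bounded[where \<phi> = \<phi>, OF B])
    then show ?thesis
      using eig_mean_bounded[where \<phi> = \<phi>, OF B, of m "\<lambda>i. b i \<omega>"] by linarith
  qed
  define A where "A = 128 * L ^ 4 + 2048 * K ^ 4"
  have A: "A \<ge> 0" by (simp add: A_def)
  have c0: "c \<ge> 0"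
    using c[of 0] by (rule order_trans[rotated]) simp
  \<comment> \<open>The eighth moments sum to at most N c, so the increment bound has expectation at
    most A (sqrt N + c sqrt N) / N^2, which is of order N^(-3/2).\<close>
  have le: "expectation (\<lambda>\<omega>. (eig_mean m \<phi> (\<lambda>i. b i \<omega>) - ?E m) ^ 4) \<le> 70 * A * (1 + c) * (1 / (real (2 * m + 2) * sqrt (2 * m + 2)))" for m
  proof -
    define N where "N = real (2 * m + 2)"
    have N: "N > 0" "real (m + 1) \<le> N"
      by (simp_all add: N_def)
    let ?S = "\<lambda>\<omega>. (\<Sum>j\<le>m. (eig_mean m \<phi> (\<lambda>i. b i \<omega>) - eig_mean m \<phi> ((\<lambda>i. b i \<omega>)(j := 0)))\<^sup>2)\<^sup>2"
    let ?U = "\<lambda>\<omega>. A * (sqrt N + (\<Sum>j\<le>m. b j \<omega> ^ 8) / sqrt N) / N\<^sup>2"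
    have iU: "integrable M ?U"
      using int by simp
    have "expectation (\<lambda>\<omega>. (eig_mean m \<phi> (\<lambda>i. b i \<omega>) - ?E m) ^ 4) \<le> 70 * expectation ?S"
      by (rule indep_central_fourth_moment_le[OF indep_vars_subset[OF b] _ _ eig_mean_measurable[OF m\<phi>] eig_mean_bounded[where \<phi> = \<phi>, OF B] local]) auto
    also have "expectation ?S \<le> expectation ?U"
    proof (rule integral_mono_AE')
      show "AE \<omega> in M. ?S \<omega> \<le> ?U \<omega>"
        unfolding A_def N_def by (intro AE_I2 eig_mean_increments[OF \<phi>' \<phi>])
      show "AE \<omega> in M. 0 \<le> ?U \<omega>"
        using A N by (intro AE_I2 divide_nonneg_nonneg mult_nonneg_nonneg add_nonneg_nonneg sum_nonneg) auto
    qed (rule iU)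
    also have "expectation ?U = A * (sqrt N + (\<Sum>j\<le>m. expectation (\<lambda>\<omega>. b j \<omega> ^ 8)) / sqrt N) / N\<^sup>2"
      using int by (simp add: prob_space)
    also have "\<dots> \<le> A * (sqrt N + (N * c) / sqrt N) / N\<^sup>2"
    proof (intro divide_right_mono mult_left_mono add_left_mono)
      have "(\<Sum>j\<le>m. expectation (\<lambda>\<omega>. b j \<omega> ^ 8)) \<le> (\<Sum>j\<le>m. c)"
        by (intro sum_mono c)
      also have "\<dots> = real (m + 1) * c"
        by simp
      also have "\<dots> \<le> N * c"
        using N c0 by (intro mult_right_mono)
      finally show "(\<Sum>j\<le>m. expectation (\<lambda>\<omega>. b j \<omega> ^ 8)) \<le> N * c" .
    qed (use A N in auto)
    also have "\<dots> = A * (1 + c) * (1 / (N * sqrt N))"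
    proof -
      have "N = sqrt N * sqrt N" "sqrt N \<noteq> 0"
        using N by simp_all
      then show ?thesis
        by (simp add: field_simps power2_eq_square)
    qed
    finally show ?thesis
      by (simp add: N_def mult.assoc)
  qed
  show "summable (\<lambda>m. expectation (\<lambda>\<omega>. (eig_mean m \<phi> (\<lambda>i. b i \<omega>) - ?E m) ^ 4))"
  proof (rule summable_comparison_test')
    show "summable (\<lambda>m. 70 * A * (1 + c) * (1 / (real (2 * m + 2) * sqrt (2 * m + 2))))"
      by (rule summable_mult[OF summable_power_neg_3_2])
    show "norm (expectation (\<lambda>\<omega>. (eig_mean m \<phi> (\<lambda>i. b i \<omega>) - ?E m) ^ 4)) \<le> 70 * A * (1 + c) * (1 / (real (2 * m + 2) * sqrt (2 * m + 2)))" for m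
      using le[of m] by simp
  qed
qed

subsection \<open>Gaussian limit of the expected spectral averages\<close>

text \<open>Squared cosines average to 1/2 over a full period: their mean could deviate only if
  \<open>n\<close> divided \<open>2 * k\<close>, which is impossible for odd \<open>n\<close> and
  these \<open>k\<close>. As the square of \<open>half_weight j\<close> is twice
  \<open>half_weight j\<close> except at \<open>j = 0\<close>, the result is 2 (n / 2) - 1.\<close>

lemma sum_eig_coeff_power2:
  assumes k: "1 \<le> k" "k \<le> 2 * m"
  shows "(\<Sum>j\<le>m. (eig_coeff m j k)\<^sup>2) = 2 * real m"
proof -
  define n where "n = 2 * m + 1"
  have n: "n > 0" by (simp add: n_def)
  define c where "c j = cos (2 * pi * (real j * real k) / n)" for j
  have "(\<Sum>j\<le>m. half_weight j * (c j)\<^sup>2) = (\<Sum>j<n. (c j)\<^sup>2)"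
    unfolding n_def
  proof (rule sum_symmetric_half[symmetric])
    fix d assume "1 \<le> d" "d \<le> m"
    then show "(c (2 * m + 1 - d))\<^sup>2 = (c d)\<^sup>2"
      unfolding c_def using cos_reflect[OF n, of d k] by (simp add: n_def)
  qed
  also have "\<dots> = (\<Sum>j<n. 1 / 2 + cos (2 * pi * (real j * of_int (2 * int k)) / n) / 2)"
  proof (rule sum.cong[OF refl])
    fix j
    have "2 * pi * (real j * of_int (2 * int k)) / n = 2 * (2 * pi * (real j * real k) / n)"
      by simp
    then have "cos (2 * pi * (real j * of_int (2 * int k)) / n) = 2 * (c j)\<^sup>2 - 1"
      unfolding c_def by (simp only: cos_double_cos)
    then show "(c j)\<^sup>2 = 1 / 2 + cos (2 * pi * (real j * of_int (2 * int k)) / n) / 2"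
      by (simp add: diff_divide_distrib)
  qed
  also have "\<dots> = n / 2"
  proof -
    have "\<not> int n dvd 2 * int k"
    proof
      assume "int n dvd 2 * int k"
      moreover have "coprime (int n) 2"
        by (simp add: n_def)
      ultimately have "int n dvd int k"
        by (simp add: coprime_dvd_mult_right_iff)
      then show False
        using k by (auto simp: n_def dest!: zdvd_imp_le)
    qed
    then have "(\<Sum>j<n. cos (2 * pi * (real j * of_int (2 * int k)) / n)) = 0"
      using sum_cos_roots_of_unity[OF n, of "2 * int k"] by (simp only: if_False of_nat_0)
    then show ?thesis
      by (simp only: sum.distrib sum_divide_distrib[symmetric]) simp
  qed
  finally have half: "(\<Sum>j\<le>m. half_weight j * (c j)\<^sup>2) = n / 2" .
  have ec: "eig_coeff m j k = half_weight j * c j" for j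
    by (simp add: eig_coeff_def c_def n_def add_ac)
  have "(\<Sum>j\<le>m. (eig_coeff m j k)\<^sup>2) = (\<Sum>j\<le>m. 2 * (half_weight j * (c j)\<^sup>2) - (if j = 0 then 1 else 0))"
    by (rule sum.cong) (auto simp: ec half_weight_def power_mult_distrib c_def)
  also have "\<dots> = 2 * (\<Sum>j\<le>m. half_weight j * (c j)\<^sup>2) - 1"
    by (simp add: sum_subtractf sum_distrib_left)
  finally show ?thesis
    unfolding half by (simp add: n_def add_divide_distrib)
qed

section \<open>Characteristic functions of single eigenvalues\<close>

lemma abs_exp_minus_le:
  fixes u :: real
  assumes "u \<ge> 0"
  shows "\<bar>exp (- u) - (1 - u)\<bar> \<le> u\<^sup>2 / 2"
proof -
  have "exp (- u) = 1 / exp u"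
    by (simp add: exp_minus divide_inverse)
  also have "\<dots> \<le> 1 / (1 + u + u\<^sup>2 / 2)"
    using assms exp_lower_Taylor_quadratic[OF assms] by (intro divide_left_mono) (auto intro!: mult_pos_pos add_pos_nonneg)
  also have "\<dots> \<le> 1 - u + u\<^sup>2 / 2"
  proof -
    have "(1 - u + u\<^sup>2 / 2) * (1 + u + u\<^sup>2 / 2) = 1 + (u\<^sup>2)\<^sup>2 / 4"
      by (simp add: power2_eq_square algebra_simps)
    then show ?thesis
      using assms by (subst pos_divide_le_eq) (auto intro!: add_pos_nonneg)
  qed
  finally have "exp (- u) - (1 - u) \<le> u\<^sup>2 / 2" by simp
  moreover have "exp (- u) - (1 - u) \<ge> 0"
    using exp_ge_add_one_self[of "- u"] by simp
  ultimately show ?thesis by simp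
qed

text \<open>Both functions are compared with 1 - t^2 / 2; the constants 1/6 and 1/8 that arise are
  rounded up to 1.\<close>

lemma (in real_distribution) char_minus_gaussian_le:
  assumes int: "integrable M (\<lambda>x. x)" "integrable M (\<lambda>x. x\<^sup>2)" "integrable M (\<lambda>x. \<bar>x\<bar> ^ 3)"
    and mean: "expectation (\<lambda>x. x) = 0" and var: "variance (\<lambda>x. x) = 1"
  shows "cmod (char M t - of_real (exp (- (t\<^sup>2 / 2)))) \<le> \<bar>t\<bar> ^ 3 * expectation (\<lambda>x. \<bar>x\<bar> ^ 3) + t ^ 4"
proof -
  have "cmod (char M t - (1 - t\<^sup>2 * 1 / 2)) \<le> (t\<^sup>2 / 6) * expectation (\<lambda>x. min (6 * x\<^sup>2) (\<bar>t\<bar> * \<bar>x\<bar> ^ 3))"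
    by (rule char_approx3[OF int(1) mean int(2) var])
  also have "\<dots> \<le> (t\<^sup>2 / 6) * expectation (\<lambda>x. \<bar>t\<bar> * \<bar>x\<bar> ^ 3)"
    by (intro mult_left_mono integral_mono_AE' AE_I2) (use int in auto)
  also have "\<dots> = \<bar>t\<bar> ^ 3 * expectation (\<lambda>x. \<bar>x\<bar> ^ 3) / 6"
    by (simp add: power3_eq_cube power2_eq_square abs_mult[symmetric])
  also have "\<dots> \<le> \<bar>t\<bar> ^ 3 * expectation (\<lambda>x. \<bar>x\<bar> ^ 3)"
    by simp
  finally have 1: "cmod (char M t - (1 - t\<^sup>2 / 2)) \<le> \<bar>t\<bar> ^ 3 * expectation (\<lambda>x. \<bar>x\<bar> ^ 3)"
    by simp
  have "cmod ((1 - t\<^sup>2 / 2) - of_real (exp (- (t\<^sup>2 / 2)))) = \<bar>(1 - t\<^sup>2 / 2) - exp (- (t\<^sup>2 / 2))\<bar>"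
  proof -
    have "(1 - t\<^sup>2 / 2) - of_real (exp (- (t\<^sup>2 / 2))) = complex_of_real ((1 - t\<^sup>2 / 2) - exp (- (t\<^sup>2 / 2)))"
      by simp
    then show ?thesis
      by (simp only: norm_of_real)
  qed
  also have "\<dots> \<le> (t\<^sup>2 / 2)\<^sup>2 / 2"
    using abs_exp_minus_le[of "t\<^sup>2 / 2"] by (simp add: abs_minus_commute)
  also have "\<dots> \<le> t ^ 4"
    by (simp add: power_divide flip: power_mult)
  finally have 2: "cmod ((1 - t\<^sup>2 / 2) - of_real (exp (- (t\<^sup>2 / 2)))) \<le> t ^ 4" .
  show ?thesis
    using norm_triangle_ineq[of "char M t - (1 - t\<^sup>2 / 2)" "(1 - t\<^sup>2 / 2) - of_real (exp (- (t\<^sup>2 / 2)))"] 1 2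
    by simp
qed

text \<open>Lindeberg's replacement in Fourier form: products of factors of modulus at most 1 differ
  by at most the sum of the factorwise differences. Coefficients are at most 2 / sqrt N, so each of
  the at most N factors contributes O(N^(-3/2)). The Gaussian has the exact variance 2 m / N of the
  eigenvalue, so the passage to variance 1 is postponed to the limit.\<close>

lemma (in prob_space) char_eig_minus_gaussian_le:
  fixes b :: "nat \<Rightarrow> 'a \<Rightarrow> real"
  assumes b: "indep_vars (\<lambda>_. borel) b UNIV" and distr: "\<And>i. distr M borel (b i) = p"
    and p: "real_distribution p"
    and int: "integrable p (\<lambda>x. x)" "integrable p (\<lambda>x. x\<^sup>2)" "integrable p (\<lambda>x. \<bar>x\<bar> ^ 3)"
    and mean: "prob_space.expectation p (\<lambda>x. x) = 0" and var: "prob_space.variance p (\<lambda>x. x) = 1"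
    and k: "1 \<le> k" "k \<le> 2 * m"
  defines "N \<equiv> real (2 * m + 2)" and "c \<equiv> prob_space.expectation p (\<lambda>x. \<bar>x\<bar> ^ 3)"
  shows "cmod (char (distr M borel (\<lambda>\<omega>. circ_eig (2 * m + 1) (\<lambda>i. b i \<omega>) k / sqrt N)) t
            - of_real (exp (- (t\<^sup>2 / 2 * (2 * real m / N))))) \<le> 8 * \<bar>t\<bar> ^ 3 * c / sqrt N + 16 * t ^ 4 / N"
proof -
  interpret p: real_distribution p by fact
  have N: "N > 0" "real (m + 1) \<le> N"
    by (simp_all add: N_def)
  have rv [measurable]: "random_variable borel (b i)" for i
    using b by (simp add: indep_vars_def)
  define e where "e j = eig_coeff m j k / sqrt N" for j
  have c0: "c \<ge> 0"
    unfolding c_def by simp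
  have e_le: "\<bar>e j\<bar> \<le> 2 / sqrt N" for j
    using N abs_eig_coeff_le[of m j k] by (simp add: e_def divide_right_mono)
  have "circ_eig (2 * m + 1) (\<lambda>i. b i \<omega>) k / sqrt N = (\<Sum>j\<le>m. e j * b j \<omega>)" for \<omega>
    unfolding circ_eig_half by (simp add: e_def sum_divide_distrib)
  then have "char (distr M borel (\<lambda>\<omega>. circ_eig (2 * m + 1) (\<lambda>i. b i \<omega>) k / sqrt N)) t =
      char (distr M borel (\<lambda>\<omega>. \<Sum>j\<le>m. e j * b j \<omega>)) t"
    by simp
  also have "\<dots> = (\<Prod>j\<le>m. char (distr M borel (\<lambda>\<omega>. e j * b j \<omega>)) t)"
    by (intro char_distr_sum indep_vars_compose2[OF indep_vars_subset[OF b]]) auto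
  also have "\<dots> = (\<Prod>j\<le>m. char p (t * e j))"
  proof (rule prod.cong[OF refl])
    fix j
    have "char (distr M borel (\<lambda>\<omega>. e j * b j \<omega>)) t = char (distr M borel (b j)) (t * e j)"
      by (simp add: char_def integral_distr mult.assoc)
    then show "char (distr M borel (\<lambda>\<omega>. e j * b j \<omega>)) t = char p (t * e j)"
      by (simp add: distr)
  qed
  finally have 1: "char (distr M borel (\<lambda>\<omega>. circ_eig (2 * m + 1) (\<lambda>i. b i \<omega>) k / sqrt N)) t = (\<Prod>j\<le>m. char p (t * e j))" .
  have e2: "(t * e j)\<^sup>2 / 2 = t\<^sup>2 / 2 / N * (eig_coeff m j k)\<^sup>2" for j
    using N by (simp add: e_def power_mult_distrib power_divide)
  have "(\<Sum>j\<le>m. (t * e j)\<^sup>2 / 2) = t\<^sup>2 / 2 / N * (\<Sum>j\<le>m. (eig_coeff m j k)\<^sup>2)"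
    unfolding e2 by (rule sum_distrib_left[symmetric])
  also have "\<dots> = t\<^sup>2 / 2 * ((\<Sum>j\<le>m. (eig_coeff m j k)\<^sup>2) / N)"
    by simp
  also have "\<dots> = t\<^sup>2 / 2 * (2 * real m / N)"
    unfolding sum_eig_coeff_power2[OF k] ..
  finally have "exp (- (t\<^sup>2 / 2 * (2 * real m / N))) = exp (\<Sum>j\<le>m. - ((t * e j)\<^sup>2 / 2))"
    by (simp add: sum_negf)
  also have "\<dots> = (\<Prod>j\<le>m. exp (- ((t * e j)\<^sup>2 / 2)))"
    by (rule exp_sum) simp
  finally have 2: "of_real (exp (- (t\<^sup>2 / 2 * (2 * real m / N)))) = (\<Prod>j\<le>m. complex_of_real (exp (- ((t * e j)\<^sup>2 / 2))))"
    by (simp only: of_real_prod)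
  have "cmod ((\<Prod>j\<le>m. char p (t * e j)) - (\<Prod>j\<le>m. complex_of_real (exp (- ((t * e j)\<^sup>2 / 2))))) \<le>
      (\<Sum>j\<le>m. cmod (char p (t * e j) - complex_of_real (exp (- ((t * e j)\<^sup>2 / 2)))))"
    by (rule norm_prod_diff) (auto intro: p.cmod_char_le_1)
  also have "\<dots> \<le> (\<Sum>j\<le>m. (8 * \<bar>t\<bar> ^ 3 * c / sqrt N + 16 * t ^ 4 / N) / N)"
  proof (rule sum_mono)
    fix j
    have "cmod (char p (t * e j) - complex_of_real (exp (- ((t * e j)\<^sup>2 / 2)))) \<le> \<bar>t * e j\<bar> ^ 3 * c + (t * e j) ^ 4"
      unfolding c_def by (rule p.char_minus_gaussian_le[OF int mean var])
    also have "\<dots> \<le> (\<bar>t\<bar> * (2 / sqrt N)) ^ 3 * c + (\<bar>t\<bar> * (2 / sqrt N)) ^ 4"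
    proof -
      have te: "\<bar>t * e j\<bar> \<le> \<bar>t\<bar> * (2 / sqrt N)"
        unfolding abs_mult by (intro mult_left_mono e_le) simp
      have "(t * e j) ^ 4 = \<bar>t * e j\<bar> ^ 4"
        by (simp add: power_even_abs)
      also have "\<dots> \<le> (\<bar>t\<bar> * (2 / sqrt N)) ^ 4"
        by (intro power_mono te) simp
      finally have "(t * e j) ^ 4 \<le> (\<bar>t\<bar> * (2 / sqrt N)) ^ 4" .
      then show ?thesis
        by (rule add_mono[rotated]) (intro mult_right_mono[OF _ c0] power_mono[OF te] abs_ge_zero)
    qed
    also have "\<dots> = (8 * \<bar>t\<bar> ^ 3 * c / sqrt N + 16 * t ^ 4 / N) / N"
    proof -
      define s where "s = sqrt N"
      have s: "sqrt N = s" "N = s * s"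
        using N by (simp_all add: s_def)
      have pow: "(a * (2 / s)) ^ 3 = 8 * a ^ 3 / (s * s * s)" "(a * (2 / s)) ^ 4 = 16 * a ^ 4 / (s * s * (s * s))" for a
        by (simp_all add: power3_eq_cube power4_eq_xxxx mult_ac)
      have "\<bar>t\<bar> ^ 4 = t ^ 4"
        by (simp add: power_even_abs)
      then show ?thesis
        unfolding s(1) pow unfolding s(2) by (simp add: add_divide_distrib mult_ac)
    qed
    finally show "cmod (char p (t * e j) - complex_of_real (exp (- ((t * e j)\<^sup>2 / 2)))) \<le> (8 * \<bar>t\<bar> ^ 3 * c / sqrt N + 16 * t ^ 4 / N) / N" .
  qed
  also have "\<dots> = real (m + 1) * ((8 * \<bar>t\<bar> ^ 3 * c / sqrt N + 16 * t ^ 4 / N) / N)"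
    by simp
  also have "\<dots> \<le> N * ((8 * \<bar>t\<bar> ^ 3 * c / sqrt N + 16 * t ^ 4 / N) / N)"
    using N c0 by (intro mult_right_mono) (auto intro!: add_nonneg_nonneg)
  also have "\<dots> = 8 * \<bar>t\<bar> ^ 3 * c / sqrt N + 16 * t ^ 4 / N"
    using N by simp
  finally show ?thesis
    unfolding 1 2 .
qed

text \<open>Letting the index \<open>k m\<close> vary arbitrarily with \<open>m\<close> is how
  uniformity in the index is expressed.\<close>

lemma (in prob_space) weak_conv_eig:
  fixes b :: "nat \<Rightarrow> 'a \<Rightarrow> real"
  assumes b: "indep_vars (\<lambda>_. borel) b UNIV" and distr: "\<And>i. distr M borel (b i) = p"
    and p: "real_distribution p"
    and int: "integrable p (\<lambda>x. x)" "integrable p (\<lambda>x. x\<^sup>2)" "integrable p (\<lambda>x. \<bar>x\<bar> ^ 3)"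
    and mean: "prob_space.expectation p (\<lambda>x. x) = 0" and var: "prob_space.variance p (\<lambda>x. x) = 1"
    and k: "\<And>m. m \<ge> 1 \<Longrightarrow> 1 \<le> k m \<and> k m \<le> 2 * m"
  shows "weak_conv_m (\<lambda>m. distr M borel (\<lambda>\<omega>. circ_eig (2 * m + 1) (\<lambda>i. b i \<omega>) (k m) / sqrt (real (2 * m + 2))))
           std_normal_distribution"
proof (rule levy_continuity)
  have rv [measurable]: "random_variable borel (b i)" for i
    using b by (simp add: indep_vars_def)
  show "real_distribution (distr M borel (\<lambda>\<omega>. circ_eig (2 * m + 1) (\<lambda>i. b i \<omega>) (k m) / sqrt (real (2 * m + 2))))" for m
    unfolding circ_eig_half by (rule real_distribution_distr) measurable
  show "real_distribution std_normal_distribution"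
    by (rule real_dist_normal_dist)
  fix t
  let ?c = "prob_space.expectation p (\<lambda>x. \<bar>x\<bar> ^ 3)"
  let ?ch = "\<lambda>m. char (distr M borel (\<lambda>\<omega>. circ_eig (2 * m + 1) (\<lambda>i. b i \<omega>) (k m) / sqrt (real (2 * m + 2)))) t"
  let ?g = "\<lambda>m. exp (- (t\<^sup>2 / 2 * (2 * real m / real (2 * m + 2))))"
  let ?err = "\<lambda>m. 8 * \<bar>t\<bar> ^ 3 * ?c / sqrt (real (2 * m + 2)) + 16 * t ^ 4 / real (2 * m + 2)"
  have "(\<lambda>m. ?ch m - of_real (?g m)) \<longlonglongrightarrow> 0"
  proof (rule Lim_null_comparison)
    show "\<forall>\<^sub>F m in sequentially. norm (?ch m - of_real (?g m)) \<le> ?err m"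
      using eventually_ge_at_top[of 1]
    proof eventually_elim
      case (elim m)
      show ?case
        using k[OF elim] by (intro char_eig_minus_gaussian_le[OF b distr p int mean var]) auto
    qed
    have "(\<lambda>m. 1 / sqrt (real (2 * m + 2))) \<longlonglongrightarrow> 0" "(\<lambda>m. 1 / real (2 * m + 2)) \<longlonglongrightarrow> 0"
      by real_asymp+
    then have "(\<lambda>m. 8 * \<bar>t\<bar> ^ 3 * ?c * (1 / sqrt (real (2 * m + 2))) + 16 * t ^ 4 * (1 / real (2 * m + 2)))
        \<longlonglongrightarrow> 8 * \<bar>t\<bar> ^ 3 * ?c * 0 + 16 * t ^ 4 * 0"
      by (intro tendsto_add tendsto_mult tendsto_const)
    then show "?err \<longlonglongrightarrow> 0"
      by simp
  qed
  moreover have "(\<lambda>m. complex_of_real (?g m)) \<longlonglongrightarrow> of_real (exp (- (t\<^sup>2 / 2)))"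
  proof (rule tendsto_of_real)
    have "(\<lambda>m. 2 * real m / real (2 * m + 2)) \<longlonglongrightarrow> 1"
      by real_asymp
    then have "?g \<longlonglongrightarrow> exp (- (t\<^sup>2 / 2 * 1))"
      by (intro tendsto_intros)
    then show "?g \<longlonglongrightarrow> exp (- (t\<^sup>2 / 2))" by simp
  qed
  ultimately have "(\<lambda>m. (?ch m - of_real (?g m)) + of_real (?g m)) \<longlonglongrightarrow> 0 + of_real (exp (- (t\<^sup>2 / 2)))"
    by (rule tendsto_add)
  then show "?ch \<longlonglongrightarrow> char std_normal_distribution t"
    by (simp add: char_std_normal_distribution)
qed

text \<open>Weak convergence is applied along the indices \<open>k m\<close> where the deviation
  from the Gaussian integral is largest, which bounds the deviations for all nonzero indices at
  once. Index 0 is bounded trivially by \<open>2 * B\<close> and disappears after division by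
  \<open>2 * m + 1\<close>.\<close>

lemma (in prob_space) expectation_eig_mean_tendsto:
  fixes b :: "nat \<Rightarrow> 'a \<Rightarrow> real"
  assumes b: "indep_vars (\<lambda>_. borel) b UNIV" and distr: "\<And>i. distr M borel (b i) = p"
    and p: "real_distribution p"
    and int: "integrable p (\<lambda>x. x)" "integrable p (\<lambda>x. x\<^sup>2)" "integrable p (\<lambda>x. \<bar>x\<bar> ^ 3)"
    and mean: "prob_space.expectation p (\<lambda>x. x) = 0" and var: "prob_space.variance p (\<lambda>x. x) = 1"
    and \<phi>: "\<And>y. isCont \<phi> y" and B: "\<And>y. \<bar>\<phi> y\<bar> \<le> B"
  shows "(\<lambda>m. expectation (\<lambda>\<omega>. eig_mean m \<phi> (\<lambda>i. b i \<omega>))) \<longlonglongrightarrow> integral\<^sup>L std_normal_distribution \<phi>"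
proof -
  have rv [measurable]: "random_variable borel (b i)" for i
    using b by (simp add: indep_vars_def)
  have [measurable]: "\<phi> \<in> borel_measurable borel"
    using \<phi> by (intro borel_measurable_continuous_onI) (simp add: continuous_on_eq_continuous_at)
  interpret N: real_distribution std_normal_distribution
    by (rule real_dist_normal_dist)
  define I where "I = integral\<^sup>L std_normal_distribution \<phi>"
  define Y where "Y m k \<omega> = circ_eig (2 * m + 1) (\<lambda>i. b i \<omega>) k / sqrt (real (2 * m + 2))" for m k \<omega>
  have Y [measurable]: "random_variable borel (Y m k)" for m k
    unfolding Y_def circ_eig_half by measurable
  define g where "g m k = \<bar>expectation (\<lambda>\<omega>. \<phi> (Y m k \<omega>)) - I\<bar>" for m k
  have I: "\<bar>I\<bar> \<le> B"
    unfolding I_def by (rule N.expectation_bounded) (rule B)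
  have gB: "g m k \<le> 2 * B" for m k
    using I expectation_bounded[of "\<lambda>\<omega>. \<phi> (Y m k \<omega>)" B] B unfolding g_def by fastforce
  \<comment> \<open>For \<open>m = 0\<close> there is no nonzero index, so the choice is constrained
    only from \<open>m = 1\<close> on.\<close>
  have "\<exists>k. m \<ge> 1 \<longrightarrow> k \<in> {1..2*m} \<and> (\<forall>l\<in>{1..2*m}. g m l \<le> g m k)" for m
  proof (cases "m \<ge> 1")
    case True
    then have "Max (g m ` {1..2*m}) \<in> g m ` {1..2*m}"
      by (intro Max_in) auto
    then obtain k where "k \<in> {1..2*m}" "g m k = Max (g m ` {1..2*m})"
      by force
    then show ?thesis
      by (intro exI[of _ k]) auto
  qed auto
  then obtain k where k: "\<And>m. m \<ge> 1 \<Longrightarrow> k m \<in> {1..2*m} \<and> (\<forall>l\<in>{1..2*m}. g m l \<le> g m (k m))"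
    by metis
  have "weak_conv_m (\<lambda>m. distr M borel (Y m (k m))) std_normal_distribution"
    unfolding Y_def by (rule weak_conv_eig[OF b distr p int mean var]) (use k in auto)
  then have "(\<lambda>m. integral\<^sup>L (distr M borel (Y m (k m))) \<phi>) \<longlonglongrightarrow> I"
    unfolding I_def
    by (rule weak_conv_imp_integral_bdd_continuous_conv[OF real_distribution_distr[OF Y] N.real_distribution_axioms _ \<phi>])
      (use B in simp)
  then have "(\<lambda>m. expectation (\<lambda>\<omega>. \<phi> (Y m (k m) \<omega>)) - I) \<longlonglongrightarrow> 0"
    by (subst (asm) integral_distr) (auto intro: LIM_zero)
  then have "(\<lambda>m. g m (k m)) \<longlonglongrightarrow> 0"
    unfolding g_def by (rule tendsto_rabs_zero)
  moreover have "(\<lambda>m. 2 * B / (2 * real m + 1)) \<longlonglongrightarrow> 0"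
  proof -
    have "(\<lambda>m. 1 / (2 * real m + 1)) \<longlonglongrightarrow> 0"
      by real_asymp
    then show ?thesis
      using tendsto_mult_left[of "\<lambda>m. 1 / (2 * real m + 1)" 0 sequentially "2 * B"] by simp
  qed
  ultimately have lim: "(\<lambda>m. 2 * B / (2 * real m + 1) + g m (k m)) \<longlonglongrightarrow> 0"
    using tendsto_add by fastforce
  have "(\<lambda>m. expectation (\<lambda>\<omega>. eig_mean m \<phi> (\<lambda>i. b i \<omega>)) - I) \<longlonglongrightarrow> 0"
  proof (rule Lim_null_comparison[OF _ lim])
    show "\<forall>\<^sub>F m in sequentially. norm (expectation (\<lambda>\<omega>. eig_mean m \<phi> (\<lambda>i. b i \<omega>)) - I) \<le> 2 * B / (2 * real m + 1) + g m (k m)"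
      using eventually_ge_at_top[of 1]
    proof eventually_elim
      case (elim m)
      have "expectation (\<lambda>\<omega>. eig_mean m \<phi> (\<lambda>i. b i \<omega>)) = (\<Sum>k<2*m+1. expectation (\<lambda>\<omega>. \<phi> (Y m k \<omega>))) / (2 * real m + 1)"
      proof -
        have "integrable M (\<lambda>\<omega>. \<phi> (Y m k \<omega>))" for k
          by (rule integrable_bounded[OF _ B]) measurable
        then show ?thesis
          by (simp add: eig_mean_def Y_def)
      qed
      then have "expectation (\<lambda>\<omega>. eig_mean m \<phi> (\<lambda>i. b i \<omega>)) - I = (\<Sum>k<2*m+1. expectation (\<lambda>\<omega>. \<phi> (Y m k \<omega>)) - I) / (2 * real m + 1)"
        by (simp add: sum_subtractf field_simps)
      then have "norm (expectation (\<lambda>\<omega>. eig_mean m \<phi> (\<lambda>i. b i \<omega>)) - I) = \<bar>\<Sum>k<2*m+1. expectation (\<lambda>\<omega>. \<phi> (Y m k \<omega>)) - I\<bar> / (2 * real m + 1)"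
        by simp
      also have "\<dots> \<le> (\<Sum>k<2*m+1. g m k) / (2 * real m + 1)"
        unfolding g_def by (intro divide_right_mono sum_abs) simp
      also have "(\<Sum>k<2*m+1. g m k) = g m 0 + (\<Sum>k\<in>{1..2*m}. g m k)"
      proof -
        have "{..<2*m+1} = insert 0 {1..2*m}" by auto
        then show ?thesis by simp
      qed
      also have "\<dots> / (2 * real m + 1) \<le> (2 * B + (\<Sum>l\<in>{1..2*m}. g m (k m))) / (2 * real m + 1)"
        using k[OF elim] gB by (intro divide_right_mono add_mono sum_mono) auto
      also have "\<dots> \<le> (2 * B + (2 * real m + 1) * g m (k m)) / (2 * real m + 1)"
        by (intro divide_right_mono add_mono) (auto simp: g_def intro!: mult_right_mono)
      also have "\<dots> = 2 * B / (2 * real m + 1) + g m (k m)"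
        by (simp add: add_divide_distrib)
      finally show ?case .
    qed
  qed
  then show ?thesis
    unfolding I_def by (rule LIM_zero_cancel)
qed

subsection \<open>From smooth test functions to the spectral distribution\<close>

text \<open>A quadratic spline with derivative \<open>2 * max 0 y\<close>: this derivative is
  Lipschitz, which is just the smoothness that the quadratic Taylor bound asks for.\<close>

definition pos_sq :: "real \<Rightarrow> real" where
  "pos_sq y = (max 0 y)\<^sup>2"

lemma pos_sq_taylor: "\<bar>pos_sq (y + d) - pos_sq y - d * (2 * max 0 y)\<bar> \<le> d\<^sup>2"
proof -
  consider "y \<ge> 0" "y + d \<ge> 0" | "y \<ge> 0" "y + d < 0" | "y < 0" "y + d \<ge> 0" | "y < 0" "y + d < 0"
    by linarith
  then show ?thesis
  proof cases
    case 1
    then show ?thesis by (simp add: pos_sq_def power2_eq_square algebra_simps)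
  next
    case 2
    then have "0 \<le> y * (- y - 2 * d)"
      by (intro mult_nonneg_nonneg) linarith+
    with 2 show ?thesis
      using zero_le_power2[of "y + d"] by (simp add: pos_sq_def power2_eq_square algebra_simps)
  next
    case 3
    then have "\<bar>y + d\<bar> \<le> \<bar>d\<bar>" by simp
    then have "(y + d)\<^sup>2 \<le> d\<^sup>2" by (simp add: abs_le_square_iff)
    with 3 show ?thesis by (simp add: pos_sq_def)
  next
    case 4
    then show ?thesis by (simp add: pos_sq_def)
  qed
qed

text \<open>Concentration is available only for test functions with a Lipschitz derivative, so indicator
  functions are sandwiched between translates and dilations of this one.\<close>

definition unit_step :: "real \<Rightarrow> real" where
  "unit_step y = 1 - 2 * pos_sq y + 4 * pos_sq (y - 1/2) - 2 * pos_sq (y - 1)"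

text \<open>The derivative of \<open>unit_step\<close>: an inverted tent on the unit interval with
  lowest value -2 at 1/2.\<close>

definition unit_step' :: "real \<Rightarrow> real" where
  "unit_step' y = - 4 * max 0 y + 8 * max 0 (y - 1/2) - 4 * max 0 (y - 1)"

lemma unit_step_taylor: "\<bar>unit_step (y + d) - unit_step y - d * unit_step' y\<bar> \<le> 8 * d\<^sup>2"
proof -
  let ?r = "\<lambda>y. pos_sq (y + d) - pos_sq y - d * (2 * max 0 y)"
  have eq: "unit_step (y + d) - unit_step y - d * unit_step' y = - 2 * ?r y + 4 * ?r (y - 1/2) - 2 * ?r (y - 1)"
    by (simp add: unit_step_def unit_step'_def algebra_simps)
  have le: "\<bar>- 2 * r1 + 4 * r2 - 2 * r3\<bar> \<le> 8 * D" if "\<bar>r1\<bar> \<le> D" "\<bar>r2\<bar> \<le> D" "\<bar>r3\<bar> \<le> D" for r1 r2 r3 D :: real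
    using that by linarith
  show ?thesis
    unfolding eq by (rule le[OF pos_sq_taylor pos_sq_taylor pos_sq_taylor])
qed

lemma abs_unit_step'_le: "\<bar>unit_step' y\<bar> \<le> 2"
  by (auto simp: unit_step'_def max_def)

lemma unit_step_cases:
  "unit_step y = (if y \<le> 0 then 1 else if y \<le> 1/2 then 1 - 2 * y\<^sup>2 else if y \<le> 1 then 2 * (1 - y)\<^sup>2 else 0)"
  by (simp add: unit_step_def pos_sq_def max_def power2_eq_square algebra_simps)

lemma unit_step_eq_0: "1 \<le> y \<Longrightarrow> unit_step y = 0"
  by (auto simp: unit_step_cases)

lemma unit_step_bounds: "0 \<le> unit_step y" "unit_step y \<le> 1"
proof -
  have "y\<^sup>2 \<le> (1/2)\<^sup>2" if "0 < y" "y \<le> 1/2"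
    using that by (intro power_mono) auto
  moreover have "(1 - y)\<^sup>2 \<le> (1/2)\<^sup>2" if "1/2 < y" "y \<le> 1"
    using that by (intro power_mono) auto
  ultimately show "0 \<le> unit_step y" "unit_step y \<le> 1"
    by (auto simp: unit_step_cases power2_eq_square)
qed

definition step_fun :: "real \<Rightarrow> real \<Rightarrow> real \<Rightarrow> real" where
  "step_fun u v y = unit_step ((y - u) / (v - u))"

lemma step_fun_bounds: "0 \<le> step_fun u v y" "step_fun u v y \<le> 1"
  by (simp_all add: step_fun_def unit_step_bounds)

lemma step_fun_eq_1: "u < v \<Longrightarrow> y \<le> u \<Longrightarrow> step_fun u v y = 1"
  by (simp add: step_fun_def unit_step_cases divide_nonpos_pos)

lemma step_fun_eq_0: "u < v \<Longrightarrow> v \<le> y \<Longrightarrow> step_fun u v y = 0"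
proof -
  assume "u < v" "v \<le> y"
  then have "1 \<le> (y - u) / (v - u)"
    by (simp add: le_divide_eq)
  then show ?thesis
    by (simp add: step_fun_def unit_step_eq_0)
qed

lemma isCont_step_fun: "u < v \<Longrightarrow> isCont (step_fun u v) y"
  unfolding step_fun_def unit_step_def pos_sq_def by (intro continuous_intros) auto

lemma step_fun_taylor:
  assumes "u < v"
  shows "\<bar>step_fun u v (y + d) - step_fun u v y - d * (unit_step' ((y - u) / (v - u)) / (v - u))\<bar> \<le> 8 / (v - u)\<^sup>2 * d\<^sup>2"
proof -
  have "(y + d - u) / (v - u) = (y - u) / (v - u) + d / (v - u)"
    by (simp add: add_divide_distrib[symmetric])
  then show ?thesis
    using unit_step_taylor[of "(y - u) / (v - u)" "d / (v - u)"]
    by (simp add: step_fun_def power_divide)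
qed

section \<open>Eigenvalue counts and the sandwich by step functions\<close>

lemma proots_prod_linear: "proots (\<Prod>r\<in>#R. [:- r, 1:]) = R" for R :: "real multiset"
proof (induction R)
  case (add x R)
  have "(\<Prod>r\<in>#R. [:- r, 1:]) \<noteq> 0"
    by (auto simp: prod_mset_zero_iff)
  then have "proots ([:- x, 1:] * (\<Prod>r\<in>#R. [:- r, 1:])) = proots [:- x, 1:] + proots (\<Prod>r\<in>#R. [:- r, 1:])"
    by (intro proots_mult) auto
  then show ?case
    by (simp add: add.IH del: mult_pCons_left)
qed simp

text \<open>Interlacing supplies a complete splitting into real linear factors, and
  \<open>proots\<close> of such a product returns the same multiset. So
  \<open>real_eigenvalues\<close> misses nothing and inherits the interlacing counts.\<close>

lemma palindromic_toeplitz_eigenvalues: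
  fixes b :: "nat \<Rightarrow> real"
  assumes n: "n > 0"
  defines "R \<equiv> real_eigenvalues (palindromic_toeplitz (n + 1) b)"
  shows "size R = n + 1"
    "arrow_poly {..<n} (b 0) (circ_eig n b) (\<lambda>k. (circ_eig n b k)\<^sup>2 / n) = (\<Prod>r\<in>#R. [:- r, 1:])"
    "card {k. k < n \<and> circ_eig n b k \<le> y} \<le> count_le R y"
    "count_le R y \<le> Suc (card {k. k < n \<and> circ_eig n b k \<le> y})"
proof -
  obtain R' where R': "size R' = Suc (card {..<n})"
    "arrow_poly {..<n} (b 0) (circ_eig n b) (\<lambda>k. (circ_eig n b k)\<^sup>2 / n) = (\<Prod>r\<in>#R'. [:- r, 1:])"
    "\<And>y. card {k \<in> {..<n}. circ_eig n b k \<le> y} \<le> count_le R' y \<and> count_le R' y \<le> Suc (card {k \<in> {..<n}. circ_eig n b k \<le> y})"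
    using arrow_poly_interlacing[of "{..<n}" "\<lambda>k. (circ_eig n b k)\<^sup>2 / n" "b 0" "circ_eig n b"] by auto
  have "R = R'"
    unfolding R_def real_eigenvalues_def char_poly_palindromic_toeplitz[OF n] R'(2) by (rule proots_prod_linear)
  then show "size R = n + 1"
    "arrow_poly {..<n} (b 0) (circ_eig n b) (\<lambda>k. (circ_eig n b k)\<^sup>2 / n) = (\<Prod>r\<in>#R. [:- r, 1:])"
    "card {k. k < n \<and> circ_eig n b k \<le> y} \<le> count_le R y"
    "count_le R y \<le> Suc (card {k. k < n \<and> circ_eig n b k \<le> y})"
    using R' by simp_all
qed

lemma normalized_esd_eq_count_le:
  assumes "N > 0"
  shows "normalized_esd (palindromic_toeplitz N b) x =
    real (count_le (real_eigenvalues (palindromic_toeplitz N b)) (x * sqrt N)) / N"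
  using assms by (simp add: normalized_esd_def count_le_def palindromic_toeplitz_def divide_le_eq)

text \<open>The mean is taken over \<open>N - 1\<close> circulant eigenvalues, the spectral
  distribution over \<open>N\<close>. Interlacing allows one extra eigenvalue, hence
  \<open>1 / N\<close> in the upper bound; in the lower bound the factor
  \<open>(2 * m + 1) / N\<close> changes the normalisation.\<close>

lemma normalized_esd_step_bounds:
  fixes b :: "nat \<Rightarrow> real" and m :: nat
  assumes uv: "u < v"
  defines "N \<equiv> 2 * m + 2"
  defines "F \<equiv> normalized_esd (palindromic_toeplitz N b)"
  shows "x \<le> u \<Longrightarrow> F x \<le> eig_mean m (step_fun u v) b + 1 / N"
    and "v \<le> x \<Longrightarrow> eig_mean m (step_fun u v) b * ((2 * m + 1) / N) \<le> F x"
proof -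
  define n where "n = 2 * m + 1"
  define y where "y k = circ_eig n b k / sqrt N" for k
  have n: "n > 0" "N > 0" "N = n + 1" by (simp_all add: n_def N_def)
  have set: "{k. k < n \<and> circ_eig n b k \<le> x * sqrt N} = {k. k < n \<and> y k \<le> x}"
    using n by (auto simp: y_def divide_le_eq)
  note ev = palindromic_toeplitz_eigenvalues(3,4)[OF n(1), of b "x * sqrt N", folded n(3), unfolded set]
  have F: "card {k. k < n \<and> y k \<le> x} / N \<le> F x" "F x \<le> (card {k. k < n \<and> y k \<le> x} + 1) / N"
    unfolding F_def normalized_esd_eq_count_le[OF n(2)] using ev by (auto intro!: divide_right_mono)
  have em: "eig_mean m (step_fun u v) b = (\<Sum>k<n. step_fun u v (y k)) / n"
    by (simp add: eig_mean_def n_def N_def y_def)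
  have card: "real (card {k. k < n \<and> y k \<le> x}) = (\<Sum>k<n. if y k \<le> x then 1 else 0)"
    by (simp add: sum.If_cases Int_def)
  {
    assume "x \<le> u"
    then have "(\<Sum>k<n. if y k \<le> x then 1 else 0) \<le> (\<Sum>k<n. step_fun u v (y k))"
      using step_fun_bounds(1) uv by (intro sum_mono) (auto simp: step_fun_eq_1)
    then have "F x \<le> ((\<Sum>k<n. step_fun u v (y k)) + 1) / N"
      using F(2) card by (auto elim!: order_trans intro!: divide_right_mono)
    also have "\<dots> \<le> (\<Sum>k<n. step_fun u v (y k)) / n + 1 / N"
      using n by (auto simp: add_divide_distrib intro!: divide_left_mono sum_nonneg step_fun_bounds)
    finally show "F x \<le> eig_mean m (step_fun u v) b + 1 / N"
      by (simp add: em)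
  }
  {
    assume "v \<le> x"
    then have "(\<Sum>k<n. step_fun u v (y k)) \<le> (\<Sum>k<n. if y k \<le> x then 1 else 0)"
      using step_fun_bounds uv by (intro sum_mono) (auto simp: step_fun_eq_0)
    then have "(\<Sum>k<n. step_fun u v (y k)) / N \<le> F x"
      using F(1) card by (auto elim!: order_trans[rotated] intro!: divide_right_mono)
    then show "eig_mean m (step_fun u v) b * ((2 * m + 1) / N) \<le> F x"
      using n by (simp add: em n_def add_ac)
  }
qed

lemma std_normal_distribution_finite_borel: "finite_borel_measure std_normal_distribution"
proof -
  interpret real_distribution std_normal_distribution
    by (rule real_dist_normal_dist)
  show ?thesis by unfold_locales
qed

lemma isCont_std_normal_cdf: "isCont std_normal_cdf x"
proof -
  interpret finite_borel_measure std_normal_distribution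
    by (rule std_normal_distribution_finite_borel)
  have "emeasure std_normal_distribution {x} = 0"
    by (subst emeasure_density) (auto intro!: nn_integral_null_set)
  then show ?thesis
    unfolding std_normal_cdf_def isCont_cdf by (simp add: measure_def)
qed

lemma integral_step_fun_bounds:
  assumes uv: "u < v"
  shows "std_normal_cdf u \<le> integral\<^sup>L std_normal_distribution (step_fun u v)"
    "integral\<^sup>L std_normal_distribution (step_fun u v) \<le> std_normal_cdf v"
proof -
  interpret real_distribution std_normal_distribution
    by (rule real_dist_normal_dist)
  have [measurable]: "step_fun u v \<in> borel_measurable borel"
    using isCont_step_fun[OF uv] by (intro borel_measurable_continuous_onI) (simp add: continuous_on_eq_continuous_at)
  have int: "integrable std_normal_distribution (step_fun u v)"
    by (rule integrable_bounded[where C = 1]) (use step_fun_bounds in \<open>auto simp: abs_le_iff intro: order_trans[of _ 0]\<close>)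
  have cdf: "std_normal_cdf y = (\<integral>x. indicator {..y} x \<partial>std_normal_distribution)" for y
    by (simp add: std_normal_cdf_def cdf_def)
  have ind: "integrable std_normal_distribution (indicator {..y} :: real \<Rightarrow> real)" for y
    by (rule integrable_bounded[where C = 1]) (auto simp: indicator_def)
  show "std_normal_cdf u \<le> integral\<^sup>L std_normal_distribution (step_fun u v)"
    unfolding cdf by (intro integral_mono ind int) (auto simp: indicator_def step_fun_bounds step_fun_eq_1[OF uv])
  show "integral\<^sup>L std_normal_distribution (step_fun u v) \<le> std_normal_cdf v"
    unfolding cdf by (intro integral_mono ind int) (auto simp: indicator_def step_fun_bounds step_fun_eq_0[OF uv])
qed

subsection \<open>Measurability of the spectral distribution\<close>

text \<open>The number of eigenvalues in \<open>{..z}\<close> is known up to \<open>1\<close> by interlacing; if \<open>z\<close> is no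
  eigenvalue, the sign of the characteristic polynomial at \<open>z\<close> decides its parity.\<close>

lemma count_le_by_parity:
  assumes Q: "Q = (\<Prod>r\<in>#R. [:- r, 1:])" and size: "size R = Suc n" and z: "poly Q z \<noteq> 0"
    and l: "card {k. k < n \<and> e k \<le> z} \<le> count_le R z" "count_le R z \<le> Suc (card {k. k < n \<and> e k \<le> z})"
  shows "real (count_le R z) = (\<Sum>k<n. if e k \<le> z then 1 else 0) +
           (if (\<Prod>k<n. if e k \<le> z then 1 else - 1) * poly Q z > (0::real) then 1 else 0)"
proof -
  define a where "a = card {k. k < n \<and> e k \<le> z}"
  have card: "(\<Sum>k<n. if e k \<le> z then 1 else 0) = real a"
    by (simp add: a_def sum.If_cases Int_def)
  have an: "a \<le> n"
    unfolding a_def using card_mono[of "{..<n}" "{k. k < n \<and> e k \<le> z}"] by auto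
  have "{..<n} \<inter> - {k. e k \<le> z} = {..<n} - {k. k < n \<and> e k \<le> z}"
    by auto
  then have "card ({..<n} \<inter> - {k. e k \<le> z}) = card ({..<n} - {k. k < n \<and> e k \<le> z})"
    by (simp only:)
  also have "\<dots> = card {..<n} - a"
    unfolding a_def by (rule card_Diff_subset) auto
  finally have "card ({..<n} \<inter> - {k. e k \<le> z}) = n - a"
    by simp
  then have prod: "(\<Prod>k<n. if e k \<le> z then 1 else - 1) = (- 1 :: real) ^ (n - a)"
    by (simp add: prod.If_cases)
  \<comment> \<open>Each root above \<open>z\<close> contributes a negative factor, and there are
    \<open>size R - count_le R z\<close> of them.\<close>
  have "(- 1) ^ (size R - count_le R z) * poly (\<Prod>r\<in>#R. [:- r, 1:]) z > 0 \<and> count_le R z \<le> size R"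
    using z unfolding Q
  proof (induction R)
    case (add r R)
    then have IH: "(- 1) ^ (size R - count_le R z) * poly (\<Prod>r\<in>#R. [:- r, 1:]) z > 0" "count_le R z \<le> size R" and "z \<noteq> r"
      by (auto simp: count_le_def)
    show ?case
    proof (cases "r \<le> z")
      case True
      with \<open>z \<noteq> r\<close> have "z - r > 0" by simp
      with IH have "(z - r) * ((- 1) ^ (size R - count_le R z) * poly (\<Prod>r\<in>#R. [:- r, 1:]) z) > 0"
        by (rule_tac mult_pos_pos)
      with True IH show ?thesis
        by (simp add: count_le_def algebra_simps)
    next
      case False
      then have "r - z > 0" by simp
      with IH have "(r - z) * ((- 1) ^ (size R - count_le R z) * poly (\<Prod>r\<in>#R. [:- r, 1:]) z) > 0"
        by (rule_tac mult_pos_pos)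
      with False IH show ?thesis
        by (simp add: count_le_def Suc_diff_le le_SucI algebra_simps)
    qed
  qed (simp add: count_le_def)
  then have pos: "(- 1) ^ (Suc n - count_le R z) * poly Q z > 0"
    by (simp add: Q size)
  \<comment> \<open>The product in the claim is (-1)^(n - a). The sign of \<open>Q\<close> at
    \<open>z\<close> agrees with it if the count is \<open>Suc a\<close> and is opposite if the
    count is \<open>a\<close>.\<close>
  consider "count_le R z = a" | "count_le R z = Suc a"
    using l unfolding a_def by linarith
  then show ?thesis
  proof cases
    case 1
    then have "\<not> (- 1) ^ (n - a) * poly Q z > 0"
      using pos an by (simp add: Suc_diff_le)
    with 1 show ?thesis
      by (simp add: card prod)
  next
    case 2
    then have "(- 1) ^ (n - a) * poly Q z > 0"
      using pos by simp
    with 2 show ?thesis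
      by (simp add: card prod)
  qed
qed

lemma poly_arrow_poly:
  "poly (arrow_poly K a v c) z = (z - a) * (\<Prod>k\<in>K. z - v k) - (\<Sum>k\<in>K. c k * (\<Prod>l\<in>K-{k}. z - v l))"
  by (simp add: arrow_poly_def poly_prod poly_sum left_diff_distrib)

lemma circ_eig_measurable:
  assumes [measurable]: "\<And>i. (\<lambda>\<omega>. b i \<omega>) \<in> borel_measurable M"
  shows "(\<lambda>\<omega>. circ_eig n (\<lambda>i. b i \<omega>) k) \<in> borel_measurable M"
  unfolding circ_eig_def circ_entry_def by measurable

text \<open>The parity formula is measurable in the \<open>b i\<close> but valid only off the
  spectrum. Since the spectrum is finite, the points \<open>y + 1 / real (Suc i)\<close> eventually
  avoid it and have no eigenvalue between them and \<open>y\<close>, so the count at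
  \<open>y\<close> is a pointwise limit.\<close>

lemma count_le_eigenvalues_measurable:
  assumes b [measurable]: "\<And>i. (\<lambda>\<omega>. b i \<omega>) \<in> borel_measurable M" and n: "n > 0"
  shows "(\<lambda>\<omega>. real (count_le (real_eigenvalues (palindromic_toeplitz (n + 1) (\<lambda>i. b i \<omega>))) y)) \<in> borel_measurable M"
proof (rule borel_measurable_LIMSEQ_real)
  let ?e = "\<lambda>\<omega>. circ_eig n (\<lambda>i. b i \<omega>)"
  let ?R = "\<lambda>\<omega>. real_eigenvalues (palindromic_toeplitz (n + 1) (\<lambda>i. b i \<omega>))"
  let ?Q = "\<lambda>\<omega>. arrow_poly {..<n} (b 0 \<omega>) (?e \<omega>) (\<lambda>k. (?e \<omega> k)\<^sup>2 / n)"
  let ?g = "\<lambda>z \<omega>. (\<Sum>k<n. if ?e \<omega> k \<le> z then 1 else 0) +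
           (if (\<Prod>k<n. if ?e \<omega> k \<le> z then 1 else - 1) * poly (?Q \<omega>) z > (0::real) then 1 else (0::real))"
  note [measurable] = circ_eig_measurable[OF b]
  have Qm [measurable]: "(\<lambda>\<omega>. poly (?Q \<omega>) z) \<in> borel_measurable M" for z
    unfolding poly_arrow_poly by measurable
  show "?g (y + 1 / real (Suc i)) \<in> borel_measurable M" for i
    by measurable
  fix \<omega> assume "\<omega> \<in> space M"
  note ev = palindromic_toeplitz_eigenvalues[OF n, of "\<lambda>i. b i \<omega>"]
  have "finite {r \<in> set_mset (?R \<omega>). r > y}" by simp
  then obtain d where d: "d > 0" "\<And>r. r \<in># ?R \<omega> \<Longrightarrow> r > y \<Longrightarrow> y + d < r"
  proof -
    have "\<exists>d>0. \<forall>r\<in>{r \<in> set_mset (?R \<omega>). r > y}. d \<le> dist y r"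
      by (rule finite_set_avoid[of "{r \<in> set_mset (?R \<omega>). r > y}" y, THEN exE]) auto
    then obtain d where "d > 0" "\<forall>r\<in>{r \<in> set_mset (?R \<omega>). r > y}. d \<le> dist y r" by blast
    then show ?thesis
      by (intro that[of "d / 2"]) (fastforce simp: dist_real_def)+
  qed
  have "\<forall>\<^sub>F i in sequentially. 1 / real (Suc i) < d"
    using LIMSEQ_inverse_real_of_nat d(1) unfolding inverse_eq_divide by (rule order_tendstoD(2))
  then have "\<forall>\<^sub>F i in sequentially. ?g (y + 1 / real (Suc i)) \<omega> = real (count_le (?R \<omega>) y)"
  proof eventually_elim
    case (elim i)
    define z where "z = y + 1 / real (Suc i)"
    have z: "y < z" "z < y + d"
      using elim by (simp_all add: z_def)
    have r: "r \<le> z \<longleftrightarrow> r \<le> y" "z \<noteq> r" if "r \<in># ?R \<omega>" for r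
      using d(2)[OF that] z by (force, cases "r > y") auto
    have "poly (?Q \<omega>) z \<noteq> 0"
      unfolding ev(2) using r by (auto simp: poly_prod_mset prod_mset_zero_iff)
    then have "real (count_le (?R \<omega>) z) = ?g z \<omega>"
      using ev(1) by (intro count_le_by_parity ev(2-4)) auto
    moreover have "count_le (?R \<omega>) z = count_le (?R \<omega>) y"
      unfolding count_le_def using r by (intro arg_cong[where f = size] filter_mset_cong) auto
    ultimately show ?case
      by (simp add: z_def)
  qed
  then show "(\<lambda>i. ?g (y + 1 / real (Suc i)) \<omega>) \<longlonglongrightarrow> real (count_le (?R \<omega>) y)"
    by (rule tendsto_eventually)
qed

lemma normalized_esd_measurable:
  assumes b: "\<And>i. (\<lambda>\<omega>. b i \<omega>) \<in> borel_measurable M"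
  shows "(\<lambda>\<omega>. normalized_esd (palindromic_toeplitz (2 * n) (\<lambda>i. b i \<omega>)) x) \<in> borel_measurable M"
proof (cases n)
  \<comment> \<open>The empty matrix: division by 0 yields the constant 0.\<close>
  case 0
  then show ?thesis
    by (simp add: normalized_esd_def palindromic_toeplitz_def)
next
  case (Suc m)
  then have "2 * n = (2 * m + 1) + 1" by simp
  then show ?thesis
    using count_le_eigenvalues_measurable[OF b, of "2 * m + 1"]
    by (simp add: normalized_esd_eq_count_le del: One_nat_def)
qed

subsection \<open>Modes of convergence\<close>

lemma (in prob_space) AE_tendsto_imp_converges_in_probability:
  assumes X [measurable]: "\<And>n. random_variable borel (X n)" and lim: "AE \<omega> in M. (\<lambda>n. X n \<omega>) \<longlonglongrightarrow> c"
  shows "converges_in_probability M X c"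
  unfolding converges_in_probability_def
proof (intro conjI allI impI X)
  fix \<epsilon> :: real assume \<epsilon>: "\<epsilon> > 0"
  let ?A = "\<lambda>n. {\<omega> \<in> space M. \<bar>X n \<omega> - c\<bar> > \<epsilon>}"
  have "(\<lambda>n. expectation (indicator (?A n) :: 'a \<Rightarrow> real)) \<longlonglongrightarrow> expectation (\<lambda>_. 0 :: real)"
  proof (rule integral_dominated_convergence[where w = "\<lambda>_. 1"])
    show "AE \<omega> in M. (\<lambda>n. indicator (?A n) \<omega> :: real) \<longlonglongrightarrow> 0"
      using lim
    proof eventually_elim
      case (elim \<omega>)
      then have "\<forall>\<^sub>F n in sequentially. dist (X n \<omega>) c < \<epsilon>"
        using \<epsilon> by (rule tendstoD)
      then have "\<forall>\<^sub>F n in sequentially. indicator (?A n) \<omega> = (0 :: real)"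
        by eventually_elim (auto simp: dist_real_def)
      then show ?case by (rule tendsto_eventually)
    qed
  qed (auto simp: indicator_def)
  then show "(\<lambda>n. measure M (?A n)) \<longlonglongrightarrow> 0"
    by simp
qed

lemma (in prob_space) AE_tendsto_imp_converges_in_distribution:
  assumes X [measurable]: "\<And>n. random_variable borel (X n)" and lim: "AE \<omega> in M. (\<lambda>n. X n \<omega>) \<longlonglongrightarrow> c"
  shows "converges_in_distribution M X c"
  unfolding converges_in_distribution_def
proof (intro conjI allI X)
  have ret: "real_distribution (return borel c)"
    by (simp add: real_distribution_def real_distribution_axioms_def prob_space_return)
  show "weak_conv_m (\<lambda>n. distr M borel (X n)) (return borel c)"
  proof (rule integral_bdd_continuous_conv_imp_weak_conv[OF real_distribution_distr[OF X] ret])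
    fix f :: "real \<Rightarrow> real" assume f: "\<And>x. isCont f x" "\<And>x. \<bar>f x\<bar> \<le> 1"
    have [measurable]: "f \<in> borel_measurable borel"
      using f by (intro borel_measurable_continuous_onI) (simp add: continuous_on_eq_continuous_at)
    have "(\<lambda>n. expectation (\<lambda>\<omega>. f (X n \<omega>))) \<longlonglongrightarrow> expectation (\<lambda>_. f c)"
    proof (rule integral_dominated_convergence[where w = "\<lambda>_. 1"])
      show "AE \<omega> in M. (\<lambda>n. f (X n \<omega>)) \<longlonglongrightarrow> f c"
        using lim by eventually_elim (rule isCont_tendsto_compose[OF f(1)])
    qed (use f in auto)
    then show "(\<lambda>n. integral\<^sup>L (distr M borel (X n)) f) \<longlonglongrightarrow> integral\<^sup>L (return borel c) f"
      by (simp add: integral_distr integral_return prob_space)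
  qed
qed

theorem theorem1p5:
  fixes p :: "real measure" and M :: "'a measure" and b :: "nat \<Rightarrow> 'a \<Rightarrow> real"
    and F :: "nat \<Rightarrow> 'a \<Rightarrow> real \<Rightarrow> real"
  assumes "real_distribution p"
    and "\<And>k::nat. integrable p (\<lambda>x. x ^ k)"
    and "prob_space.expectation p (\<lambda>x. x) = 0"
    and "prob_space.variance p (\<lambda>x. x) = 1"
    and "prob_space M"
    and "prob_space.indep_vars M (\<lambda>_. borel) b UNIV"
    and "\<And>i. distr M borel (b i) = p"
  defines "F \<equiv> \<lambda>N \<omega>. normalized_esd (palindromic_toeplitz N (\<lambda>i. b i \<omega>))"
  shows "(\<forall>x. converges_in_distribution M (\<lambda>n \<omega>. F (2 * n) \<omega> x) (std_normal_cdf x))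
       \<and> (\<forall>x. converges_in_probability M (\<lambda>n \<omega>. F (2 * n) \<omega> x) (std_normal_cdf x))
       \<and> (AE \<omega> in M. \<forall>x. (\<lambda>n. F (2 * n) \<omega> x) \<longlonglongrightarrow> std_normal_cdf x)"
proof -
  interpret prob_space M by fact
  interpret p: real_distribution p by fact
  note moments = assms(2) and b = assms(6) and distr = assms(7)
  have rv [measurable]: "random_variable borel (b i)" for i
    using b by (simp add: indep_vars_def)
  have int: "integrable p (\<lambda>x. x)" "integrable p (\<lambda>x. x\<^sup>2)" "integrable p (\<lambda>x. \<bar>x\<bar> ^ 3)"
    using moments[of 1] moments[of 2] integrable_abs[OF moments[of 3]] by (simp_all add: power_abs)
  have b8: "integrable M (\<lambda>\<omega>. b i \<omega> ^ 8)" "expectation (\<lambda>\<omega>. b i \<omega> ^ 8) = p.expectation (\<lambda>x. x ^ 8)" for i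
    using moments[of 8] unfolding distr[of i, symmetric] by (simp_all add: integrable_distr_eq integral_distr)
  have step: "AE \<omega> in M. (\<lambda>m. eig_mean m (step_fun u v) (\<lambda>i. b i \<omega>)) \<longlonglongrightarrow> integral\<^sup>L std_normal_distribution (step_fun u v)"
    if uv: "u < v" for u v
  proof -
    have B: "\<bar>step_fun u v y\<bar> \<le> 1" for y
      using step_fun_bounds[of u v y] by simp
    have meas: "step_fun u v \<in> borel_measurable borel"
      using isCont_step_fun[OF uv] by (intro borel_measurable_continuous_onI) (simp add: continuous_on_eq_continuous_at)
    have L: "\<bar>unit_step' ((y - u) / (v - u)) / (v - u)\<bar> \<le> 2 / (v - u)" for y
      using abs_unit_step'_le[of "(y - u) / (v - u)"] uv by (simp add: divide_right_mono)
    have lim: "(\<lambda>m. expectation (\<lambda>\<omega>. eig_mean m (step_fun u v) (\<lambda>i. b i \<omega>))) \<longlonglongrightarrow>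
        integral\<^sup>L std_normal_distribution (step_fun u v)"
      by (rule expectation_eig_mean_tendsto[OF b distr assms(1) int assms(3,4) isCont_step_fun[OF uv] B])
    have "AE \<omega> in M. (\<lambda>m. eig_mean m (step_fun u v) (\<lambda>i. b i \<omega>)
        - expectation (\<lambda>\<omega>. eig_mean m (step_fun u v) (\<lambda>i. b i \<omega>))) \<longlonglongrightarrow> 0"
      by (rule eig_mean_concentration[OF b b8(1) eq_refl[OF b8(2)] meas B L step_fun_taylor[OF uv]])
    then show ?thesis
    proof eventually_elim
      case (elim \<omega>)
      show ?case
        using tendsto_add[OF elim lim] by simp
    qed
  qed
  \<comment> \<open>Rational endpoints leave countably many test functions, so one null set serves
    all of them and thereby all real \<open>x\<close>.\<close>
  have "AE \<omega> in M. \<forall>u\<in>\<rat>. \<forall>v\<in>\<rat>. u < v \<longrightarrow>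
      (\<lambda>m. eig_mean m (step_fun u v) (\<lambda>i. b i \<omega>)) \<longlonglongrightarrow> integral\<^sup>L std_normal_distribution (step_fun u v)"
    using step by (simp add: AE_ball_countable countable_rat AE_impI)
  then have AE: "AE \<omega> in M. \<forall>x. (\<lambda>n. F (2 * n) \<omega> x) \<longlonglongrightarrow> std_normal_cdf x"
  proof eventually_elim
    case (elim \<omega>)
    show ?case
    proof
      fix x
      have lim: "(\<lambda>m. eig_mean m (step_fun u v) (\<lambda>i. b i \<omega>)) \<longlonglongrightarrow> integral\<^sup>L std_normal_distribution (step_fun u v)"
        if "u \<in> \<rat>" "v \<in> \<rat>" "u < v" for u v
        using elim that by blast
      have cont: "(std_normal_cdf \<longlongrightarrow> std_normal_cdf x) (at x)"
        using isCont_std_normal_cdf by (simp add: isCont_def)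
      have "(\<lambda>m. F (2 * m + 2) \<omega> x) \<longlonglongrightarrow> std_normal_cdf x"
      proof (rule order_tendstoI)
        fix a assume "std_normal_cdf x < a"
        \<comment> \<open>Continuity of the limit leaves room for rationals x < u < v at which the
          Gaussian distribution function is still below \<open>a\<close>; the Gaussian integral of
          the step is at most its value at \<open>v\<close>.\<close>
        then have "\<forall>\<^sub>F y in at_right x. std_normal_cdf y < a"
          by (rule order_tendstoD(2)[OF tendsto_within_subset[OF cont subset_UNIV]])
        then obtain c where c: "c > x" "\<And>y. x < y \<Longrightarrow> y < c \<Longrightarrow> std_normal_cdf y < a"
          unfolding eventually_at_right_field by auto
        obtain u where u: "u \<in> \<rat>" "x < u" "u < c"
          using Rats_dense_in_real[OF c(1)] by blast
        obtain v where v: "v \<in> \<rat>" "u < v" "v < c"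
          using Rats_dense_in_real[OF u(3)] by blast
        have "(\<lambda>m. 1 / real (2 * m + 2)) \<longlonglongrightarrow> 0"
          by real_asymp
        then have "(\<lambda>m. eig_mean m (step_fun u v) (\<lambda>i. b i \<omega>) + 1 / real (2 * m + 2)) \<longlonglongrightarrow>
            integral\<^sup>L std_normal_distribution (step_fun u v) + 0"
          by (intro tendsto_add lim u v)
        moreover have "integral\<^sup>L std_normal_distribution (step_fun u v) + 0 < a"
          using integral_step_fun_bounds(2)[OF v(2)] c(2)[of v] u v by simp
        ultimately have "\<forall>\<^sub>F m in sequentially. eig_mean m (step_fun u v) (\<lambda>i. b i \<omega>) + 1 / real (2 * m + 2) < a"
          by (rule order_tendstoD(2))
        then show "\<forall>\<^sub>F m in sequentially. F (2 * m + 2) \<omega> x < a"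
        proof eventually_elim
          case (elim m)
          then show ?case
            unfolding F_def using normalized_esd_step_bounds(1)[OF v(2), of x m "\<lambda>i. b i \<omega>"] u by simp
        qed
      next
        fix a assume "a < std_normal_cdf x"
        \<comment> \<open>Symmetrically, now u < v < x, and the Gaussian integral of the step is at
          least the value of the distribution function at \<open>u\<close>.\<close>
        then have "\<forall>\<^sub>F y in at_left x. a < std_normal_cdf y"
          by (rule order_tendstoD(1)[OF tendsto_within_subset[OF cont subset_UNIV]])
        then obtain c where c: "c < x" "\<And>y. c < y \<Longrightarrow> y < x \<Longrightarrow> a < std_normal_cdf y"
          unfolding eventually_at_left_field by auto
        obtain u where u: "u \<in> \<rat>" "c < u" "u < x"
          using Rats_dense_in_real[OF c(1)] by blast
        obtain v where v: "v \<in> \<rat>" "u < v" "v < x"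
          using Rats_dense_in_real[OF u(3)] by blast
        have "(\<lambda>m. real (2 * m + 1) / real (2 * m + 2)) \<longlonglongrightarrow> 1"
          by real_asymp
        then have "(\<lambda>m. eig_mean m (step_fun u v) (\<lambda>i. b i \<omega>) * (real (2 * m + 1) / real (2 * m + 2))) \<longlonglongrightarrow>
            integral\<^sup>L std_normal_distribution (step_fun u v) * 1"
          by (intro tendsto_mult lim u v)
        moreover have "a < integral\<^sup>L std_normal_distribution (step_fun u v) * 1"
          using integral_step_fun_bounds(1)[OF v(2)] c(2)[of u] u v by simp
        ultimately have "\<forall>\<^sub>F m in sequentially. a < eig_mean m (step_fun u v) (\<lambda>i. b i \<omega>) * (real (2 * m + 1) / real (2 * m + 2))"
          by (rule order_tendstoD(1))
        then show "\<forall>\<^sub>F m in sequentially. a < F (2 * m + 2) \<omega> x"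
        proof eventually_elim
          case (elim m)
          then show ?case
            unfolding F_def using normalized_esd_step_bounds(2)[OF v(2), of x m "\<lambda>i. b i \<omega>"] v by simp
        qed
      qed
      \<comment> \<open>The sizes \<open>2 * m + 2\<close> are all even numbers except 0, so only
        one term of the sequence has been skipped.\<close>
      then have "(\<lambda>m. F (2 * Suc m) \<omega> x) \<longlonglongrightarrow> std_normal_cdf x"
        by simp
      then show "(\<lambda>n. F (2 * n) \<omega> x) \<longlonglongrightarrow> std_normal_cdf x"
        by (rule LIMSEQ_imp_Suc)
    qed
  qed
  have meas: "random_variable borel (\<lambda>\<omega>. F (2 * n) \<omega> x)" for n x
    unfolding F_def by (rule normalized_esd_measurable) (rule rv)
  have AEx: "AE \<omega> in M. (\<lambda>n. F (2 * n) \<omega> x) \<longlonglongrightarrow> std_normal_cdf x" for x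
    using AE by eventually_elim simp
  show ?thesis
    using AE AE_tendsto_imp_converges_in_distribution[OF meas AEx] AE_tendsto_imp_converges_in_probability[OF meas AEx]
    by blast
qed

end
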